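(* Let $n\ge3$, $\emptyset\neq S\subseteq\{1,\dots,n-1\}$, $\mathfrak p:=\sum_{i\in S}\mathfrak p_i'$. Define the subgroup $$\mathcal E(\mathbb S_{n-1},\mathfrak p):=\prod_{|I|=2,\ I\in\mathcal J(\mathfrak p)}E_\infty(\mathbb S_{CI})\cdot(1+\mathfrak p\mathfrak p_n)^*_3$$ of $(1+\mathfrak p\mathfrak p_n)^*=\mathrm{GL}_\infty(\mathbb S_{n-1},\mathfrak p)$. Then $\mathcal E(\mathbb S_{n-1},\mathfrak p)=E_\infty(\mathbb S_{n-1},\mathfrak p)$.
   Context: $K$ is a field, $\mathbb N=\{0,1,\dots\}$. $\mathbb S_n$ is the $K$-algebra generated by $x_1,\dots,x_n,y_1,\dots,y_n$ with relations $y_ix_i=1$, $[x_i,y_j]=[x_i,x_j]=[y_i,y_j]=0$ ($i\ne j$). $E_{st}(i):=x_i^sy_i^t-x_i^{s+1}y_i^{t+1}$, $e_i:=E_{00}(i)$. For $I\subseteq\{1,\dots,n\}$ and $\alpha,\beta\in\mathbb N^I$, $E_{\alpha\beta}(I):=\prod_{i\in I}E_{\alpha_i\beta_i}(i)$; $CI$ is the complement of $I$; $\mathbb S_{CI}$ is the subalgebra generated by $x_k,y_k$, $k\in CI$; $E_\infty(\mathbb S_{CI})$ is the subgroup of $\mathbb S_n^*$ generated by all $1+aE_{\alpha\beta}(I)$, $a\in\mathbb S_{CI}$, $\alpha\ne\beta\in\mathbb N^I$. $\mathfrak p_i$ is the ideal of $\mathbb S_n$ generated by $e_i$, $\mathfrak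 p_I:=\prod_{i\in I}\mathfrak p_i$, $\mathfrak a_{n,s}:=\sum_{|I|=s}\mathfrak p_I$. For an ideal $\mathfrak b$ of $\mathbb S_n$, $(1+\mathfrak b)^*$ is the group of units of $\mathbb S_n$ in $1+\mathfrak b$. $\mathbb S_{n-1}$ is the subalgebra generated by $x_1,\dots,x_{n-1},y_1,\dots,y_{n-1}$; $\mathfrak p_i'$ the ideal of $\mathbb S_{n-1}$ generated by $e_i$. $\mathfrak p\mathfrak p_n:=\sum_{i\in S}\mathfrak p_i\mathfrak p_n$; $(1+\mathfrak p\mathfrak p_n)^*_s:=(1+\mathfrak p\mathfrak p_n)^*\cap(1+\mathfrak a_{n,s})^*$. $\mathcal J(\mathfrak p):=\{J\subseteq\{1,\dots,n\}: n\in J,\ J\cap S\ne\emptyset\}$. The product $\prod E_\infty(\mathbb S_{CI})$ is the set of products of elements of these subgroups in a fixed order. $\mathrm{GL}_\infty(\mathbb S_{n-1})$ is identified with $(1+\mathfrak p_n)^*$ via $(a_{kl})\mapsto1+\sum(a_{kl}-\delta_{kl})E_{kl}(n)$, and then $\mathrm{GL}_\infty(\mathbb S_{n-1},\mathfrak p):=\ker(\mathrm{GL}_\infty(\mathbb S_{n-1})\to\mathrm{GL}_\infty(\mathbb S_{n-1}/\mathfrak p))$ corresponds to $(1+\mathfrak p\mathfrak p_n)^*$. $E_\infty(\mathbb S_{n-1},\mathfrak p)$ is the relative elementary group: the normal subgroup of $E_\infty(\mathbb S_{n-1})$ generated by the matrices $1+aE_{kl}$ with $a\in\mathfrak p$,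 $k\ne l$. *)

theory Defs
  imports Main
begin

text \<open>Model of the Jacobson algebra: S_n is the monoid algebra over K of the
  n-th power of the bicyclic monoid; monomials x^a y^b are pairs of exponent
  functions (a, b), with x_i^a y_i^b x_i^c y_i^d = x_i^(a+(c-b)) y_i^((b-c)+d).
  Elements are functions from monomials to K with finite support.\<close>

type_synonym mon = "(nat \<Rightarrow> nat) \<times> (nat \<Rightarrow> nat)"
type_synonym 'k jel = "mon \<Rightarrow> 'k"

definition mmul :: "mon \<Rightarrow> mon \<Rightarrow> mon" where
  "mmul m1 m2 = ((\<lambda>i. fst m1 i + (fst m2 i - snd m1 i)),
                 (\<lambda>i. snd m2 i + (snd m1 i - fst m2 i)))"

definition jsupp :: "'k::field jel \<Rightarrow> mon set" where
  "jsupp f = {m. f m \<noteq> 0}"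

text \<open>Subalgebra generated by x_k, y_k for k in J (as a set of elements).\<close>
definition Jac :: "nat set \<Rightarrow> 'k::field jel set" where
  "Jac J = {f. finite (jsupp f) \<and>
      (\<forall>m\<in>jsupp f. \<forall>i. i \<notin> J \<longrightarrow> fst m i = 0 \<and> snd m i = 0)}"

definition Sn :: "nat \<Rightarrow> 'k::field jel set" where
  "Sn n = Jac {1..n}"

definition jmul :: "'k::field jel \<Rightarrow> 'k jel \<Rightarrow> 'k jel" where
  "jmul f g = (\<lambda>m. \<Sum>p\<in>{p. fst p \<in> jsupp f \<and> snd p \<in> jsupp g \<and> mmul (fst p) (snd p) = m}.
                  f (fst p) * g (snd p))"

definition jadd :: "'k::field jel \<Rightarrow> 'k jel \<Rightarrow> 'k jel" where
  "jadd f g = (\<lambda>m. f m + g m)"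

definition jsub :: "'k::field jel \<Rightarrow> 'k jel \<Rightarrow> 'k jel" where
  "jsub f g = (\<lambda>m. f m - g m)"

definition jneg :: "'k::field jel \<Rightarrow> 'k jel" where
  "jneg f = (\<lambda>m. - f m)"

definition jzero :: "'k::field jel" where
  "jzero = (\<lambda>m. 0)"

definition jone :: "'k::field jel" where
  "jone = (\<lambda>m. if m = ((\<lambda>_. 0), (\<lambda>_. 0)) then 1 else 0)"

definition jX :: "nat \<Rightarrow> 'k::field jel" where
  "jX i = (\<lambda>m. if m = ((\<lambda>j. if j = i then 1 else 0), (\<lambda>_. 0)) then 1 else 0)"

definition jY :: "nat \<Rightarrow> 'k::field jel" where
  "jY i = (\<lambda>m. if m = ((\<lambda>_. 0), (\<lambda>j. if j = i then 1 else 0)) then 1 else 0)"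

primrec jpow :: "'k::field jel \<Rightarrow> nat \<Rightarrow> 'k jel" where
  "jpow f 0 = jone"
| "jpow f (Suc k) = jmul (jpow f k) f"

definition Est :: "nat \<Rightarrow> nat \<Rightarrow> nat \<Rightarrow> 'k::field jel" where
  "Est i s t = jsub (jmul (jpow (jX i) s) (jpow (jY i) t))
                    (jmul (jpow (jX i) (s+1)) (jpow (jY i) (t+1)))"

definition je :: "nat \<Rightarrow> 'k::field jel" where
  "je i = Est i 0 0"

definition EI :: "nat set \<Rightarrow> (nat \<Rightarrow> nat) \<Rightarrow> (nat \<Rightarrow> nat) \<Rightarrow> 'k::field jel" where
  "EI I \<alpha> \<beta> = foldr (\<lambda>i acc. jmul (Est i (\<alpha> i) (\<beta> i)) acc) (sorted_list_of_set I) jone"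

inductive_set ideal_gen :: "'k::field jel set \<Rightarrow> 'k jel set \<Rightarrow> 'k jel set"
  for R X where
  ig_zero: "jzero \<in> ideal_gen R X"
| ig_gen: "x \<in> X \<Longrightarrow> x \<in> ideal_gen R X"
| ig_add: "a \<in> ideal_gen R X \<Longrightarrow> b \<in> ideal_gen R X \<Longrightarrow> jadd a b \<in> ideal_gen R X"
| ig_neg: "a \<in> ideal_gen R X \<Longrightarrow> jneg a \<in> ideal_gen R X"
| ig_lmul: "a \<in> ideal_gen R X \<Longrightarrow> r \<in> R \<Longrightarrow> jmul r a \<in> ideal_gen R X"
| ig_rmul: "a \<in> ideal_gen R X \<Longrightarrow> r \<in> R \<Longrightarrow> jmul a r \<in> ideal_gen R X"

definition ideal_prod :: "'k::field jel set \<Rightarrow> 'k jel set \<Rightarrow> 'k jel set \<Rightarrow> 'k jel set" where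
  "ideal_prod R A B = ideal_gen R {jmul a b | a b. a \<in> A \<and> b \<in> B}"

definition pid :: "nat \<Rightarrow> nat \<Rightarrow> 'k::field jel set" where
  "pid n i = ideal_gen (Sn n) {je i}"

definition pI :: "nat \<Rightarrow> nat set \<Rightarrow> 'k::field jel set" where
  "pI n I = foldr (\<lambda>i acc. ideal_prod (Sn n) (pid n i) acc) (sorted_list_of_set I) (Sn n)"

definition ans :: "nat \<Rightarrow> nat \<Rightarrow> 'k::field jel set" where
  "ans n s = ideal_gen (Sn n) (\<Union>{pI n I | I. I \<subseteq> {1..n} \<and> card I = s})"

definition pS :: "nat \<Rightarrow> nat set \<Rightarrow> 'k::field jel set" where
  "pS n S = ideal_gen (Sn (n-1)) (\<Union>i\<in>S. ideal_gen (Sn (n-1)) {je i})"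

definition ppn :: "nat \<Rightarrow> nat set \<Rightarrow> 'k::field jel set" where
  "ppn n S = ideal_gen (Sn n) (\<Union>i\<in>S. ideal_prod (Sn n) (pid n i) (pid n n))"

definition Units :: "nat \<Rightarrow> 'k::field jel set" where
  "Units n = {u \<in> Sn n. \<exists>v\<in>Sn n. jmul u v = jone \<and> jmul v u = jone}"

definition one_plus_units :: "nat \<Rightarrow> 'k::field jel set \<Rightarrow> 'k jel set" where
  "one_plus_units n b = {u \<in> Units n. jsub u jone \<in> b}"

definition jinv :: "'k::field jel \<Rightarrow> 'k jel" where
  "jinv u = (SOME v. jmul u v = jone \<and> jmul v u = jone)"

inductive_set grp_gen :: "'k::field jel set \<Rightarrow> 'k jel set" for X where
  gg_one: "jone \<in> grp_gen X"
| gg_mul: "g \<in> grp_gen X \<Longrightarrow> x \<in> X \<Longrightarrow> jmul g x \<in> grp_gen X"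
| gg_inv: "g \<in> grp_gen X \<Longrightarrow> x \<in> X \<Longrightarrow> jmul g (jinv x) \<in> grp_gen X"

definition Einf :: "nat \<Rightarrow> nat set \<Rightarrow> 'k::field jel set" where
  "Einf n I = grp_gen {jadd jone (jmul a (EI I \<alpha> \<beta>)) | a \<alpha> \<beta>.
                         a \<in> Jac ({1..n} - I) \<and> (\<exists>i\<in>I. \<alpha> i \<noteq> \<beta> i)}"

text \<open>E_infty(S_{n-1}) inside (1+p_n)^*: generated by 1 + a E_kl(n), a in S_{n-1}, k \<noteq> l.\<close>
definition Eel :: "nat \<Rightarrow> 'k::field jel set" where
  "Eel n = grp_gen {jadd jone (jmul a (Est n k l)) | a k l. a \<in> Sn (n-1) \<and> k \<noteq> l}"

definition Erel :: "nat \<Rightarrow> 'k::field jel set \<Rightarrow> 'k jel set" where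
  "Erel n p = grp_gen {jmul (jmul g (jadd jone (jmul a (Est n k l)))) (jinv g) | g a k l.
                         g \<in> Eel n \<and> a \<in> p \<and> k \<noteq> l}"

definition setprod_list :: "'k::field jel set list \<Rightarrow> 'k jel set" where
  "setprod_list As = foldr (\<lambda>A B. {jmul a b | a b. a \<in> A \<and> b \<in> B}) As {jone}"

end

theory Submission
  imports Defs "HOL-Library.Poly_Mapping" "HOL-Library.FuncSet"
begin

text \<open>
  Write \<open>p_I\<close> for the product of the ideals \<open>p_i\<close> with \<open>i \<in> I\<close>.  The elementary group of
  \<open>I = {i, n}\<close> is normal in the whole unit group: if \<open>g\<close> is a unit and \<open>a E\<close> is an off-diagonal
  matrix unit with coefficient, then \<open>g (1 + a E) g\<^sup>-\<^sup>1 = 1 + c r\<close> with a column \<open>c\<close> and a row \<open>r\<close>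
  such that \<open>r c = 0\<close>, and this is the commutator of \<open>1 + c\<close> and \<open>1 + r\<close> once \<open>c\<close> and \<open>r\<close> are
  routed through an index beyond their supports.  Hence the relative elementary group is the
  product of the groups of the pairs \<open>{i, n}\<close>, \<open>i \<in> S\<close>, and what remains is to show that this
  product contains every unit congruent to \<open>1\<close> modulo the sum of the \<open>p_J\<close>, \<open>J = {i, j, n}\<close>.

  These ideals are removed one at a time.  Modulo the earlier ones such a unit is \<open>1 + w\<close> with
  \<open>w \<in> p_J\<close>, and after conjugation by a permutation matrix \<open>w = W e_j\<close>, where \<open>W\<close> does not involve
  the variable \<open>j\<close>.  With \<open>h = 1 + W\<close> the unit \<open>1 + W e_j\<close> is the commutator of \<open>diag(h, 1)\<close> and a
  matrix over the subalgebra generated by \<open>x_j\<close> and \<open>y_j\<close>, both of which dilate to products of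
  elementary matrices; these products lift from the quotient.  The argument is the vanishing of the
  map from \<open>K_1\<close> of a ring to \<open>K_1\<close> of its Toeplitz extension.
\<close>

section \<open>The algebra as a monoid algebra\<close>

text \<open>Why \<open>1 + W e_j\<close> is elementary: put \<open>x = x_j\<close>,
  \<open>y = y_j\<close>, \<open>e = 1 - x y\<close>. The ring \<open>R\<close> is the sum of the
  right ideals \<open>x R\<close> and \<open>e R\<close>. Since \<open>h = 1 + W\<close> commutes
  with \<open>x\<close> and \<open>y\<close>, it preserves both, and \<open>x\<close> identifies its
  action on \<open>R\<close> with that on \<open>x R\<close>. In \<open>K_1\<close> the class of
  \<open>h\<close> is therefore itself plus the class of \<open>1 + W e\<close>. The obstacle is
  that \<open>h\<close> is invertible only modulo the ideal \<open>q\<close> of the remaining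
  triples, and that the unit at first yields relations for \<open>W e_j\<close> only. These must be
  divided by \<open>e_j\<close> modulo \<open>q\<close>, which needs a hold on \<open>q\<close>
  inside \<open>p_i p_n\<close>: there it is the kernel of an explicit linear reduction. The
  elementary factors, in contrast, are written over the algebra itself, so that they are lifts from
  the start. Room for larger matrices costs nothing, as the indices of the variable \<open>n\<close>
  are unbounded: a shift by \<open>x_n^D\<close> gives an orthogonal copy of any finite
  corner.\<close>

abbreviation keys :: "('a \<Rightarrow>\<^sub>0 'b::zero) \<Rightarrow> 'a set" where "keys \<equiv> Poly_Mapping.keys"
abbreviation lookup :: "('a \<Rightarrow>\<^sub>0 'b::zero) \<Rightarrow> 'a \<Rightarrow> 'b" where "lookup \<equiv> Poly_Mapping.lookup"
abbreviation single :: "'a \<Rightarrow> 'b \<Rightarrow> ('a \<Rightarrow>\<^sub>0 'b::zero)" where "single \<equiv> Poly_Mapping.single"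

text \<open>A type of its own, because multiplication of finitely supported maps runs along the
  \<open>+\<close> of the exponent type, which here has to be the noncommutative bicyclic
  law.\<close>

datatype bic = Bic (xexp: "nat \<Rightarrow> nat") (yexp: "nat \<Rightarrow> nat")

instantiation bic :: monoid_add
begin

definition zero_bic :: bic where
  "zero_bic = Bic (\<lambda>_. 0) (\<lambda>_. 0)"

definition plus_bic :: "bic \<Rightarrow> bic \<Rightarrow> bic" where
  "plus_bic m1 m2 = Bic (\<lambda>i. xexp m1 i + (xexp m2 i - yexp m1 i))
                        (\<lambda>i. yexp m2 i + (yexp m1 i - xexp m2 i))"

instance
proof
  fix a b c :: bic
  show "a + b + c = a + (b + c)"
    by (auto simp: plus_bic_def fun_eq_iff)
  show "0 + a = a" "a + 0 = a"
    by (simp_all add: plus_bic_def zero_bic_def)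
qed

end

type_synonym 'k alg = "bic \<Rightarrow>\<^sub>0 'k"

definition alg_on :: "nat set \<Rightarrow> 'k::field alg set" where
  "alg_on V = {f. \<forall>m\<in>keys f. \<forall>i. i \<notin> V \<longrightarrow> xexp m i = 0 \<and> yexp m i = 0}"

lemma alg_sum_monomials: "f = (\<Sum>m\<in>keys f. single m (lookup f m))"
  by (rule poly_mapping_eqI)
    (auto simp: lookup_sum lookup_single when_def in_keys_iff sum.delta[OF finite_keys])

lemma alg_on_induct [consumes 1, case_names zero single add]:
  assumes "f \<in> alg_on V"
    and "P 0"
    and "\<And>m c. (\<forall>i. i \<notin> V \<longrightarrow> xexp m i = 0 \<and> yexp m i = 0) \<Longrightarrow> P (single m c)"
    and "\<And>f g. P f \<Longrightarrow> P g \<Longrightarrow> P (f + g)"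
  shows "P f"
proof -
  have "P (\<Sum>m\<in>A. single m (lookup f m))" if "finite A" "A \<subseteq> keys f" for A
    using that
  proof (induction A rule: finite_induct)
    case (insert m A)
    then show ?case
      using assms(1,3,4) by (auto simp: alg_on_def)
  qed (simp add: assms(2))
  then show ?thesis
    using alg_sum_monomials[of f] by (metis finite_keys order_refl)
qed

lemma alg_on_UNIV: "f \<in> alg_on UNIV"
  by (simp add: alg_on_def)

lemma alg_on_0 [simp]: "0 \<in> alg_on V"
  by (simp add: alg_on_def)

lemma alg_on_1 [simp]: "1 \<in> alg_on V"
  by (simp add: alg_on_def zero_bic_def)

lemma alg_on_add: "f \<in> alg_on V \<Longrightarrow> g \<in> alg_on V \<Longrightarrow> f + g \<in> alg_on V"
  using keys_add[of f g] unfolding alg_on_def by blast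

lemma alg_on_uminus: "f \<in> alg_on V \<Longrightarrow> - f \<in> alg_on V"
  by (simp add: alg_on_def in_keys_iff)

lemma alg_on_diff: "f \<in> alg_on V \<Longrightarrow> g \<in> alg_on V \<Longrightarrow> f - g \<in> alg_on V"
  using alg_on_add[of f V "- g"] by (simp add: alg_on_uminus)

lemma alg_on_mult:
  assumes "f \<in> alg_on V" "g \<in> alg_on V"
  shows "f * g \<in> alg_on V"
  unfolding alg_on_def
proof (intro CollectI ballI allI impI)
  fix m i assume "m \<in> keys (f * g)" "i \<notin> V"
  then obtain a b where "m = a + b" "a \<in> keys f" "b \<in> keys g"
    using keys_mult[of f g] by blast
  then show "xexp m i = 0 \<and> yexp m i = 0"
    using assms \<open>i \<notin> V\<close> by (auto simp: alg_on_def plus_bic_def)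
qed

lemma alg_on_power: "f \<in> alg_on V \<Longrightarrow> f ^ k \<in> alg_on V"
  by (induction k) (simp_all add: alg_on_mult)

lemma alg_on_sum: "(\<And>a. a \<in> A \<Longrightarrow> f a \<in> alg_on V) \<Longrightarrow> sum f A \<in> alg_on V"
  by (induction A rule: infinite_finite_induct) (simp_all add: alg_on_add)

lemma alg_on_mono: "V \<subseteq> V' \<Longrightarrow> alg_on V \<subseteq> alg_on V'"
  unfolding alg_on_def by blast

lemma alg_on_single:
  "(\<forall>i. i \<notin> V \<longrightarrow> xexp m i = 0 \<and> yexp m i = 0) \<Longrightarrow> single m c \<in> alg_on V"
  by (simp add: alg_on_def)

lemma bic_commute:
  assumes "\<And>i. i \<notin> V \<Longrightarrow> xexp a i = 0 \<and> yexp a i = 0"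
    and "\<And>i. i \<notin> V' \<Longrightarrow> xexp b i = 0 \<and> yexp b i = 0" "V \<inter> V' = {}"
  shows "a + b = b + a"
proof -
  have "xexp a i = 0 \<and> yexp a i = 0 \<or> xexp b i = 0 \<and> yexp b i = 0" for i
    using assms by blast
  then have "xexp a i + (xexp b i - yexp a i) = xexp b i + (xexp a i - yexp b i)"
    "yexp b i + (yexp a i - xexp b i) = yexp a i + (yexp b i - xexp a i)" for i
    by (metis add.commute diff_0_eq_0 diff_zero)+
  then show ?thesis
    by (simp add: plus_bic_def)
qed

lemma alg_on_commute:
  assumes "f \<in> alg_on V" "g \<in> alg_on V'" "V \<inter> V' = {}"
  shows "f * g = g * f"
  using assms(1)
proof (induction rule: alg_on_induct)
  case (single m c)
  show ?case
    using assms(2)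
  proof (induction rule: alg_on_induct)
    case (single m' c')
    then show ?case
      using bic_commute[of V m V' m'] \<open>\<forall>i. i \<notin> V \<longrightarrow> xexp m i = 0 \<and> yexp m i = 0\<close> assms(3)
      by (simp add: mult_single mult.commute)
  qed (simp_all add: distrib_left distrib_right)
qed (simp_all add: distrib_left distrib_right)

section \<open>Generators and matrix units of one variable\<close>

definition X :: "nat \<Rightarrow> 'k::field alg" where
  "X i = single (Bic (\<lambda>j. if j = i then 1 else 0) (\<lambda>_. 0)) 1"

definition Y :: "nat \<Rightarrow> 'k::field alg" where
  "Y i = single (Bic (\<lambda>_. 0) (\<lambda>j. if j = i then 1 else 0)) 1"

lemma X_power: "X i ^ s = single (Bic (\<lambda>j. if j = i then s else 0) (\<lambda>_. 0)) 1"
proof (induction s)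
  case 0
  then show ?case by (simp add: zero_bic_def[symmetric] if_cancel)
next
  case (Suc s)
  then show ?case by (auto simp: X_def mult_single plus_bic_def fun_eq_iff
        intro!: arg_cong[where f = "\<lambda>m. single m 1"])
qed

lemma Y_power: "Y i ^ s = single (Bic (\<lambda>_. 0) (\<lambda>j. if j = i then s else 0)) 1"
proof (induction s)
  case 0
  then show ?case by (simp add: zero_bic_def[symmetric] if_cancel)
next
  case (Suc s)
  then show ?case by (auto simp: Y_def mult_single plus_bic_def fun_eq_iff
        intro!: arg_cong[where f = "\<lambda>m. single m 1"])
qed

lemma X_in: "i \<in> V \<Longrightarrow> X i \<in> alg_on V"
  unfolding X_def by (rule alg_on_single) auto

lemma Y_in: "i \<in> V \<Longrightarrow> Y i \<in> alg_on V"
  unfolding Y_def by (rule alg_on_single) auto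

lemma Y_X [simp]: "Y i * X i = 1"
  by (simp add: X_def Y_def mult_single plus_bic_def zero_bic_def[symmetric] single_one[symmetric] del: single_one)

definition E :: "nat \<Rightarrow> nat \<Rightarrow> nat \<Rightarrow> 'k::field alg" where
  "E i s t = X i ^ s * Y i ^ t - X i ^ (s + 1) * Y i ^ (t + 1)"

abbreviation e0 :: "nat \<Rightarrow> 'k::field alg" where
  "e0 i \<equiv> E i 0 0"

text \<open>The identity matrix of size \<open>d\<close> (see \<open>sum_E\<close>): multiplication
  by it cuts the matrix indices of the variable \<open>i\<close> down to those below
  \<open>d\<close>.\<close>

definition trunc :: "nat \<Rightarrow> nat \<Rightarrow> 'k::field alg" where
  "trunc i d = 1 - X i ^ d * Y i ^ d"

lemmas alg_intros = alg_on_0 alg_on_1 alg_on_add alg_on_uminus alg_on_diff alg_on_mult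
  alg_on_power alg_on_sum X_in Y_in

lemma E_in: "i \<in> V \<Longrightarrow> E i s t \<in> alg_on V"
  unfolding E_def by (intro alg_intros)

lemma trunc_in: "i \<in> V \<Longrightarrow> trunc i d \<in> alg_on V"
  unfolding trunc_def by (intro alg_intros)

lemma Y_power_X_power: "Y i ^ a * X i ^ a = (1 :: 'k::field alg)"
proof (induction a)
  case (Suc a)
  have "Y i ^ Suc a * X i ^ Suc a = Y i ^ a * (Y i * X i) * (X i ^ a :: 'k alg)"
    by (subst power_Suc2[of "Y i"]) (simp only: power_Suc mult.assoc)
  then show ?case using Suc by simp
qed simp

lemma Y_power_X_power_le:
  assumes "a \<le> b"
  shows "Y i ^ a * X i ^ b = (X i ^ (b - a) :: 'k::field alg)"
proof -
  have "Y i ^ a * X i ^ (a + (b - a)) = Y i ^ a * X i ^ a * (X i ^ (b - a) :: 'k alg)"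
    by (simp only: power_add mult.assoc)
  then show ?thesis
    using assms by (simp add: Y_power_X_power)
qed

lemma Y_power_X_power_ge:
  assumes "b \<le> a"
  shows "Y i ^ a * X i ^ b = (Y i ^ (a - b) :: 'k::field alg)"
proof -
  have "Y i ^ (a - b + b) * X i ^ b = Y i ^ (a - b) * (Y i ^ b * X i ^ b :: 'k alg)"
    by (simp only: power_add mult.assoc)
  then show ?thesis
    using assms by (simp add: Y_power_X_power)
qed

lemma E_eq: "E i s t = X i ^ s * (1 - X i * Y i) * (Y i ^ t :: 'k::field alg)"
proof -
  have "X i ^ (s + 1) * Y i ^ (t + 1) = X i ^ s * (X i * Y i) * (Y i ^ t :: 'k alg)"
    unfolding Suc_eq_plus1[symmetric]
    by (subst power_Suc2) (simp only: power_Suc mult.assoc)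
  then show ?thesis
    unfolding E_def by (simp only: right_diff_distrib left_diff_distrib mult_1_right)
qed

lemma Y_e0: "Y i * (1 - X i * Y i) = 0"
  by (simp add: right_diff_distrib flip: mult.assoc)

lemma e0_X: "(1 - X i * Y i) * X i = 0"
  by (simp add: left_diff_distrib mult.assoc)

lemma X_power_E: "X i ^ a * E i s t = E i (a + s) t"
  by (simp add: E_eq power_add mult.assoc)

lemma E_Y_power: "E i s t * Y i ^ a = E i s (t + a)"
  by (simp add: E_eq power_add mult.assoc)

lemma Y_power_E: "Y i ^ a * E i s t = (if a \<le> s then E i (s - a) t else (0 :: 'k::field alg))"
proof (cases "a \<le> s")
  case True
  then show ?thesis
    by (simp add: E_eq Y_power_X_power_le flip: mult.assoc)
next
  case False
  then obtain b where b: "a - s = Suc b"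
    by (metis Suc_diff_Suc not_le)
  have "Y i ^ a * E i s t = Y i ^ (a - s) * (1 - X i * Y i) * (Y i ^ t :: 'k alg)"
    using False by (simp add: E_eq Y_power_X_power_ge flip: mult.assoc)
  also have "\<dots> = 0"
    unfolding b power_Suc2 by (simp only: mult.assoc Y_e0[THEN arg_cong[where f = "\<lambda>z. z * Y i ^ t"], unfolded mult.assoc]) simp
  finally show ?thesis using False by simp
qed

lemma E_X_power: "E i s t * X i ^ a = (if a \<le> t then E i s (t - a) else (0 :: 'k::field alg))"
proof (cases "a \<le> t")
  case True
  then show ?thesis
    by (simp add: E_eq Y_power_X_power_ge mult.assoc)
next
  case False
  then obtain b where b: "a - t = Suc b"
    by (metis Suc_diff_Suc not_le)
  have "E i s t * X i ^ a = X i ^ s * ((1 - X i * Y i) * X i ^ (a - t) :: 'k alg)"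
    using False by (simp add: E_eq Y_power_X_power_le mult.assoc)
  also have "\<dots> = 0"
    unfolding b power_Suc by (simp add: e0_X flip: mult.assoc)
  finally show ?thesis using False by simp
qed

lemma E_mult: "E i s t * E i u v = (if t = u then E i s v else (0 :: 'k::field alg))"
proof (cases "t \<le> u")
  case True
  have "E i s t * E i u v = E i s t * X i ^ u * (E i 0 v :: 'k alg)"
    by (simp add: X_power_E mult.assoc)
  also have "\<dots> = (if t = u then E i s 0 * E i 0 v else 0)"
    using True by (auto simp: E_X_power)
  also have "E i s 0 * E i 0 v = X i ^ s * ((1 - X i * Y i) * (1 - X i * Y i)) * (Y i ^ v :: 'k alg)"
    by (simp add: E_eq mult.assoc)
  also have "(1 - X i * Y i) * (1 - X i * Y i) = (1 - X i * Y i :: 'k alg)"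
    unfolding left_diff_distrib[of 1 _ "1 - X i * Y i"] by (simp only: mult.assoc Y_e0) simp
  finally show ?thesis
    by (simp only: E_eq)
next
  case False
  have "E i s t * E i u v = E i s 0 * (Y i ^ t * E i u v :: 'k alg)"
    by (simp add: E_Y_power flip: mult.assoc)
  then show ?thesis
    using False by (simp add: Y_power_E)
qed

lemma trunc_E: "trunc i d * E i s t = (if s < d then E i s t else 0)"
  by (auto simp: trunc_def left_diff_distrib mult.assoc Y_power_E X_power_E)

lemma E_trunc: "E i s t * trunc i d = (if t < d then E i s t else 0)"
  by (auto simp: trunc_def right_diff_distrib E_X_power E_Y_power simp flip: mult.assoc)

lemma sum_E: "(\<Sum>s<d. E i s s) = trunc i d"
  by (induction d) (simp_all add: trunc_def E_def)

lemma trunc_idem: "trunc i d * trunc i d = (trunc i d :: 'k::field alg)"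
proof -
  have "Y i ^ d * (1 - X i ^ d * Y i ^ d) = (0 :: 'k alg)"
    by (simp add: right_diff_distrib Y_power_X_power flip: mult.assoc)
  then show ?thesis
    by (simp add: trunc_def left_diff_distrib mult.assoc)
qed

section \<open>Matrix ideals and elementary groups\<close>

definition ideal_of :: "nat set \<Rightarrow> 'k::field alg set \<Rightarrow> bool" where
  "ideal_of V A \<longleftrightarrow> A \<subseteq> alg_on V \<and> 0 \<in> A \<and> (\<forall>a\<in>A. \<forall>b\<in>A. a + b \<in> A) \<and>
     (\<forall>a\<in>A. \<forall>r\<in>alg_on V. r * a \<in> A \<and> a * r \<in> A)"

lemma ideal_ofD:
  assumes "ideal_of V A"
  shows "a \<in> A \<Longrightarrow> a \<in> alg_on V" "0 \<in> A" "a \<in> A \<Longrightarrow> b \<in> A \<Longrightarrow> a + b \<in> A"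
    "a \<in> A \<Longrightarrow> r \<in> alg_on V \<Longrightarrow> r * a \<in> A" "a \<in> A \<Longrightarrow> r \<in> alg_on V \<Longrightarrow> a * r \<in> A"
  using assms unfolding ideal_of_def by blast+

lemma ideal_uminus: "ideal_of V A \<Longrightarrow> a \<in> A \<Longrightarrow> - a \<in> A"
  using ideal_ofD(4)[of V A a "- 1"] by (simp add: alg_on_uminus)

lemma ideal_diff: "ideal_of V A \<Longrightarrow> a \<in> A \<Longrightarrow> b \<in> A \<Longrightarrow> a - b \<in> A"
  using ideal_ofD(3)[of V A a "- b"] by (simp add: ideal_uminus)

lemma ideal_sum: "ideal_of V A \<Longrightarrow> (\<And>x. x \<in> I \<Longrightarrow> f x \<in> A) \<Longrightarrow> sum f I \<in> A"
  by (induction I rule: infinite_finite_induct) (simp_all add: ideal_ofD)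

lemma ideal_of_alg_on: "ideal_of V (alg_on V)"
  by (auto simp: ideal_of_def alg_on_add alg_on_mult)

lemma single_split:
  "single m c = single (Bic ((xexp m)(j := 0)) ((yexp m)(j := 0))) c * X j ^ xexp m j * Y j ^ yexp m j"
  by (cases m) (auto simp: X_power Y_power mult_single plus_bic_def fun_eq_iff
      intro!: arg_cong[where f = "\<lambda>m. single m c"])

lemma alg_on_split_induct [consumes 1, case_names zero mono add]:
  assumes "f \<in> alg_on V"
    and "P 0"
    and "\<And>g a b. g \<in> alg_on (V - {j}) \<Longrightarrow> P (g * X j ^ a * Y j ^ b)"
    and "\<And>f g. P f \<Longrightarrow> P g \<Longrightarrow> P (f + g)"
  shows "P f"
  using assms(1)
proof (induction rule: alg_on_induct)
  case (single m c)
  show ?case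
    unfolding single_split[of m c j]
    using single by (intro assms(3) alg_on_single) auto
qed (use assms in auto)

text \<open>The finitely supported infinite matrices over \<open>A\<close>, indexed by the variable
  \<open>j\<close>. With \<open>A\<close> the algebra in all other variables this is
  \<open>p_j\<close>.\<close>

inductive_set mat_ext :: "nat \<Rightarrow> 'k::field alg set \<Rightarrow> 'k alg set" for j A where
  mat_ext_zero: "0 \<in> mat_ext j A"
| mat_ext_gen: "c \<in> A \<Longrightarrow> c * E j s t \<in> mat_ext j A"
| mat_ext_add: "a \<in> mat_ext j A \<Longrightarrow> b \<in> mat_ext j A \<Longrightarrow> a + b \<in> mat_ext j A"

lemma alg_commute_var:
  assumes "f \<in> alg_on (V - {j})" "g \<in> alg_on {j}"
  shows "f * g = g * f"
  by (rule alg_on_commute[OF assms]) auto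

text \<open>A monomial \<open>x_j^a y_j^b\<close> times a matrix unit is again a matrix unit or
  \<open>0\<close>, and the part of a multiplier without \<open>j\<close> passes through to the
  coefficient.\<close>

lemma ideal_of_mat_ext:
  fixes A :: "'k::field alg set"
  assumes A: "ideal_of (V - {j}) A" and j: "j \<in> V"
  shows "ideal_of V (mat_ext j A)"
proof -
  have sub: "mat_ext j A \<subseteq> alg_on V"
  proof
    fix f assume "f \<in> mat_ext j A"
    then show "f \<in> alg_on V"
    proof induction
      case (mat_ext_gen c s t)
      then show ?case
        using ideal_ofD(1)[OF A] alg_on_mono[of "V - {j}" V] j
        by (intro alg_on_mult E_in) auto
    qed (auto intro: alg_on_add)
  qed
  have XY: "X j ^ a * Y j ^ b \<in> alg_on {j}" for a b
    by (intro alg_intros) auto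
  have gen: "c * (X j ^ a * Y j ^ b * E j s t) \<in> mat_ext j A"
    "c * (E j s t * (X j ^ a * Y j ^ b)) \<in> mat_ext j A" if "c \<in> A" for c a b s t
  proof -
    have "X j ^ a * Y j ^ b * E j s t = (if b \<le> s then E j (a + (s - b)) t else (0 :: 'k alg))"
      by (simp add: mult.assoc Y_power_E X_power_E)
    moreover have "E j s t * (X j ^ a * Y j ^ b) = (if a \<le> t then E j s (t - a + b) else (0 :: 'k alg))"
      by (simp add: E_X_power E_Y_power flip: mult.assoc)
    ultimately show "c * (X j ^ a * Y j ^ b * E j s t) \<in> mat_ext j A"
      "c * (E j s t * (X j ^ a * Y j ^ b)) \<in> mat_ext j A"
      using that mat_ext_gen[of c A j] mat_ext_zero[of j A] by simp_all
  qed
  have "r * f \<in> mat_ext j A \<and> f * r \<in> mat_ext j A" if f: "f \<in> mat_ext j A" and r: "r \<in> alg_on V" for f r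
    using f
  proof induction
    case (mat_ext_gen c s t)
    have cV: "c \<in> alg_on (V - {j})" using ideal_ofD(1)[OF A mat_ext_gen] .
    show ?case
      using r
    proof (induction rule: alg_on_split_induct[where j = j])
      case (mono g a b)
      have "g * X j ^ a * Y j ^ b * (c * E j s t) = g * (X j ^ a * Y j ^ b * c) * E j s t"
        by (simp add: mult.assoc)
      also have "X j ^ a * Y j ^ b * c = c * (X j ^ a * Y j ^ b)"
        by (rule alg_commute_var[OF cV XY, symmetric])
      finally have 1: "g * X j ^ a * Y j ^ b * (c * E j s t) = g * c * (X j ^ a * Y j ^ b * E j s t)"
        by (simp add: mult.assoc)
      have "c * E j s t * (g * X j ^ a * Y j ^ b) = c * (E j s t * g) * (X j ^ a * Y j ^ b)"
        by (simp add: mult.assoc)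
      also have "E j s t * g = g * E j s t"
        by (rule alg_commute_var[OF mono, symmetric]) (simp add: E_in)
      finally have 2: "c * E j s t * (g * X j ^ a * Y j ^ b) = c * g * (E j s t * (X j ^ a * Y j ^ b))"
        by (simp add: mult.assoc)
      show ?case
        unfolding 1 2 using gen ideal_ofD(4,5)[OF A mat_ext_gen mono] by blast
    qed (auto simp: distrib_left distrib_right intro: mat_ext.intros)
  qed (auto simp: distrib_left distrib_right intro: mat_ext.intros)
  then show ?thesis
    unfolding ideal_of_def using sub mat_ext_zero mat_ext_add by blast
qed

text \<open>The ideal \<open>p_i p_n\<close>, as matrices in the indices of \<open>n\<close> whose
  entries are matrices in the indices of \<open>i\<close>.\<close>

definition pair_ideal :: "nat set \<Rightarrow> nat \<Rightarrow> nat \<Rightarrow> 'k::field alg set" where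
  "pair_ideal V i n = mat_ext n (mat_ext i (alg_on (V - {n} - {i})))"

lemma ideal_of_pair_ideal:
  assumes "i \<in> V" "n \<in> V" "i \<noteq> n"
  shows "ideal_of V (pair_ideal V i n)"
  unfolding pair_ideal_def
  using assms by (intro ideal_of_mat_ext ideal_of_alg_on) auto

lemma pair_ideal_gen: "a \<in> alg_on (V - {n} - {i}) \<Longrightarrow> a * E i s t * E n k l \<in> pair_ideal V i n"
  unfolding pair_ideal_def by (intro mat_ext_gen)

lemma pair_ideal_induct [consumes 1, case_names zero gen add]:
  assumes "f \<in> pair_ideal V i n"
    and "P 0"
    and gen: "\<And>a s t k l. a \<in> alg_on (V - {n} - {i}) \<Longrightarrow> P (a * E i s t * E n k l)"
    and add: "\<And>f g. P f \<Longrightarrow> P g \<Longrightarrow> P (f + g)"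
  shows "P f"
  using assms(1) unfolding pair_ideal_def
proof (induction rule: mat_ext.induct)
  case (mat_ext_gen c s t)
  then show ?case
    by (induction rule: mat_ext.induct) (auto simp: distrib_right assms(2) gen add)
qed (auto simp: assms(2) add)

text \<open>The group \<^const>\<open>Einf\<close> of the pair \<open>{i, n}\<close>.  The inverse of a generator is again a generator,
  so the generated monoid is already a group.\<close>

inductive_set elem_grp :: "nat set \<Rightarrow> nat \<Rightarrow> nat \<Rightarrow> 'k::field alg set" for V i n where
  elem_grp_one: "1 \<in> elem_grp V i n"
| elem_grp_mul: "g \<in> elem_grp V i n \<Longrightarrow> a \<in> alg_on (V - {n} - {i}) \<Longrightarrow> (s, k) \<noteq> (t, l) \<Longrightarrow>
    g * (1 + a * E i s t * E n k l) \<in> elem_grp V i n"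

lemma elem_grp_mult:
  assumes "f \<in> elem_grp V i n" "g \<in> elem_grp V i n"
  shows "f * g \<in> elem_grp V i n"
  using assms(2) by induction (simp_all add: assms(1) elem_grp_mul flip: mult.assoc)

lemma elem_grp_gen: "a \<in> alg_on (V - {n} - {i}) \<Longrightarrow> (s, k) \<noteq> (t, l) \<Longrightarrow> 1 + a * E i s t * E n k l \<in> elem_grp V i n"
  using elem_grp_mul[OF elem_grp_one] by (metis mult_1)

definition inv_pair :: "nat set \<Rightarrow> 'k::field alg \<Rightarrow> 'k alg \<Rightarrow> bool" where
  "inv_pair V u v \<longleftrightarrow> u \<in> alg_on V \<and> v \<in> alg_on V \<and> u * v = 1 \<and> v * u = 1"

lemma inv_pair_sym: "inv_pair V u v \<Longrightarrow> inv_pair V v u"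
  by (auto simp: inv_pair_def)

lemma inv_pair_mult:
  assumes "inv_pair V u v" "inv_pair V u' v'"
  shows "inv_pair V (u * u') (v' * v)"
proof -
  have "u * u' * (v' * v) = u * (u' * v') * v" "v' * v * (u * u') = v' * (v * u) * u'"
    by (simp_all only: mult.assoc)
  then show ?thesis
    using assms by (auto simp: inv_pair_def alg_on_mult)
qed

lemma EE_mult:
  fixes a b :: "'k::field alg"
  assumes "i \<noteq> n" "a \<in> alg_on (V - {n} - {i})" "b \<in> alg_on (V - {n} - {i})"
  shows "(a * E i s t * E n k l) * (b * E i s' t' * E n k' l') =
     (if t = s' \<and> l = k' then a * b * E i s t' * E n k l' else 0)"
proof -
  have nb: "E n k l * b = b * E n k l" and ib: "E i s t * b = b * E i s t"
    by (rule alg_on_commute[OF _ assms(3)], rule E_in, rule singletonI, auto)+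
  have ni: "E n k l * E i s' t' = E i s' t' * (E n k l :: 'k alg)"
    by (rule alg_on_commute[of _ "{n}" _ "{i}"]) (use assms in \<open>auto intro: E_in\<close>)
  have "(a * E i s t * E n k l) * (b * E i s' t' * E n k' l') =
     a * E i s t * (E n k l * b) * E i s' t' * E n k' l'"
    by (simp add: mult.assoc)
  also have "\<dots> = a * (E i s t * b) * (E n k l * E i s' t') * E n k' l'"
    by (simp only: nb mult.assoc)
  also have "\<dots> = a * b * (E i s t * E i s' t') * (E n k l * E n k' l')"
    by (simp only: ib ni mult.assoc)
  also have "\<dots> = (if t = s' \<and> l = k' then a * b * E i s t' * E n k l' else 0)"
    by (simp add: E_mult)
  finally show ?thesis .
qed

lemma gen_inv_pair:
  fixes a :: "'k::field alg"
  assumes "i \<noteq> n" "i \<in> V" "n \<in> V" "a \<in> alg_on (V - {n} - {i})" "(s, k) \<noteq> (t, l)"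
  shows "inv_pair V (1 + a * E i s t * E n k l) (1 + (- a) * E i s t * E n k l)"
proof -
  let ?x = "a * E i s t * E n k l"
  have a: "a \<in> alg_on V" using assms(4) alg_on_mono[of "V - {n} - {i}" V] by auto
  have "?x * ?x = 0"
    using assms(1,4,5) by (subst EE_mult[of i n a V]) auto
  then have "(1 + ?x) * (1 - ?x) = 1" "(1 - ?x) * (1 + ?x) = 1"
    by (simp_all only: distrib_right distrib_left left_diff_distrib right_diff_distrib) simp_all
  moreover have "?x \<in> alg_on V"
    using a assms by (intro alg_intros E_in)
  ultimately show ?thesis
    by (auto simp: inv_pair_def intro: alg_intros)
qed

lemma elem_grp_inverse:
  assumes "i \<noteq> n" "i \<in> V" "n \<in> V" "f \<in> elem_grp V i n"
  shows "\<exists>g\<in>elem_grp V i n. inv_pair V f g"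
  using assms(4)
proof induction
  case elem_grp_one
  then show ?case by (auto simp: inv_pair_def intro!: bexI[of _ 1] elem_grp.elem_grp_one)
next
  case (elem_grp_mul g a s k t l)
  then obtain h where h: "h \<in> elem_grp V i n" "inv_pair V g h" by blast
  have "(1 + (- a) * E i s t * E n k l) * h \<in> elem_grp V i n"
    using elem_grp_mul.hyps by (intro elem_grp_mult h elem_grp_gen alg_on_uminus) auto
  then show ?case
    using inv_pair_mult[OF h(2) gen_inv_pair[OF assms(1-3) elem_grp_mul.hyps(2,3)]] by blast
qed

lemma trunc_EE_trunc:
  fixes a :: "'k::field alg"
  assumes "i \<noteq> n" "a \<in> alg_on (V - {n} - {i})"
  shows "trunc n D * (a * E i s t * E n k l) = (if k < D then a * E i s t * E n k l else 0)"
    "(a * E i s t * E n k l) * trunc n D = (if l < D then a * E i s t * E n k l else 0)"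
proof -
  have "a * E i s t \<in> alg_on (insert i V - {n})"
    using assms alg_on_mono[of "V - {n} - {i}" "insert i V - {n}"]
    by (intro alg_on_mult E_in) auto
  then have "a * E i s t * trunc n D = trunc n D * (a * E i s t)"
    by (rule alg_commute_var) (simp add: trunc_in)
  then have "trunc n D * (a * E i s t * E n k l) = a * E i s t * (trunc n D * E n k l)"
    by (simp only: mult.assoc[symmetric])
  then show "trunc n D * (a * E i s t * E n k l) = (if k < D then a * E i s t * E n k l else 0)"
    by (simp add: trunc_E)
  show "(a * E i s t * E n k l) * trunc n D = (if l < D then a * E i s t * E n k l else 0)"
    by (simp add: mult.assoc E_trunc)
qed

text \<open>Two elements of the strip between the corner \<open>trunc n D\<close> and its complement
  multiply to \<open>0\<close>. Sums in the strip thus become products, and only spanning elements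
  have to be checked; there the two indices of \<open>n\<close> differ.\<close>

lemma upper_in_elem_grp:
  fixes f :: "'k::field alg"
  assumes "i \<noteq> n" "f \<in> pair_ideal V i n"
  shows "1 + trunc n D * f * (1 - trunc n D) \<in> elem_grp V i n"
  using assms(2)
proof (induction rule: pair_ideal_induct)
  case zero
  then show ?case by (simp add: elem_grp_one)
next
  case (gen a s t k l)
  show ?case
    using elem_grp_gen[OF gen, of s k t l] assms(1) gen
    by (auto simp: trunc_EE_trunc right_diff_distrib elem_grp_one)
next
  case (add f g)
  have "(1 - trunc n D) * trunc n D = (0 :: 'k alg)"
    by (simp add: left_diff_distrib trunc_idem)
  then have "trunc n D * f * (1 - trunc n D) * (trunc n D * g * (1 - trunc n D)) = 0"
    by (metis mult.assoc mult_zero_left mult_zero_right)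
  then have "1 + trunc n D * (f + g) * (1 - trunc n D) =
     (1 + trunc n D * f * (1 - trunc n D)) * (1 + trunc n D * g * (1 - trunc n D))"
    by (simp add: distrib_left distrib_right)
  then show ?case
    using elem_grp_mult[OF add] by simp
qed

lemma lower_in_elem_grp:
  fixes f :: "'k::field alg"
  assumes "i \<noteq> n" "f \<in> pair_ideal V i n"
  shows "1 + (1 - trunc n D) * f * trunc n D \<in> elem_grp V i n"
  using assms(2)
proof (induction rule: pair_ideal_induct)
  case zero
  then show ?case by (simp add: elem_grp_one)
next
  case (gen a s t k l)
  show ?case
    using elem_grp_gen[OF gen, of s k t l] assms(1) gen
    by (auto simp: trunc_EE_trunc left_diff_distrib elem_grp_one)
next
  case (add f g)
  have "trunc n D * (1 - trunc n D) = (0 :: 'k alg)"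
    by (simp add: right_diff_distrib trunc_idem)
  then have "(1 - trunc n D) * f * trunc n D * ((1 - trunc n D) * g * trunc n D) = 0"
    by (metis mult.assoc mult_zero_left mult_zero_right)
  then have "1 + (1 - trunc n D) * (f + g) * trunc n D =
     (1 + (1 - trunc n D) * f * trunc n D) * (1 + (1 - trunc n D) * g * trunc n D)"
    by (simp add: distrib_left distrib_right)
  then show ?case
    using elem_grp_mult[OF add] by simp
qed

section \<open>Normality of the elementary group of a pair under all units\<close>

lemma alg_bounded_left:
  fixes u :: "'k::field alg"
  assumes "u \<in> alg_on V"
  shows "\<exists>D0. \<forall>D\<ge>D0. \<forall>p. trunc n D * (u * E n k p) = u * E n k p"
  using assms
proof (induction rule: alg_on_split_induct[where j = n])
  case (mono g a b)
  have "trunc n D * (g * X n ^ a * Y n ^ b * E n k p) = g * X n ^ a * Y n ^ b * E n k p"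
    if "D \<ge> a + k + 1" for D p
  proof -
    have "g * trunc n D = trunc n D * g"
      by (rule alg_commute_var[OF mono]) (simp add: trunc_in)
    then have "trunc n D * (g * X n ^ a * Y n ^ b * E n k p) = g * (trunc n D * (X n ^ a * (Y n ^ b * E n k p)))"
      by (simp only: mult.assoc[symmetric])
    moreover have "a + (k - b) < D" using that by simp
    then have "trunc n D * (X n ^ a * (Y n ^ b * E n k p)) = (X n ^ a * (Y n ^ b * E n k p) :: 'k alg)"
      by (simp add: Y_power_E X_power_E trunc_E del: add_diff_assoc)
    ultimately show ?thesis
      by (simp only: mult.assoc)
  qed
  then show ?case by blast
next
  case (add f g)
  then obtain D1 D2 where "\<forall>D\<ge>D1. \<forall>p. trunc n D * (f * E n k p) = f * E n k p"
    "\<forall>D\<ge>D2. \<forall>p. trunc n D * (g * E n k p) = g * E n k p"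
    by blast
  then show ?case
    by (intro exI[of _ "max D1 D2"]) (simp add: distrib_right distrib_left)
qed simp

lemma alg_bounded_right:
  fixes u :: "'k::field alg"
  assumes "u \<in> alg_on V"
  shows "\<exists>D0. \<forall>D\<ge>D0. \<forall>p. E n p k * u * trunc n D = E n p k * u"
  using assms
proof (induction rule: alg_on_split_induct[where j = n])
  case (mono g a b)
  have "E n p k * (g * X n ^ a * Y n ^ b) * trunc n D = E n p k * (g * X n ^ a * Y n ^ b)"
    if "D \<ge> b + k + 1" for D p
  proof -
    have "E n p k * g = g * E n p k"
      by (rule alg_commute_var[OF mono, symmetric]) (simp add: E_in)
    then have eq: "E n p k * (g * X n ^ a * Y n ^ b) = g * (E n p k * X n ^ a * Y n ^ b)"
      by (simp only: mult.assoc[symmetric])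
    have "k - a + b < D" using that by simp
    then have "E n p k * X n ^ a * Y n ^ b * trunc n D = (E n p k * X n ^ a * Y n ^ b :: 'k alg)"
      by (simp add: E_X_power E_Y_power E_trunc del: add_diff_assoc2)
    then show ?thesis
      unfolding eq by (simp only: mult.assoc)
  qed
  then show ?case by blast
next
  case (add f g)
  then obtain D1 D2 where "\<forall>D\<ge>D1. \<forall>p. E n p k * f * trunc n D = E n p k * f"
    "\<forall>D\<ge>D2. \<forall>p. E n p k * g * trunc n D = E n p k * g"
    by blast
  then show ?case
    by (intro exI[of _ "max D1 D2"]) (simp add: distrib_right distrib_left)
qed simp

text \<open>The relation \<open>[e_12(c), e_23(r)] = e_13(c r)\<close>, with the inverses spelled
  \<open>1 + - c\<close> and \<open>1 + - r\<close> so that all four factors have the shape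
  \<open>1 + z\<close>.\<close>

lemma commutator_identity:
  fixes c r :: "'r::ring_1"
  assumes "c * c = 0" "r * r = 0" "r * c = 0"
  shows "1 + c * r = (1 + c) * (1 + r) * (1 + - c) * (1 + - r)"
proof -
  have "(1 + c) * (1 + r) * (1 - c) = 1 + r + c * r"
    using assms by (simp add: algebra_simps)
  then show ?thesis
    using assms by (simp add: algebra_simps)
qed

lemma elem_grp_conj_gen:
  fixes a :: "'k::field alg"
  assumes V: "i \<noteq> n" "i \<in> V" "n \<in> V" and a: "a \<in> alg_on (V - {n} - {i})" and ne: "(s, k) \<noteq> (t, l)"
    and uv: "inv_pair V u v"
  shows "u * (1 + a * E i s t * E n k l) * v \<in> elem_grp V i n"
proof -
  have u: "u \<in> alg_on V" and v: "v \<in> alg_on V" and uv1: "u * v = 1" and vu1: "v * u = 1"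
    using uv by (auto simp: inv_pair_def)
  have aV: "a \<in> alg_on V" using a alg_on_mono[of "V - {n} - {i}" V] by auto
  have "u * (a * E i s 0) \<in> alg_on V" "E i 0 t * v \<in> alg_on V"
    using u v aV V by (intro alg_on_mult E_in; simp)+
  from alg_bounded_left[OF this(1), of n k] alg_bounded_right[OF this(2), of n l]
  obtain D1 D2 where D1: "\<And>D p. D \<ge> D1 \<Longrightarrow> trunc n D * (u * (a * E i s 0) * E n k p) = u * (a * E i s 0) * E n k p"
    and D2: "\<And>D p. D \<ge> D2 \<Longrightarrow> E n p l * (E i 0 t * v) * trunc n D = E n p l * (E i 0 t * v)"
    by blast
  \<comment> \<open>\<open>D\<close> lies beyond the supports of column \<open>k\<close> of
    \<open>u (a E i s 0)\<close> and of row \<open>l\<close> of \<open>E i 0 t v\<close>. It also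
    serves as the intermediate index, which is why the two bounds are uniform in \<open>p\<close>:
    \<open>c\<close> has rows below \<open>D\<close> and column \<open>D\<close>, while
    \<open>r\<close> has row \<open>D\<close> and columns below \<open>D\<close>.\<close>
  define D where "D = max D1 D2"
  define c where "c = u * (a * E i s 0 * E n k D)"
  define r where "r = (1 * E i 0 t * E n D l) * v"
  have ni: "E n p q * E i p' q' = E i p' q' * (E n p q :: 'k alg)" for p q p' q'
    by (rule alg_on_commute[of _ "{n}" _ "{i}"]) (use V in \<open>auto intro: E_in\<close>)
  have cS: "c \<in> pair_ideal V i n" and rS: "r \<in> pair_ideal V i n"
    unfolding c_def r_def using ideal_of_pair_ideal[OF V(2,3,1)] pair_ideal_gen[OF a] pair_ideal_gen[OF alg_on_1] u v
    by (metis ideal_ofD(4,5))+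
  have c1: "trunc n D * c = c" 
    using D1[of D D] by (simp add: c_def D_def mult.assoc)
  have c2: "c * trunc n D = 0"
    unfolding c_def by (simp add: mult.assoc E_trunc)
  have r1: "r * trunc n D = r"
    using D2[of D D] by (simp add: r_def D_def mult.assoc[symmetric] ni)
  have r2: "trunc n D * r = 0"
    unfolding r_def by (subst mult.assoc[symmetric], subst trunc_EE_trunc[of i n _ V]) (use V in auto)
  have G1: "1 + x \<in> elem_grp V i n" if "x \<in> pair_ideal V i n" "trunc n D * x = x" "x * trunc n D = 0" for x
    using upper_in_elem_grp[OF V(1) that(1), of D] that(2,3) by (simp add: right_diff_distrib)
  have G2: "1 + x \<in> elem_grp V i n" if "x \<in> pair_ideal V i n" "x * trunc n D = x" "trunc n D * x = 0" for x
    using lower_in_elem_grp[OF V(1) that(1), of D] that(2,3) by (simp add: left_diff_distrib)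
  have cc: "c * c = 0" by (metis c1 c2 mult.assoc mult_zero_left)
  have rr: "r * r = 0" by (metis r1 r2 mult.assoc mult_zero_right)
  \<comment> \<open>\<open>v u = 1\<close> brings the inner index pairs \<open>(t, l)\<close> and
    \<open>(s, k)\<close> face to face, and they differ.\<close>
  have "r * c = (1 * E i 0 t * E n D l) * (v * u) * (a * E i s 0 * E n k D)"
    unfolding c_def r_def by (simp only: mult.assoc)
  also have "\<dots> = 0"
    unfolding vu1 mult_1_right using ne by (subst EE_mult[OF V(1) alg_on_1 a]) auto
  finally have rc: "r * c = 0" .
  have "c * r = u * ((a * E i s 0 * E n k D) * (1 * E i 0 t * E n D l)) * v"
    unfolding c_def r_def by (simp only: mult.assoc)
  also have "\<dots> = u * (a * E i s t * E n k l) * v"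
    using V by (subst EE_mult[OF V(1) a]) auto
  finally have "u * (1 + a * E i s t * E n k l) * v = 1 + c * r"
    using uv1 by (simp add: distrib_left distrib_right)
  also have "\<dots> = (1 + c) * (1 + r) * (1 + - c) * (1 + - r)"
    by (rule commutator_identity[OF cc rr rc])
  also have "\<dots> \<in> elem_grp V i n"
    using c1 c2 r1 r2
    by (intro elem_grp_mult G1[of c] G2[of r] G1[of "- c"] G2[of "- r"] cS rS
        ideal_uminus[OF ideal_of_pair_ideal[OF V(2,3,1)]]) simp_all
  finally show ?thesis .
qed

lemma elem_grp_conj:
  assumes V: "i \<noteq> n" "i \<in> V" "n \<in> V" and uv: "inv_pair V u v" and f: "f \<in> elem_grp V i n"
  shows "u * f * v \<in> elem_grp V i n"
  using f
proof induction
  case elem_grp_one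
  then show ?case using uv by (simp add: inv_pair_def elem_grp.elem_grp_one)
next
  case (elem_grp_mul g a s k t l)
  let ?x = "1 + a * E i s t * E n k l"
  have "u * (g * ?x) * v = u * g * (v * u) * ?x * v"
    using uv by (simp add: inv_pair_def mult.assoc)
  also have "\<dots> = (u * g * v) * (u * ?x * v)"
    by (simp only: mult.assoc)
  finally show ?case
    using elem_grp_mult[OF elem_grp_mul.IH elem_grp_conj_gen[OF V elem_grp_mul.hyps(2,3) uv]] by simp
qed

section \<open>Reduction modulo the ideals of single variables\<close>

text \<open>The monomial \<open>x_k\<^sup>a y_k\<^sup>b\<close> becomes \<open>x_k\<^sup>a\<^sup>-\<^sup>b y_k\<^sup>b\<^sup>-\<^sup>a\<close> (truncated subtraction) for \<open>k \<in> B\<close>.  The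
  linear map \<open>reduce B\<close> is not multiplicative, but its kernel is the sum of the ideals \<open>p_k\<close>, \<open>k \<in> B\<close>.\<close>

definition reduce_mon :: "nat set \<Rightarrow> bic \<Rightarrow> bic" where
  "reduce_mon B m = Bic (\<lambda>i. if i \<in> B then xexp m i - yexp m i else xexp m i)
                 (\<lambda>i. if i \<in> B then yexp m i - xexp m i else yexp m i)"

definition reduce :: "nat set \<Rightarrow> 'k::field alg \<Rightarrow> 'k alg" where
  "reduce B f = (\<Sum>m\<in>keys f. single (reduce_mon B m) (lookup f m))"

lemma reduce_0 [simp]: "reduce B 0 = 0"
  by (simp add: reduce_def)

lemma reduce_single [simp]: "reduce B (single m c) = single (reduce_mon B m) c"
  by (simp add: reduce_def)

lemma reduce_add: "reduce B (f + g) = reduce B f + reduce B g"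
  unfolding reduce_def by (rule setsum_keys_plus_distrib) (simp_all add: single_add)

lemma reduce_sum: "reduce B (sum f A) = (\<Sum>a\<in>A. reduce B (f a))"
  by (induction A rule: infinite_finite_induct) (simp_all add: reduce_add)

lemma reduce_mon_add_right: "reduce_mon B (m + reduce_mon B m') = reduce_mon B (m + m')"
  by (auto simp: reduce_mon_def plus_bic_def fun_eq_iff)

lemma reduce_mon_add_left: "reduce_mon B (reduce_mon B m + m') = reduce_mon B (m + m')"
  by (auto simp: reduce_mon_def plus_bic_def fun_eq_iff)

text \<open>The substitute for multiplicativity. For \<open>k \<in> B\<close> the reduced exponents
  record only the integer power of \<open>x_k\<close> in the quotient where \<open>y_k\<close>
  inverts \<open>x_k\<close>, so reducing a factor beforehand cannot change the reduced product.
  Hence the kernel is a two-sided ideal.\<close>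

lemma reduce_mult_reduce: "reduce B (f * reduce B g) = reduce B (f * g)"
  using alg_on_UNIV[of f]
proof (induction rule: alg_on_induct)
  case (single m c)
  show ?case
    using alg_on_UNIV[of g]
    by (induction rule: alg_on_induct) (simp_all add: mult_single reduce_mon_add_right reduce_add distrib_left)
qed (simp_all add: reduce_add distrib_right)

lemma reduce_reduce_mult: "reduce B (reduce B f * g) = reduce B (f * g)"
  using alg_on_UNIV[of f]
proof (induction rule: alg_on_induct)
  case (single m c)
  show ?case
    using alg_on_UNIV[of g]
    by (induction rule: alg_on_induct) (simp_all add: mult_single reduce_mon_add_left reduce_add distrib_left)
qed (simp_all add: reduce_add distrib_right)

lemma reduce_mult_zero: "reduce B g = 0 \<Longrightarrow> reduce B (f * g) = 0" "reduce B f = 0 \<Longrightarrow> reduce B (f * g) = 0"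
  using reduce_mult_reduce[of B f g] reduce_reduce_mult[of B f g] by simp_all

lemma reduce_mult_right:
  assumes "g \<in> alg_on W" "W \<inter> B = {}"
  shows "reduce B (f * g) = reduce B f * g"
  using alg_on_UNIV[of f]
proof (induction rule: alg_on_induct)
  case (single m c)
  show ?case
    using assms(1)
  proof (induction rule: alg_on_induct)
    case (single m' c')
    have "i \<in> B \<Longrightarrow> xexp m' i = 0 \<and> yexp m' i = 0" for i
      using single assms(2) by blast
    then have "reduce_mon B (m + m') = reduce_mon B m + m'"
      by (auto simp: reduce_mon_def plus_bic_def fun_eq_iff)
    then show ?case by (simp add: mult_single)
  qed (simp_all add: reduce_add distrib_left)
qed (simp_all add: reduce_add distrib_right)

lemma reduce_alg_on: "f \<in> alg_on V \<Longrightarrow> reduce B f \<in> alg_on V"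
  by (induction rule: alg_on_induct) (auto simp: reduce_add reduce_mon_def intro!: alg_on_single alg_on_add)

lemma reduce_mon_insert: "reduce_mon (insert k B) m = reduce_mon {k} (reduce_mon B m)"
  by (auto simp: reduce_mon_def fun_eq_iff)

lemma reduce_insert: "reduce (insert k B) f = reduce {k} (reduce B f)"
  using alg_on_UNIV[of f] by (induction rule: alg_on_induct) (simp_all add: reduce_add reduce_mon_insert[symmetric])

lemma reduce_XY: "reduce {k} (X k ^ a * Y k ^ b) = X k ^ (a - b) * Y k ^ (b - a)"
  by (auto simp: X_power Y_power mult_single reduce_mon_def plus_bic_def fun_eq_iff
      intro!: arg_cong[where f = "\<lambda>m. single m 1"])

lemma reduce_XY_mem:
  assumes "k \<in> B"
  shows "reduce B (X k * Y k :: 'k::field alg) = 1"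
proof -
  have "reduce B (X k * Y k :: 'k alg) = single (reduce_mon B (Bic (\<lambda>j. if j = k then 1 else 0) (\<lambda>j. if j = k then 1 else 0))) 1"
    by (simp add: X_def Y_def mult_single plus_bic_def)
  also have "reduce_mon B (Bic (\<lambda>j. if j = k then 1 else 0) (\<lambda>j. if j = k then 1 else 0)) = 0"
    using assms by (auto simp: reduce_mon_def zero_bic_def fun_eq_iff)
  finally show ?thesis by simp
qed

lemma reduce_1: "reduce B 1 = (1 :: 'k::field alg)"
proof -
  have "reduce B (single 0 1) = (single 0 1 :: 'k alg)"
    by (simp only: reduce_single) (simp add: reduce_mon_def zero_bic_def cong: if_cong)
  then show ?thesis by simp
qed

lemma reduce_uminus: "reduce B (- f) = - reduce B f"
  using reduce_add[of B "- f" f] by (simp add: eq_neg_iff_add_eq_0)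

lemma reduce_diff: "reduce B (f - g) = reduce B f - reduce B g"
  using reduce_add[of B f "- g"] by (simp add: reduce_uminus)

lemma reduce_e0: "k \<in> B \<Longrightarrow> reduce B (e0 k) = 0"
  by (simp add: E_eq reduce_diff reduce_1 reduce_XY_mem)

lemma E_eq_e0: "E k s t = X k ^ s * e0 k * Y k ^ t"
  by (simp add: X_power_E E_Y_power)

lemma reduce_E: "k \<in> B \<Longrightarrow> reduce B (E k s t) = 0"
  unfolding E_eq_e0[of k s t] by (intro reduce_mult_zero reduce_e0)

lemma ideal_trunc:
  assumes "ideal_of W A" "k \<in> W" "e0 k \<in> A"
  shows "trunc k m \<in> A"
proof -
  have "E k s s \<in> A" for s
    unfolding E_eq_e0[of k s s]
    using assms by (intro ideal_ofD(4,5)[OF assms(1)] alg_on_power X_in Y_in)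
  then show ?thesis
    unfolding sum_E[symmetric] using assms(1) by (intro ideal_sum) auto
qed

lemma diff_reduce_single_var:
  fixes f :: "'k::field alg"
  assumes A: "ideal_of W A" and e: "k \<in> W \<Longrightarrow> e0 k \<in> A" and f: "f \<in> alg_on W"
  shows "f - reduce {k} f \<in> A"
proof (cases "k \<in> W")
  case False
  have "reduce {k} f = f"
    using f
  proof (induction rule: alg_on_induct)
    case (single m c)
    then have "reduce_mon {k} m = m"
      using False by (cases m) (auto simp: reduce_mon_def fun_eq_iff)
    then show ?case by simp
  qed (simp_all add: reduce_add)
  then show ?thesis using A by (simp add: ideal_ofD)
next
  case True
  show ?thesis
    using f
  proof (induction rule: alg_on_split_induct[where j = k])
    case zero
    then show ?case using A by (simp add: ideal_ofD)
  next
    case (mono g a b)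
    have gW: "g \<in> alg_on W" using mono alg_on_mono[of "W - {k}" W] by auto
    have gc: "g * (X k ^ a * Y k ^ b) = X k ^ a * Y k ^ b * g" for a b
      by (rule alg_commute_var[OF mono]) (intro alg_intros singletonI)
    \<comment> \<open>The common part of the exponents cancels:
      \<open>X k ^ m * Y k ^ m = 1 - trunc k m\<close>, and \<open>trunc k m\<close> lies in the
      ideal by \<open>ideal_trunc\<close>.\<close>
    define m where "m = min a b"
    have "reduce {k} (g * X k ^ a * Y k ^ b) = reduce {k} (X k ^ a * Y k ^ b * g)"
      by (simp only: mult.assoc[of g] gc)
    also have "\<dots> = X k ^ (a - b) * Y k ^ (b - a) * g"
      using reduce_mult_right[OF mono, of "{k}" "X k ^ a * Y k ^ b"] by (simp add: reduce_XY)
    also have "\<dots> = g * (X k ^ (a - b) * Y k ^ (b - a))"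
      by (rule gc[symmetric])
    finally have s: "reduce {k} (g * X k ^ a * Y k ^ b) = g * (X k ^ (a - m) * Y k ^ (b - m))"
      by (simp add: m_def min_def)
    have "X k ^ a * Y k ^ b = X k ^ (a - m + m) * (Y k ^ (m + (b - m)) :: 'k alg)"
      by (simp add: m_def)
    also have "\<dots> = X k ^ (a - m) * (X k ^ m * Y k ^ m) * Y k ^ (b - m)"
      by (simp only: power_add mult.assoc)
    also have "X k ^ m * Y k ^ m = 1 - (trunc k m :: 'k alg)"
      by (simp add: trunc_def)
    finally have "g * X k ^ a * Y k ^ b - reduce {k} (g * X k ^ a * Y k ^ b) =
        - (g * X k ^ (a - m) * trunc k m * Y k ^ (b - m))"
      unfolding s by (simp add: mult.assoc[of g] right_diff_distrib left_diff_distrib)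
    then show ?case
      using ideal_ofD(5)[OF A ideal_ofD(4)[OF A ideal_trunc[OF A True e[OF True], of m],
            of "g * X k ^ (a - m)"], of "Y k ^ (b - m)"] ideal_uminus[OF A] gW True
      by (simp add: alg_on_mult alg_on_power X_in Y_in)
  next
    case (add f g)
    have "f + g - reduce {k} (f + g) = (f - reduce {k} f) + (g - reduce {k} g)"
      by (simp add: reduce_add)
    then show ?case
      using ideal_ofD(3)[OF A add] by (simp only:)
  qed
qed

lemma diff_reduce:
  fixes f :: "'k::field alg"
  assumes A: "ideal_of W A" and f: "f \<in> alg_on W" and "finite B" and e: "\<And>k. k \<in> B \<Longrightarrow> k \<in> W \<Longrightarrow> e0 k \<in> A"
  shows "f - reduce B f \<in> A"
  using assms(3) e
proof (induction B rule: finite_induct)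
  case empty
  have "reduce_mon {} m = m" for m by (simp add: reduce_mon_def)
  then have "reduce {} f = f"
    by (simp add: reduce_def alg_sum_monomials[symmetric])
  then show ?case using A by (simp add: ideal_ofD)
next
  case (insert k B)
  have "f - reduce B f \<in> A" "reduce B f - reduce {k} (reduce B f) \<in> A"
    using insert by (auto intro!: diff_reduce_single_var[OF A] reduce_alg_on f)
  then show ?case
    unfolding reduce_insert[of k B] using ideal_ofD(3)[OF A] by fastforce
qed

text \<open>The coefficients \<open>g\<close> with \<open>g * E i s t * E n k l\<close> in
  \<open>q\<close> for all indices form an ideal of the algebra in the other variables. It contains
  \<open>e0 k\<close> for \<open>k \<in> B\<close>, because matrix units on both sides of
  \<open>e0 i * e0 k * e0 n\<close> produce every index; so \<open>diff_reduce\<close> applies to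
  the coefficients.\<close>

lemma pair_ideal_diff_reduce:
  fixes f :: "'k::field alg"
  assumes V: "i \<noteq> n" "i \<in> V" "n \<in> V" and f: "f \<in> pair_ideal V i n"
    and B: "finite B" "i \<notin> B" "n \<notin> B" and q: "ideal_of V q"
    and e: "\<And>k. k \<in> B \<Longrightarrow> k \<in> V \<Longrightarrow> e0 i * e0 k * e0 n \<in> q"
  shows "f - reduce B f \<in> q"
proof -
  let ?W = "V - {n} - {i}"
  define A where "A = {g \<in> alg_on ?W. \<forall>s t k l. g * E i s t * E n k l \<in> q}"
  have WV: "g \<in> alg_on ?W \<Longrightarrow> g \<in> alg_on V" for g :: "'k alg"
    using alg_on_mono[of ?W V] by auto
  have comm: "E i s t * E n k l * r = r * (E i s t * E n k l)" if "r \<in> alg_on ?W" for s t k l and r :: "'k alg"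
    by (rule alg_on_commute[OF _ that, of _ "{i, n}"]) (auto intro!: alg_on_mult E_in)
  have A: "ideal_of ?W A"
    unfolding ideal_of_def A_def
  proof (intro conjI ballI subsetI, goal_cases)
    case (4 a r)
    then show ?case
      using ideal_ofD(4)[OF q _ WV[of r]] by (auto simp: mult.assoc alg_on_mult)
  next
    case (5 a r)
    have "a * r * E i s t * E n k l = a * E i s t * E n k l * r" for s t k l
      using comm[OF 5(2)] by (simp add: mult.assoc)
    then show ?case
      using 5 ideal_ofD(5)[OF q _ WV[of r]] by (auto simp: alg_on_mult)
  qed (auto simp: ideal_ofD[OF q] alg_on_add distrib_right)
  have eA: "e0 k \<in> A" if "k \<in> B" "k \<in> ?W" for k
    unfolding A_def
  proof (intro CollectI conjI allI)
    show "e0 k \<in> alg_on ?W" using that by (intro E_in) auto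
    fix s t p l
    have "e0 i * e0 k = e0 k * (e0 i :: 'k alg)"
      by (rule alg_on_commute[of _ "{i}" _ "{k}"]) (use that B in \<open>auto intro: E_in\<close>)
    then have kin: "e0 k * e0 i * e0 n \<in> q"
      using e[of k] that by auto
    have "(1 * E i s 0 * E n p 0) * (e0 k * e0 i * e0 n) * (1 * E i 0 t * E n 0 l) \<in> q"
      using V by (intro ideal_ofD(5)[OF q ideal_ofD(4)[OF q kin]] alg_on_mult alg_on_1 E_in)
    also have "(1 * E i s 0 * E n p 0) * (e0 k * e0 i * e0 n) * (1 * E i 0 t * E n 0 l) = e0 k * E i s t * (E n p l :: 'k alg)"
    proof -
      have ek: "(e0 k :: 'k alg) \<in> alg_on ?W" using that by (intro E_in) auto
      show ?thesis
        using EE_mult[OF V(1) alg_on_1 ek, of s 0 p 0 0 0 0 0] EE_mult[OF V(1) ek alg_on_1, of s 0 p 0 0 t 0 l]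
        by simp
    qed
    finally show "e0 k * E i s t * E n p l \<in> q" .
  qed
  show ?thesis
    using f
  proof (induction rule: pair_ideal_induct)
    case zero
    then show ?case using q by (simp add: ideal_ofD)
  next
    case (gen a s t k l)
    have "reduce B (a * (E i s t * E n k l)) = reduce B a * (E i s t * E n k l)"
      by (rule reduce_mult_right[of _ "{i, n}"]) (use B in \<open>auto intro!: alg_on_mult E_in\<close>)
    moreover have "a - reduce B a \<in> A"
      by (rule diff_reduce[OF A gen B(1) eA])
    ultimately show ?case
      by (auto simp: A_def left_diff_distrib mult.assoc)
  next
    case (add f g)
    have "f + g - reduce B (f + g) = (f - reduce B f) + (g - reduce B g)"
      by (simp add: reduce_add)
    then show ?case
      using ideal_ofD(3)[OF q add] by (simp only:)
  qed
qed

text \<open>\<open>g * e0 j = 0\<close> means \<open>g = g * (X j * Y j)\<close>; every monomial on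
  the right has exponent \<open>1\<close> at \<open>X j\<close>, every one on the left exponent
  \<open>0\<close>.\<close>

lemma mult_e0_cancel:
  assumes "g \<in> alg_on (V - {j})" "g * e0 j = 0"
  shows "g = 0"
proof -
  have eq: "g = g * (X j * Y j)"
    using assms(2) by (simp add: E_eq right_diff_distrib)
  have "m \<notin> keys g" for m
  proof
    assume m: "m \<in> keys g"
    then have "m \<in> keys (g * (X j * Y j))" using eq by simp
    then obtain a b where "m = a + b" "a \<in> keys g" "b \<in> keys (X j * Y j :: 'a alg)"
      using keys_mult[of g "X j * Y j"] by blast
    then have "xexp m j = 1"
      using assms(1) by (auto simp: alg_on_def X_def Y_def mult_single plus_bic_def)
    then show False
      using m assms(1) by (auto simp: alg_on_def)
  qed
  then show ?thesis
    by (metis all_not_in_conv keys_eq_empty)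
qed

text \<open>Inside \<open>p_i p_n\<close> the ideal \<open>q\<close> is exactly the kernel of
  \<open>reduce B\<close>: one inclusion is \<open>ker\<close>, the other comes from
  \<open>e\<close> through \<open>pair_ideal_diff_reduce\<close>. As \<open>j \<notin> B\<close>,
  reduction commutes with multiplication by \<open>e0 j\<close>, which can then be
  cancelled.\<close>

lemma mem_if_mult_e0_mem:
  fixes z :: "'k::field alg"
  assumes V: "i \<noteq> n" "i \<in> V" "n \<in> V" and j: "j \<notin> B"
    and B: "finite B" "i \<notin> B" "n \<notin> B" and q: "ideal_of V q"
    and e: "\<And>k. k \<in> B \<Longrightarrow> k \<in> V \<Longrightarrow> e0 i * e0 k * e0 n \<in> q"
    and ker: "\<And>f. f \<in> q \<Longrightarrow> reduce B f = 0"
    and z: "z \<in> pair_ideal V i n" "z \<in> alg_on (V - {j})" "z * e0 j \<in> q"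
  shows "z \<in> q"
proof -
  have "reduce B z * e0 j = reduce B (z * e0 j)"
    by (rule reduce_mult_right[symmetric, of _ "{j}"]) (use j in \<open>auto intro: E_in\<close>)
  then have "reduce B z * e0 j = 0"
    using ker[OF z(3)] by simp
  then have "reduce B z = 0"
    by (rule mult_e0_cancel[OF reduce_alg_on[OF z(2)]])
  then show ?thesis
    using pair_ideal_diff_reduce[OF V z(1) B q e] by simp
qed

section \<open>Two by two block matrices\<close>

lemma mult_eq_left:
  fixes a :: "'r::semigroup_mult"
  shows "a * b = c \<Longrightarrow> a * (b * z) = c * z"
  by (simp flip: mult.assoc)

lemma mult_eq_left2:
  fixes a :: "'r::semigroup_mult"
  shows "a * b = c * d \<Longrightarrow> a * (b * z) = c * (d * z)"
  by (simp flip: mult.assoc)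

text \<open>Here \<open>s\<close> and \<open>s'\<close> are the off-diagonal matrix units between the corner of \<open>r\<close> and an orthogonal
  copy of it, so that \<open>blk\<close> embeds the two by two matrices over the corner, completed by the identity.\<close>

locale block =
  fixes r s s' :: "'r::ring_1"
  assumes rr: "r * r = r" and rs: "r * s = s" and sr: "s * r = 0"
    and s'r: "s' * r = s'" and rs': "r * s' = 0" and ss': "s * s' = r"
begin

definition blk :: "'r \<Rightarrow> 'r \<Rightarrow> 'r \<Rightarrow> 'r \<Rightarrow> 'r" where
  "blk a b c d = (1 - r - s' * s) + a + b * s + s' * c + s' * (d * s)"

definition corner :: "'r \<Rightarrow> bool" where
  "corner a \<longleftrightarrow> r * a = a \<and> a * r = a"

lemma corner_intros:
  "corner 0" "corner r" "corner a \<Longrightarrow> corner b \<Longrightarrow> corner (a + b)"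
  "corner a \<Longrightarrow> corner (- a)" "corner a \<Longrightarrow> corner b \<Longrightarrow> corner (a * b)"
  "corner a \<Longrightarrow> corner b \<Longrightarrow> corner (a - b)"
  by (auto simp: corner_def rr distrib_left distrib_right left_diff_distrib right_diff_distrib mult.assoc)
    (simp_all flip: mult.assoc)

lemma blk_mult:
  assumes "corner a" "corner b" "corner c" "corner d" "corner a'" "corner b'" "corner c'" "corner d'"
  shows "blk a b c d * blk a' b' c' d' =
    blk (a * a' + b * c') (a * b' + b * d') (c * a' + d * c') (c * b' + d * d')"
proof -
  \<comment> \<open>The idempotent complementary to the corner \<open>r\<close> and its copy
    \<open>s' * s\<close>.\<close>
  define z where "z = 1 - r - s' * s"
  have r': "r * (x * y) = x * y" if "corner x" for x y
    using that by (simp add: corner_def flip: mult.assoc)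
  have xs': "x * s' = 0" "x * (s' * y) = 0" if "corner x" for x y
    using that rs' by (metis corner_def mult.assoc mult_zero_right mult_zero_left)+
  have sx: "s * x = 0" "s * (x * y) = 0" if "corner x" for x y
    using that sr by (metis corner_def mult.assoc mult_zero_right mult_zero_left)+
  have ss'x: "s * (s' * x) = x" "s * (s' * (x * y)) = x * y" if "corner x" for x y
    using that ss' r' by (simp_all add: corner_def flip: mult.assoc)
  have zx: "z * x = 0" "z * (x * y) = 0" if "corner x" for x y
    using that sx[OF that] r'[OF that] by (simp_all add: z_def corner_def left_diff_distrib mult.assoc)
  have xz: "x * z = 0" if "corner x" for x
    using that xs'[OF that] by (simp add: z_def corner_def right_diff_distrib mult.assoc)
  have sz: "s * z = 0"
    using sr ss' rs by (simp add: z_def right_diff_distrib flip: mult.assoc)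
  have zs': "z * s' = 0"
    using rs' ss' s'r by (simp add: z_def left_diff_distrib mult.assoc)
  then have zs'': "z * (s' * y) = 0" for y
    by (simp flip: mult.assoc)
  have zz: "z * z = z"
  proof -
    have "z * z = z * (1 - r - s' * s)" by (simp add: z_def)
    also have "\<dots> = z - z * r - z * (s' * s)" by (simp add: right_diff_distrib)
    finally show ?thesis by (simp add: zs'' zx corner_intros)
  qed
  show ?thesis
    unfolding blk_def z_def[symmetric]
    using assms
    by (simp add: distrib_left distrib_right mult.assoc xs' sx ss'x zx xz sz zs' zs'' zz)
qed

lemma blk_r: "blk r a 0 r = 1 + a * s" "blk r 0 c r = 1 + s' * c"
  by (simp_all add: blk_def rs)

text \<open>If \<open>b\<close> is the inverse of \<open>a\<close> in the corner, this is the matrix with rows \<open>(0, a)\<close> and \<open>(-b, 0)\<close>; if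
  only \<open>b a = r\<close>, the upper left entry is the idempotent \<open>r - a b\<close>.\<close>

definition rot :: "'r \<Rightarrow> 'r \<Rightarrow> 'r" where
  "rot a b = (1 + a * s) * (1 + s' * (- b)) * (1 + a * s)"

lemma rot_eq:
  assumes "corner a" "corner b"
  shows "rot a b = blk (r - a * b) (a + a - a * b * a) (- b) (r - b * a)"
proof -
  have "rot a b = blk r a 0 r * blk r 0 (- b) r * blk r a 0 r"
    unfolding rot_def blk_r ..
  also have "\<dots> = blk (r - a * b) (a + a - a * b * a) (- b) (r - b * a)"
    using assms by (simp add: blk_mult corner_intros rr) (simp add: corner_def algebra_simps rr)
  finally show ?thesis .
qed

end

text \<open>\<open>a\<close> acts as a partial isometry with adjoint \<open>b\<close> and orthogonal
  idempotents \<open>a * b\<close> and \<open>b * a\<close>; \<open>P\<close> exchanges the two and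
  fixes the rest, like a permutation matrix.\<close>

lemma swap_involution:
  fixes a b :: "'r::ring_1"
  assumes "a * a = 0" "b * b = 0" "a * b * a = a" "b * a * b = b"
  defines "P \<equiv> 1 - a * b - b * a + a + b"
  shows "P * P = 1" "P * (b * m * a) * P = a * b * m * (a * b)"
proof -
  have Pb: "P * b = a * b" and aP: "a * P = a * b" and Pa: "P * a = b * a"
    using assms(1-4) assms(1,2)[THEN mult_eq_left] by (simp_all add: P_def algebra_simps)
  have "P * P = P - P * (a * b) - P * (b * a) + P * a + P * b"
    unfolding P_def by (simp add: algebra_simps)
  moreover have "P * (a * b) = b * (a * b)" "P * (b * a) = a * (b * a)"
    using Pa[THEN mult_eq_left2] Pb[THEN mult_eq_left2] by simp_all
  ultimately show "P * P = 1"
    unfolding Pa Pb using assms(3,4) by (simp add: P_def mult.assoc)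
  have "P * (b * m * a) * P = (P * b) * m * (a * P)"
    by (simp only: mult.assoc)
  then show "P * (b * m * a) * P = a * b * m * (a * b)"
    unfolding Pb aP .
qed

lemma ideal_cong_trans:
  assumes "ideal_of V q" "a - b \<in> q" "b - c \<in> q"
  shows "a - c \<in> q"
  using ideal_ofD(3)[OF assms] by simp

lemma ideal_cong_mult:
  assumes q: "ideal_of V q" and "a - a' \<in> q" "b - b' \<in> q" "b \<in> alg_on V" "a' \<in> alg_on V"
  shows "a * b - a' * b' \<in> q"
proof -
  have "a * b - a' * b' = (a - a') * b + a' * (b - b')"
    by (simp add: left_diff_distrib right_diff_distrib)
  then show ?thesis
    using assms by (simp add: ideal_ofD[OF q])
qed

lemma block_cong:
  fixes r s s' :: "'k::field alg"
  assumes "block r s s'" and q: "ideal_of V q" and V: "s \<in> alg_on V" "s' \<in> alg_on V"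
    and "a - a' \<in> q" "b - b' \<in> q" "c - c' \<in> q" "d - d' \<in> q"
  shows "block.blk r s s' a b c d - block.blk r s s' a' b' c' d' \<in> q"
proof -
  interpret block r s s' by fact
  have "blk a b c d - blk a' b' c' d' = (a - a') + (b - b') * s + s' * (c - c') + s' * ((d - d') * s)"
    by (simp add: blk_def left_diff_distrib right_diff_distrib)
  then show ?thesis
    using assms by (simp add: ideal_ofD[OF q])
qed

text \<open>The parameter \<open>p\<close> allows for one-sided inverses: for
  \<open>a = h * x\<close> and \<open>b = y * h'\<close> the product \<open>b * a\<close> is
  \<open>r\<close> modulo \<open>q\<close>, but \<open>a * b\<close> is only the smaller idempotent
  \<open>x * y * r\<close>.\<close>

lemma block_rot_cong:
  fixes r s s' :: "'k::field alg"
  assumes "block r s s'" and q: "ideal_of V q" and V: "r \<in> alg_on V" "s \<in> alg_on V" "s' \<in> alg_on V"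
    and a: "block.corner r a" "a \<in> alg_on V" and b: "block.corner r b"
    and "a * b - p \<in> q" "b * a - r \<in> q"
  shows "block.rot s s' a b - block.blk r s s' (r - p) a (- b) 0 \<in> q"
proof -
  interpret block r s s' by fact
  have "a + a - a * b * a - a = - (a * (b * a - r))"
    using a by (simp add: corner_def right_diff_distrib mult.assoc)
  then have "a + a - a * b * a - a \<in> q"
    using assms by (simp only:) (intro ideal_uminus[OF q] ideal_ofD(4)[OF q])
  moreover have "r - a * b - (r - p) = - (a * b - p)" "r - b * a - 0 = - (b * a - r)"
    by simp_all
  then have "r - a * b - (r - p) \<in> q" "r - b * a - 0 \<in> q"
    using assms(9,10) ideal_uminus[OF q] by metis+
  ultimately show ?thesis
    unfolding rot_eq[OF a(1) b]
    by (intro block_cong[OF assms(1) q V(2,3)]) (simp_all add: ideal_ofD[OF q])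
qed

text \<open>Let \<open>e = 1 - x y\<close> and let \<open>T\<close> have rows \<open>(e, x)\<close>
  and \<open>(-y, 0)\<close>; its inverse has rows \<open>(e, -x)\<close> and \<open>(y, 0)\<close>.
  Modulo \<open>q\<close> the factors are \<open>diag(h,1) T diag(h',1)\<close>, then
  \<open>diag(h,h')\<close> in Whitehead's factorization, then the inverse of \<open>T\<close>.
  Together they give \<open>diag(h,1) T diag(1,h') T^-1 = diag(h e + x y, 1)\<close>.\<close>

lemma block_elementary_cong:
  fixes r s s' x y W W' :: "'k::field alg"
  assumes bl: "block r s s'" and q: "ideal_of V q"
    and V: "r \<in> alg_on V" "s \<in> alg_on V" "s' \<in> alg_on V" "x \<in> alg_on V" "y \<in> alg_on V"
      "W \<in> alg_on V" "W' \<in> alg_on V"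
    and yx: "y * x = 1"
    and comm: "x * r = r * x" "y * r = r * y" "x * W = W * x" "y * W = W * y"
      "x * W' = W' * x" "y * W' = W' * y"
    and cW: "block.corner r W" "block.corner r W'"
    and WW: "W + W' + W * W' \<in> q" "W + W' + W' * W \<in> q"
  defines "h \<equiv> r + W" and "h' \<equiv> r + W'"
  shows "block.rot s s' (h * x) (y * h') * (block.rot s s' h h' * block.rot s s' (- r) (- r)) *
     block.rot s s' (- (x * r)) (- (y * r)) - (1 + W * (1 - x * y)) \<in> q"
proof -
  interpret block r s s' by fact
  define e where "e = 1 - x * y"
  have ye: "y * e = 0" and ex: "e * x = 0" and ee: "e * e = e"
  proof -
    show ye: "y * e = 0" using yx by (simp add: e_def right_diff_distrib flip: mult.assoc)
    show "e * x = 0" using yx by (simp add: e_def left_diff_distrib mult.assoc)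
    show "e * e = e" using ye by (simp add: e_def left_diff_distrib mult.assoc)
  qed
  have ch: "corner h" "corner h'"
    using cW by (auto simp: h_def h'_def intro: corner_intros)
  have xh: "x * h = h * x" "y * h = h * y" "x * h' = h' * x" "y * h' = h' * y"
    using comm by (simp_all add: h_def h'_def distrib_left distrib_right)
  have eh: "e * h = h * e" "e * h' = h' * e" "e * r = r * e"
    using xh comm(1,2) xh[symmetric, THEN mult_eq_left2] comm(1,2)[symmetric, THEN mult_eq_left2]
    by (simp_all add: e_def left_diff_distrib right_diff_distrib mult.assoc)
  have hV: "h \<in> alg_on V" "h' \<in> alg_on V" using V by (auto simp: h_def h'_def intro: alg_on_add)
  have hh: "h * h' - r \<in> q" "h' * h - r \<in> q"
    using WW cW rr by (simp_all add: h_def h'_def corner_def distrib_left distrib_right add_ac)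
  have hr: "h * r = h" "r * h = h" "h' * r = h'" "r * h' = h'"
    using ch by (auto simp: corner_def)
  \<comment> \<open>Normal form: \<open>x\<close>, \<open>y\<close> and \<open>e\<close> move to the
    left of \<open>r\<close>, \<open>h\<close> and \<open>h'\<close>, each rule also in a version
    for right-nested products.\<close>
  note nf1 = xh[symmetric] comm(1,2)[symmetric] eh[symmetric]
  note nf2 = yx ye ex ee rr hr
  note nf = mult.assoc nf1 nf1[THEN mult_eq_left2] nf2 nf2[THEN mult_eq_left]
  have hx: "corner (h * x)" and yh: "corner (y * h')" and xr: "corner (x * r)" and yr: "corner (y * r)"
    by (simp_all add: corner_def nf)
  have yhx: "y * (h' * (h * x)) = h' * h"
    by (simp add: nf)
  have hxy: "h * (x * (y * h')) = x * y * (h * h')"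
    by (simp add: nf)
  have O1: "rot (h * x) (y * h') - blk (r - x * y * r) (h * x) (- (y * h')) 0 \<in> q"
  proof (rule block_rot_cong[OF bl q V(1-3) hx _ yh])
    show "h * x \<in> alg_on V" using hV V by (intro alg_on_mult)
    have "h * x * (y * h') - x * y * r = x * y * (h * h' - r)"
      using hxy by (simp add: right_diff_distrib mult.assoc)
    then show "h * x * (y * h') - x * y * r \<in> q"
      using V hh by (simp only:) (intro ideal_ofD(4)[OF q] alg_on_mult)
    show "y * h' * (h * x) - r \<in> q"
      using yhx hh by (simp add: mult.assoc)
  qed
  have O2: "rot h h' - blk (r - r) h (- h') 0 \<in> q"
    by (rule block_rot_cong[OF bl q V(1-3) ch(1) hV(1) ch(2) hh])
  have O3: "rot (- r) (- r) - blk (r - r) (- r) (- (- r)) 0 \<in> q"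
    using V by (intro block_rot_cong[OF bl q V(1-3)] corner_intros alg_on_uminus)
      (simp_all add: rr ideal_ofD[OF q])
  have yxr: "y * (r * (x * r)) = r"
    by (simp add: nf)
  have xyr: "x * (r * (y * r)) = x * (y * r)"
    by (simp add: nf)
  have O4: "rot (- (x * r)) (- (y * r)) - blk (r - x * (y * r)) (- (x * r)) (- (- (y * r))) 0 \<in> q"
    using V xr yr by (intro block_rot_cong[OF bl q V(1-3)] corner_intros(4) alg_on_uminus alg_on_mult)
      (simp_all add: mult.assoc yxr xyr ideal_ofD[OF q])
  have omV: "rot a b \<in> alg_on V" if "a \<in> alg_on V" "b \<in> alg_on V" for a b
    unfolding rot_def using that V by (intro alg_intros)
  have blkV: "blk a b c d \<in> alg_on V" if "a \<in> alg_on V" "b \<in> alg_on V" "c \<in> alg_on V" "d \<in> alg_on V" for a b c d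
    unfolding blk_def using that V by (intro alg_intros)
  let ?B1 = "blk (r - x * y * r) (h * x) (- (y * h')) 0"
  let ?B2 = "blk (r - r) h (- h') 0"
  let ?B3 = "blk (r - r) (- r) (- (- r)) 0"
  let ?B4 = "blk (r - x * (y * r)) (- (x * r)) (- (- (y * r))) 0"
  have cong: "rot (h * x) (y * h') * (rot h h' * rot (- r) (- r)) * rot (- (x * r)) (- (y * r)) -
      ?B1 * (?B2 * ?B3) * ?B4 \<in> q"
    by (intro ideal_cong_mult[OF q] O1 O2 O3 O4 alg_on_mult omV blkV alg_intros hV V)
  have er: "r - x * y * r = e * r" "r - x * (y * r) = e * r"
    by (simp_all add: e_def left_diff_distrib mult.assoc)
  have cer: "corner (e * r)"
    by (simp add: corner_def nf)
  have "?B2 * ?B3 = blk h 0 0 h'"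
    using ch by (simp add: blk_mult corner_intros hr)
  also have "?B1 * blk h 0 0 h' = blk (e * r * h) (h * x * h') (- (y * h' * h)) 0"
    unfolding er using ch hx yh cer by (simp add: blk_mult corner_intros)
  also have "blk (e * r * h) (h * x * h') (- (y * h' * h)) 0 * ?B4 =
     blk (e * r * h * (e * r) + h * x * h' * (y * r)) (- (e * r * h * (x * r)))
       (- (y * h' * h * (e * r))) (y * h' * h * (x * r))"
  proof -
    have "corner (h * x * h')" "corner (y * h' * h)" "corner (e * r * h)"
      using hx yh ch cer corner_intros(5) by blast+
    then show ?thesis
      unfolding er using xr yr cer by (simp add: blk_mult corner_intros)
  qed
  also have "e * r * h * (e * r) = e * h"
    by (simp add: nf)
  also have "h * x * h' * (y * r) = x * y * (h * h')"
    by (simp add: nf)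
  also have "e * r * h * (x * r) = 0"
    by (simp add: nf)
  also have "y * h' * h * (e * r) = 0"
    by (simp add: nf)
  also have "y * h' * h * (x * r) = h' * h"
    by (simp add: nf)
  finally have prod: "?B1 * (?B2 * ?B3) * ?B4 = blk (e * h + x * y * (h * h')) (- 0) (- 0) (h' * h)"
    by simp
  have "blk (e * h + x * y * (h * h')) 0 0 (h' * h) - (1 + W * e) =
      x * y * (h * h' - r) + s' * ((h' * h - r) * s)"
  proof -
    have "e * h = r - x * y * r + W * e"
      using comm(3,4) comm(4)[symmetric, THEN mult_eq_left2] comm(3)[THEN mult_eq_left2]
      by (simp add: h_def e_def distrib_left left_diff_distrib right_diff_distrib mult.assoc)
    moreover have "s' * (r * s) = s' * s" using rs by simp
    ultimately show ?thesis
      by (simp add: blk_def left_diff_distrib right_diff_distrib)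
  qed
  also have "\<dots> \<in> q"
    using hh V by (intro ideal_ofD(3)[OF q] ideal_ofD(4)[OF q] ideal_ofD(5)[OF q] alg_on_mult)
  finally have "?B1 * (?B2 * ?B3) * ?B4 - (1 + W * e) \<in> q"
    unfolding prod by simp
  then show ?thesis
    unfolding e_def[symmetric] by (rule ideal_cong_trans[OF q cong])
qed

section \<open>Lifting a unit modulo an ideal\<close>

lemma pair_ideal_mono:
  assumes "V \<subseteq> V'" "f \<in> pair_ideal V i n"
  shows "f \<in> pair_ideal V' i n"
  using assms(2)
proof (induction rule: pair_ideal_induct)
  case (gen a s t k l)
  then show ?case
    using alg_on_mono[of "V - {n} - {i}" "V' - {n} - {i}"] assms(1) by (intro pair_ideal_gen) auto
qed (auto simp: pair_ideal_def intro: mat_ext.intros)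

lemma pair_ideal_local_unit:
  fixes f :: "'k::field alg"
  assumes "i \<noteq> n" "f \<in> pair_ideal V i n"
  shows "\<exists>d. \<forall>D\<ge>d. trunc n D * f = f \<and> f * trunc n D = f \<and> trunc i D * f = f \<and> f * trunc i D = f"
  using assms(2)
proof (induction rule: pair_ideal_induct)
  case (gen a s t k l)
  have ai: "a * trunc i D = trunc i D * a" for D
    by (rule alg_commute_var[OF gen]) (simp add: trunc_in)
  have ni: "E n k l * trunc i D = trunc i D * (E n k l :: 'k alg)" for D
    by (rule alg_on_commute[of _ "{n}" _ "{i}"]) (use assms in \<open>auto intro: E_in trunc_in\<close>)
  have "trunc i D * (a * E i s t * E n k l) = a * E i s t * E n k l" if "s < D" for D
    using ai[of D, symmetric] ai[of D, symmetric, THEN mult_eq_left2] that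
    by (simp add: mult.assoc trunc_E[THEN mult_eq_left])
  moreover have "a * E i s t * E n k l * trunc i D = a * E i s t * E n k l" if "t < D" for D
    using ni[of D] that
    by (simp add: mult.assoc E_trunc[THEN mult_eq_left])
  ultimately show ?case
    using assms(1) gen by (intro exI[of _ "Suc (s + t + k + l)"]) (auto simp: trunc_EE_trunc)
next
  case (add f g)
  then obtain d1 d2 where
    "\<forall>D\<ge>d1. trunc n D * f = f \<and> f * trunc n D = f \<and> trunc i D * f = f \<and> f * trunc i D = f"
    "\<forall>D\<ge>d2. trunc n D * g = g \<and> g * trunc n D = g \<and> trunc i D * g = g \<and> g * trunc i D = g"
    by blast
  then show ?case
    by (intro exI[of _ "max d1 d2"]) (simp add: distrib_right distrib_left)
qed simp

lemma if_mult:
  fixes c :: "'r::mult_zero"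
  shows "(if P then c else 0) * z = (if P then c * z else 0)" "z * (if P then c else 0) = (if P then z * c else 0)"
  by simp_all

text \<open>The representation holds for all large \<open>D\<close>, so that two elements can be
  written as matrices of one common size.\<close>

lemma mat_ext_pair_ideal_repr:
  fixes w :: "'k::field alg"
  assumes V: "i \<noteq> n" "i \<in> V" "n \<in> V" and w: "w \<in> mat_ext j (pair_ideal V i n)"
  shows "\<exists>c d. (\<forall>s t. c s t \<in> pair_ideal V i n) \<and>
    (\<forall>D\<ge>d. w = (\<Sum>s<D. \<Sum>t<D. c s t * E j s t)) \<and>
    (\<forall>D\<ge>d. \<forall>s t. trunc n D * c s t = c s t \<and> c s t * trunc n D = c s t)"
  using w
proof induction
  case mat_ext_zero
  show ?case
    by (intro exI[of _ "\<lambda>_ _. 0"]) (simp add: pair_ideal_def mat_ext.mat_ext_zero)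
next
  case (mat_ext_gen c s t)
  obtain d where d: "\<forall>D\<ge>d. trunc n D * c = c \<and> c * trunc n D = c"
    using pair_ideal_local_unit[OF V(1) mat_ext_gen] by blast
  have "c * E j s t = (\<Sum>s'<D. \<Sum>t'<D. (if s' = s \<and> t' = t then c else 0) * E j s' t')"
    if "D \<ge> d + s + t + 1" for D
  proof -
    have "(\<Sum>s'<D. \<Sum>t'<D. (if s' = s \<and> t' = t then c else 0) * E j s' t') =
        (\<Sum>s'<D. if s' = s then (\<Sum>t'<D. if t' = t then c * E j s' t' else 0) else 0)"
      by (intro sum.cong refl) (auto simp: if_mult)
    also have "\<dots> = c * E j s t"
      using that by simp
    finally show ?thesis by simp
  qed
  then show ?case
    using d mat_ext_gen
    by (intro exI[of _ "\<lambda>s' t'. if s' = s \<and> t' = t then c else 0"] exI[of _ "d + s + t + 1"])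
      (auto simp: pair_ideal_def mat_ext.mat_ext_zero)
next
  case (mat_ext_add a b)
  then obtain c1 d1 c2 d2 where
    1: "\<forall>s t. c1 s t \<in> pair_ideal V i n" "\<forall>D\<ge>d1. a = (\<Sum>s<D. \<Sum>t<D. c1 s t * E j s t)"
      "\<forall>D\<ge>d1. \<forall>s t. trunc n D * c1 s t = c1 s t \<and> c1 s t * trunc n D = c1 s t" and
    2: "\<forall>s t. c2 s t \<in> pair_ideal V i n" "\<forall>D\<ge>d2. b = (\<Sum>s<D. \<Sum>t<D. c2 s t * E j s t)"
      "\<forall>D\<ge>d2. \<forall>s t. trunc n D * c2 s t = c2 s t \<and> c2 s t * trunc n D = c2 s t"
    by blast
  have "a + b = (\<Sum>s<D. \<Sum>t<D. (c1 s t + c2 s t) * E j s t)" if "D \<ge> max d1 d2" for D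
    using 1(2)[rule_format, of D] 2(2)[rule_format, of D] that
    by (simp add: distrib_right sum.distrib)
  moreover have "c1 s t + c2 s t \<in> pair_ideal V i n" for s t
    using 1(1) 2(1) ideal_ofD(3)[OF ideal_of_pair_ideal[OF V(2,3,1)]] by blast
  ultimately show ?case
    using 1(3) 2(3)
    by (intro exI[of _ "\<lambda>s t. c1 s t + c2 s t"] exI[of _ "max d1 d2"])
      (simp add: distrib_left distrib_right)
qed

section \<open>Finite corners and shifts in the variable \<open>n\<close>\<close>

lemma trunc_trunc_in_pair_ideal:
  fixes i n :: nat
  assumes V: "i \<noteq> n" "i \<in> V" "n \<in> V"
  shows "trunc i D * trunc n D \<in> (pair_ideal V i n :: 'k::field alg set)"
proof -
  have "trunc i D * trunc n D = (\<Sum>s<D. \<Sum>k<D. 1 * E i s s * E n k k :: 'k alg)"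
    by (simp add: sum_E[symmetric] sum_product)
  also have "\<dots> \<in> pair_ideal V i n"
    by (intro ideal_sum[OF ideal_of_pair_ideal[OF V(2,3,1)]] pair_ideal_gen alg_on_1)
  finally show ?thesis .
qed

lemma Y_power_trunc: "Y n ^ D * trunc n D = (0 :: 'k::field alg)"
  by (simp add: trunc_def right_diff_distrib Y_power_X_power flip: mult.assoc)

lemma trunc_X_power: "trunc n D * X n ^ D = (0 :: 'k::field alg)"
  by (simp add: trunc_def left_diff_distrib Y_power_X_power mult.assoc)

text \<open>The shift \<open>X n ^ D\<close> carries the indices below \<open>D\<close> of the
  variable \<open>n\<close> to those from \<open>D\<close> to \<open>2 D - 1\<close>; this is the
  orthogonal copy of the corner.\<close>

lemma corner_block:
  fixes i n D :: nat
  assumes "i \<noteq> n"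
  defines "r \<equiv> trunc i D * trunc n D :: 'k::field alg"
  shows "block r (r * Y n ^ D) (X n ^ D * r)"
proof -
  have c: "trunc n D * trunc i D = trunc i D * (trunc n D :: 'k alg)"
    by (rule alg_on_commute[of _ "{n}" _ "{i}"]) (use assms in \<open>auto intro: trunc_in\<close>)
  note nf = mult.assoc c c[THEN mult_eq_left2] trunc_idem trunc_idem[THEN mult_eq_left]
  have rr: "r * r = r"
    by (simp add: r_def nf)
  have Yr: "Y n ^ D * r = 0"
    by (simp add: r_def Y_power_trunc[THEN mult_eq_left] flip: c)
  have rX: "r * X n ^ D = 0"
    by (simp add: r_def mult.assoc trunc_X_power)
  show ?thesis
  proof
    show "r * r = r" "r * (r * Y n ^ D) = r * Y n ^ D" "X n ^ D * r * r = X n ^ D * r"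
      using rr rr[THEN mult_eq_left] by (simp_all add: mult.assoc)
    show "r * Y n ^ D * r = 0" using Yr by (simp add: mult.assoc)
    show "r * (X n ^ D * r) = 0" using rX[THEN mult_eq_left] by simp
    show "r * Y n ^ D * (X n ^ D * r) = r"
      using rr by (simp add: mult.assoc Y_power_X_power[THEN mult_eq_left])
  qed
qed

lemma Y_power_trunc_multiple: "Y n ^ (d * Suc k) * trunc n d = (0 :: 'k::field alg)"
  by (simp only: mult_Suc_right power_add add.commute[of d] mult.assoc mult_zero_right Y_power_trunc)

lemma trunc_X_power_multiple: "trunc n d * X n ^ (d * Suc k) = (0 :: 'k::field alg)"
  by (simp only: mult_Suc_right power_add mult_zero_left trunc_X_power[THEN mult_eq_left])

text \<open>The shifts by \<open>d (s + 1)\<close> and \<open>d (t + 1)\<close> move the window of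
  indices below \<open>d\<close> to disjoint windows unless \<open>s = t\<close>.\<close>

lemma trunc_Y_X_trunc:
  "trunc n d * (Y n ^ (d * Suc s) * (X n ^ (d * Suc t) * trunc n d)) = (if s = t then trunc n d else (0 :: 'k::field alg))"
proof -
  consider "s = t" | "s < t" | "t < s" by linarith
  then show ?thesis
  proof cases
    case 1
    then show ?thesis
      by (simp add: trunc_idem Y_power_X_power[THEN mult_eq_left] del: mult_Suc_right)
  next
    case 2
    then obtain k where k: "t = s + Suc k" using less_iff_Suc_add by auto
    have "Y n ^ (d * Suc s) * X n ^ (d * Suc t) = (X n ^ (d * Suc k) :: 'k alg)"
      by (subst Y_power_X_power_le) (auto simp: k algebra_simps)
    then show ?thesis
      using 2 by (simp add: mult_eq_left trunc_X_power_multiple[THEN mult_eq_left] del: mult_Suc_right)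
  next
    case 3
    then obtain k where k: "s = t + Suc k" using less_iff_Suc_add by auto
    have "Y n ^ (d * Suc s) * X n ^ (d * Suc t) = (Y n ^ (d * Suc k) :: 'k alg)"
      by (subst Y_power_X_power_ge) (auto simp: k algebra_simps)
    then show ?thesis
      using 3 by (simp add: mult_eq_left Y_power_trunc_multiple del: mult_Suc_right)
  qed
qed

text \<open>A partial isometry and its adjoint that trade the index \<open>s < d\<close> of the variable \<open>j\<close> for a shift by
  \<open>d (s + 1)\<close> of the index of the variable \<open>n\<close>; the shift is at least \<open>d\<close>, which makes source and
  range orthogonal.\<close>

definition fold_up :: "nat \<Rightarrow> nat \<Rightarrow> nat \<Rightarrow> 'k::field alg" where
  "fold_up j n d = (\<Sum>s<d. E j s 0 * (trunc n d * Y n ^ (d * Suc s)))"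

definition fold_down :: "nat \<Rightarrow> nat \<Rightarrow> nat \<Rightarrow> 'k::field alg" where
  "fold_down j n d = (\<Sum>s<d. E j 0 s * (X n ^ (d * Suc s) * trunc n d))"

lemma fold_relations:
  fixes j n d :: nat
  assumes "j \<noteq> n"
  defines "p \<equiv> fold_up j n d :: 'k::field alg" and "p' \<equiv> fold_down j n d :: 'k alg"
  shows "p * p' = trunc j d * trunc n d" "p * p = 0" "p' * p' = 0" "p * p' * p = p" "p' * p * p' = p'"
proof -
  have c: "g * E j s t = E j s t * g" if "g \<in> alg_on {n}" for g :: "'k alg" and s t
    by (rule alg_on_commute[OF that, of _ "{j}"]) (use assms in \<open>auto intro: E_in\<close>)
  have sw: "(E j s t * g) * (E j u v * h) = (E j s t * E j u v) * (g * h)"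
    if "g \<in> alg_on {n}" for g h :: "'k alg" and s t u v
    using c[OF that, of u v, THEN mult_eq_left2] by (simp add: mult.assoc)
  have in1: "trunc n d * Y n ^ (d * Suc s) \<in> alg_on {n}" "X n ^ (d * Suc s) * trunc n d \<in> alg_on {n}" for s
    by (intro alg_intros trunc_in singletonI)+
  show pp': "p * p' = trunc j d * trunc n d"
  proof -
    have "p * p' = (\<Sum>s<d. \<Sum>t<d. if s = t then E j s s * trunc n d else 0)"
      unfolding p_def p'_def fold_up_def fold_down_def sum_product
      by (intro sum.cong refl, subst sw[OF in1(1)])
        (simp add: E_mult mult.assoc trunc_Y_X_trunc del: mult_Suc_right)
    then show ?thesis
      by (simp add: sum_E[symmetric, of j] sum_distrib_right)
  qed
  show "p * p = 0"
    unfolding p_def fold_up_def sum_product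
    by (intro sum.neutral ballI, subst sw[OF in1(1)])
      (simp add: mult.assoc Y_power_trunc_multiple[THEN mult_eq_left] del: mult_Suc_right)
  show "p' * p' = 0"
    unfolding p'_def fold_down_def sum_product
    by (intro sum.neutral ballI, subst sw[OF in1(2)])
      (simp add: mult.assoc trunc_X_power_multiple[THEN mult_eq_left] del: mult_Suc_right)
  have trj: "trunc n d * trunc j d = trunc j d * (trunc n d :: 'k alg)"
    by (rule alg_on_commute[of _ "{n}" _ "{j}"]) (use assms in \<open>auto intro: trunc_in\<close>)
  have "trunc j d * trunc n d * p = p"
    unfolding p_def fold_up_def sum_distrib_left
  proof (intro sum.cong refl)
    fix s assume "s \<in> {..<d}"
    have "trunc j d * trunc n d * (E j s 0 * (trunc n d * Y n ^ (d * Suc s))) =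
        (trunc j d * E j s 0) * (trunc n d * trunc n d * Y n ^ (d * Suc s) :: 'k alg)"
      using c[OF trunc_in[OF singletonI], of d s 0, THEN mult_eq_left2] by (simp add: mult.assoc)
    then show "trunc j d * trunc n d * (E j s 0 * (trunc n d * Y n ^ (d * Suc s))) =
        (E j s 0 * (trunc n d * Y n ^ (d * Suc s)) :: 'k alg)"
      using \<open>s \<in> {..<d}\<close> by (simp add: trunc_E trunc_idem)
  qed
  then show "p * p' * p = p" by (simp add: pp')
  have "p' * (trunc j d * trunc n d) = p'"
    unfolding p'_def fold_down_def sum_distrib_right
  proof (intro sum.cong refl)
    fix s assume "s \<in> {..<d}"
    have cj: "X n ^ (d * Suc s) * trunc n d * trunc j d = trunc j d * (X n ^ (d * Suc s) * trunc n d :: 'k alg)"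
      by (rule alg_on_commute[OF in1(2), of _ "{j}"]) (use assms in \<open>auto intro: trunc_in\<close>)
    have "E j 0 s * (X n ^ (d * Suc s) * trunc n d) * (trunc j d * trunc n d) =
        E j 0 s * (X n ^ (d * Suc s) * trunc n d * trunc j d) * (trunc n d :: 'k alg)"
      by (simp only: mult.assoc)
    also have "\<dots> = (E j 0 s * trunc j d) * (X n ^ (d * Suc s) * (trunc n d * trunc n d))"
      unfolding cj by (simp only: mult.assoc)
    finally show "E j 0 s * (X n ^ (d * Suc s) * trunc n d) * (trunc j d * trunc n d) =
        (E j 0 s * (X n ^ (d * Suc s) * trunc n d) :: 'k alg)"
      using \<open>s \<in> {..<d}\<close> by (simp add: E_trunc trunc_idem)
  qed
  then show "p' * p * p' = p'" by (simp add: pp' mult.assoc)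
qed

text \<open>The entry \<open>c s t\<close> of a \<open>d\<close> by \<open>d\<close> matrix in the
  indices of \<open>j\<close> becomes the block \<open>(s + 1, t + 1)\<close> of size
  \<open>d\<close> in the indices of \<open>n\<close>; of the variable \<open>j\<close> only
  \<open>e0 j\<close> is left.\<close>

lemma fold_conj:
  fixes c :: "nat \<Rightarrow> nat \<Rightarrow> 'k::field alg"
  assumes jn: "j \<noteq> n" and c: "\<And>s t. c s t \<in> alg_on (V - {j})"
    and trc: "\<And>s t. trunc n d * c s t = c s t" "\<And>s t. c s t * trunc n d = c s t"
  defines "w \<equiv> (\<Sum>s<d. \<Sum>t<d. c s t * E j s t)"
  shows "fold_down j n d * w * fold_up j n d =
      (\<Sum>s<d. \<Sum>t<d. X n ^ (d * Suc s) * c s t * Y n ^ (d * Suc t)) * e0 j"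
    and "trunc j d * trunc n d * w = w" and "w * (trunc j d * trunc n d) = w"
proof -
  have cc: "E j u v * c s t = c s t * E j u v" for u v s t
    by (rule alg_commute_var[OF c, symmetric]) (simp add: E_in)
  have cn: "g * E j u v = E j u v * g" if "g \<in> alg_on {n}" for g :: "'k alg" and u v
    by (rule alg_on_commute[OF that, of _ "{j}"]) (use jn in \<open>auto intro: E_in\<close>)
  have in1: "trunc n d * Y n ^ (d * Suc s) \<in> alg_on {n}" "X n ^ (d * Suc s) * trunc n d \<in> alg_on {n}" for s
    by (intro alg_intros trunc_in singletonI)+
  have ent: "E j 0 u * w * E j v 0 = c u v * e0 j" if "u < d" "v < d" for u v
  proof -
    have "E j 0 u * w * E j v 0 = (\<Sum>s<d. \<Sum>t<d. c s t * (E j 0 u * E j s t * E j v 0))"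
      unfolding w_def sum_distrib_left sum_distrib_right
      using cc[THEN mult_eq_left2] by (simp add: mult.assoc)
    also have "\<dots> = (\<Sum>s<d. if s = u then (\<Sum>t<d. if t = v then c s t * e0 j else 0) else 0)"
      by (intro sum.cong refl) (auto simp: E_mult if_mult)
    also have "\<dots> = c u v * e0 j"
      using that by (simp add: if_mult)
    finally show ?thesis .
  qed
  have "fold_down j n d * w * fold_up j n d =
     (\<Sum>s<d. \<Sum>t<d. (E j 0 s * (X n ^ (d * Suc s) * trunc n d)) * w * (E j t 0 * (trunc n d * Y n ^ (d * Suc t))))"
    unfolding fold_up_def fold_down_def by (simp only: sum_distrib_left sum_distrib_right) (rule sum.swap)
  also have "\<dots> = (\<Sum>s<d. \<Sum>t<d. X n ^ (d * Suc s) * c s t * Y n ^ (d * Suc t) * e0 j)"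
  proof (intro sum.cong refl)
    fix s t assume "s \<in> {..<d}" "t \<in> {..<d}"
    have "(E j 0 s * (X n ^ (d * Suc s) * trunc n d)) * w * (E j t 0 * (trunc n d * Y n ^ (d * Suc t))) =
      (X n ^ (d * Suc s) * trunc n d) * (E j 0 s * w * E j t 0) * (trunc n d * Y n ^ (d * Suc t))"
      unfolding cn[OF in1(2), symmetric] by (simp only: mult.assoc)
    also have "\<dots> = (X n ^ (d * Suc s) * trunc n d) * c s t * (e0 j * (trunc n d * Y n ^ (d * Suc t)))"
      using ent \<open>s \<in> {..<d}\<close> \<open>t \<in> {..<d}\<close> by (simp add: mult.assoc)
    also have "\<dots> = X n ^ (d * Suc s) * (trunc n d * c s t * trunc n d) * Y n ^ (d * Suc t) * e0 j"
      unfolding cn[OF in1(1), symmetric] by (simp only: mult.assoc)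
    finally show "(E j 0 s * (X n ^ (d * Suc s) * trunc n d)) * w * (E j t 0 * (trunc n d * Y n ^ (d * Suc t))) =
      X n ^ (d * Suc s) * c s t * Y n ^ (d * Suc t) * e0 j"
      by (simp only: trc)
  qed
  finally show "fold_down j n d * w * fold_up j n d =
      (\<Sum>s<d. \<Sum>t<d. X n ^ (d * Suc s) * c s t * Y n ^ (d * Suc t)) * e0 j"
    by (simp only: sum_distrib_right)
  have ctj: "trunc j d * c s t = c s t * trunc j d" for s t
    by (rule alg_commute_var[OF c, symmetric]) (simp add: trunc_in)
  have trE: "trunc j d * (c s t * E j s t) = c s t * E j s t" "c s t * E j s t * trunc j d = c s t * E j s t"
    if "s < d" "t < d" for s t
    using that ctj[of s t, THEN mult_eq_left2] by (simp_all add: mult.assoc trunc_E E_trunc)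
  have trn: "trunc n d * (c s t * E j s t) = c s t * E j s t" "c s t * E j s t * trunc n d = c s t * E j s t" for s t
    using trc[THEN mult_eq_left] cn[OF trunc_in[OF singletonI], of d s t] by (simp_all add: mult.assoc flip: cn[OF trunc_in[OF singletonI]])
  have "trunc n d * w = w" "w * trunc n d = w"
    unfolding w_def by (simp_all only: sum_distrib_left sum_distrib_right trn)
  moreover have "trunc j d * w = w" "w * trunc j d = w"
    unfolding w_def sum_distrib_left sum_distrib_right by (intro sum.cong refl; simp add: trE)+
  ultimately show "trunc j d * trunc n d * w = w" "w * (trunc j d * trunc n d) = w"
    by (simp_all add: mult.assoc) (simp flip: mult.assoc)
qed

text \<open>One removal step: \<open>q\<close> is the ideal of the remaining triples and
  \<open>w\<close> the part of \<open>u - 1\<close> in \<open>p_i p_j p_n\<close>. The inverse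
  relations hold only modulo \<open>q\<close>, yet \<open>Z\<close> is a product of genuine
  elementary elements and hence a lift.\<close>

lemma elementary_mod_ideal:
  fixes u v :: "'k::field alg"
  assumes V: "i \<in> V" "n \<in> V" "j \<in> V" "i \<noteq> n" "j \<noteq> n" "i \<noteq> j"
    and B: "finite B" "i \<notin> B" "n \<notin> B" "j \<notin> B" and q: "ideal_of V q"
    and e: "\<And>k. k \<in> B \<Longrightarrow> k \<in> V \<Longrightarrow> e0 i * e0 k * e0 n \<in> q"
    and ker: "\<And>f. f \<in> q \<Longrightarrow> reduce B f = 0"
    and uv: "inv_pair V u v"
    and w: "w \<in> mat_ext j (pair_ideal (V - {j}) i n)" and uw: "u - 1 - w \<in> q"
  shows "\<exists>Z\<in>elem_grp V i n. u - Z \<in> q"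
proof -
  have Vj: "i \<in> V - {j}" "n \<in> V - {j}" using V by auto
  have PJ: "ideal_of V (mat_ext j (pair_ideal (V - {j}) i n) :: 'k alg set)"
    by (intro ideal_of_mat_ext ideal_of_pair_ideal) (use V in auto)
  have u: "u \<in> alg_on V" and v: "v \<in> alg_on V" and uv1: "u * v = 1" and vu1: "v * u = 1"
    using uv by (auto simp: inv_pair_def)
  \<comment> \<open>Since \<open>v = 1 - v (u - 1)\<close>, the inverse is \<open>1 - v w\<close>
    modulo \<open>q\<close>, again with its second term in \<open>p_i p_j p_n\<close>.\<close>
  define w' where "w' = - (v * w)"
  have w': "w' \<in> mat_ext j (pair_ideal (V - {j}) i n)"
    unfolding w'_def using w v by (intro ideal_uminus[OF PJ] ideal_ofD(4)[OF PJ])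
  have "v - 1 - w' = - (v * (u - 1 - w))"
    using vu1 by (simp add: w'_def right_diff_distrib)
  then have vw: "v - 1 - w' \<in> q"
    using v uw by (simp only:) (intro ideal_uminus[OF q] ideal_ofD(4)[OF q])
  have wV: "w \<in> alg_on V" "w' \<in> alg_on V" using ideal_ofD(1)[OF PJ] w w' by auto
  have 1: "u - (1 + w) \<in> q" "v - (1 + w') \<in> q" using uw vw by (simp_all add: algebra_simps)
  have "u * v - (1 + w) * (1 + w') \<in> q" "v * u - (1 + w') * (1 + w) \<in> q"
    using u v wV by (intro ideal_cong_mult[OF q] 1 alg_on_add alg_on_1; simp)+
  then have "- (u * v - (1 + w) * (1 + w')) \<in> q" "- (v * u - (1 + w') * (1 + w)) \<in> q"
    by (intro ideal_uminus[OF q]; simp)+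
  then have z: "w + w' + w * w' \<in> q" "w + w' + w' * w \<in> q"
    by (simp_all add: uv1 vu1 algebra_simps)
  obtain c1 d1 c2 d2 where
    c1: "\<forall>s t. c1 s t \<in> pair_ideal (V - {j}) i n" "\<forall>D\<ge>d1. w = (\<Sum>s<D. \<Sum>t<D. c1 s t * E j s t)"
      "\<forall>D\<ge>d1. \<forall>s t. trunc n D * c1 s t = c1 s t \<and> c1 s t * trunc n D = c1 s t" and
    c2: "\<forall>s t. c2 s t \<in> pair_ideal (V - {j}) i n" "\<forall>D\<ge>d2. w' = (\<Sum>s<D. \<Sum>t<D. c2 s t * E j s t)"
      "\<forall>D\<ge>d2. \<forall>s t. trunc n D * c2 s t = c2 s t \<and> c2 s t * trunc n D = c2 s t"
    using mat_ext_pair_ideal_repr[OF V(4) Vj w] mat_ext_pair_ideal_repr[OF V(4) Vj w'] by blast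
  define d where "d = max d1 d2"
  have wd: "w = (\<Sum>s<d. \<Sum>t<d. c1 s t * E j s t)" "w' = (\<Sum>s<d. \<Sum>t<d. c2 s t * E j s t)"
    and tc1: "\<And>s t. trunc n d * c1 s t = c1 s t" "\<And>s t. c1 s t * trunc n d = c1 s t"
    and tc2: "\<And>s t. trunc n d * c2 s t = c2 s t" "\<And>s t. c2 s t * trunc n d = c2 s t"
    using c1(2,3) c2(2,3) by (simp_all add: d_def)
  define W where "W = (\<Sum>s<d. \<Sum>t<d. X n ^ (d * Suc s) * c1 s t * Y n ^ (d * Suc t))"
  define W' where "W' = (\<Sum>s<d. \<Sum>t<d. X n ^ (d * Suc s) * c2 s t * Y n ^ (d * Suc t))"
  have SpJ: "ideal_of (V - {j}) (pair_ideal (V - {j}) i n :: 'k alg set)"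
    by (rule ideal_of_pair_ideal[OF Vj V(4)])
  have SpV: "ideal_of V (pair_ideal V i n :: 'k alg set)"
    by (rule ideal_of_pair_ideal[OF V(1,2,4)])
  have WS: "W \<in> pair_ideal (V - {j}) i n" "W' \<in> pair_ideal (V - {j}) i n"
    unfolding W_def W'_def using c1(1) c2(1) Vj
    by (intro ideal_sum[OF SpJ] ideal_ofD(5)[OF SpJ ideal_ofD(4)[OF SpJ]] alg_on_power X_in Y_in; simp)+
  then have WJ: "W \<in> alg_on (V - {j})" "W' \<in> alg_on (V - {j})"
    using ideal_ofD(1)[OF SpJ] by auto
  have cJ: "c1 s t \<in> alg_on (V - {j})" "c2 s t \<in> alg_on (V - {j})" for s t
    using ideal_ofD(1)[OF SpJ] c1(1) c2(1) by auto
  define p where "p = (fold_up j n d :: 'k alg)"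
  define p' where "p' = (fold_down j n d :: 'k alg)"
  note rel = fold_relations[OF V(5), of d, where ?'k = 'k, folded p_def p'_def]
  have pV: "p \<in> alg_on V" "p' \<in> alg_on V"
    unfolding p_def p'_def fold_up_def fold_down_def using V
    by (intro alg_intros E_in trunc_in; simp)+
  note f1 = fold_conj[where c = c1, OF V(5) cJ(1) tc1, folded wd(1) W_def p_def p'_def rel(1)]
  note f2 = fold_conj[where c = c2, OF V(5) cJ(2) tc2, folded wd(2) W'_def p_def p'_def rel(1)]
  have e0c: "e0 j * W = W * e0 j" "e0 j * W' = W' * e0 j"
    by (rule alg_commute_var[OF WJ(1), symmetric] alg_commute_var[OF WJ(2), symmetric]; simp add: E_in)+
  have e0e0: "e0 j * e0 j = (e0 j :: 'k alg)" by (simp add: E_mult)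
  have mulW: "p' * (x * x') * p = (U * U') * e0 j"
    if "p' * x * p = U * e0 j" "p' * x' * p = U' * e0 j" "x * (p * p') = x" "e0 j * U' = U' * e0 j" for x x' U U'
  proof -
    have "p' * (x * x') * p = p' * (x * (p * p') * x') * p" by (simp only: that(3))
    also have "\<dots> = (p' * x * p) * (p' * x' * p)" by (simp only: mult.assoc)
    also have "\<dots> = U * (e0 j * U') * e0 j" unfolding that(1,2) by (simp only: mult.assoc)
    also have "\<dots> = (U * U') * (e0 j * e0 j)" unfolding that(4) by (simp only: mult.assoc)
    finally show ?thesis by (simp only: e0e0)
  qed
  have inq: "p' * x * p \<in> q" if "x \<in> q" for x
    using that pV by (intro ideal_ofD(5)[OF q ideal_ofD(4)[OF q]])
  \<comment> \<open>Folding the relations \<open>z\<close> gives those for \<open>W\<close> and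
    \<open>W'\<close> only up to the factor \<open>e0 j\<close>, which
    \<open>mem_if_mult_e0_mem\<close> cancels.\<close>
  have Wz: "W + W' + W * W' \<in> q" "W + W' + W' * W \<in> q"
  proof -
    have "(W + W' + W * W') * e0 j = p' * (w + w' + w * w') * p"
      using mulW[OF f1(1) f2(1) f1(3) e0c(2)] f1(1) f2(1)
      by (simp add: distrib_left distrib_right)
    then have a: "(W + W' + W * W') * e0 j \<in> q" using inq[OF z(1)] by simp
    have "(W + W' + W' * W) * e0 j = p' * (w + w' + w' * w) * p"
      using mulW[OF f2(1) f1(1) f2(3) e0c(1)] f1(1) f2(1)
      by (simp add: distrib_left distrib_right)
    then have b: "(W + W' + W' * W) * e0 j \<in> q" using inq[OF z(2)] by simp
    have S: "W + W' + W * W' \<in> pair_ideal (V - {j}) i n" "W + W' + W' * W \<in> pair_ideal (V - {j}) i n"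
      using WS WJ by (intro ideal_ofD(3)[OF SpJ] ideal_ofD(4)[OF SpJ]; simp)+
    have S': "x \<in> q" if "x \<in> pair_ideal (V - {j}) i n" "x * e0 j \<in> q" for x
      by (rule mem_if_mult_e0_mem[OF V(4,1,2) B(4,1-3) q e ker pair_ideal_mono[OF _ that(1)] ideal_ofD(1)[OF SpJ that(1)] that(2)])
        auto
    show "W + W' + W * W' \<in> q" "W + W' + W' * W \<in> q"
      using S' S a b by blast+
  qed
  obtain D1 D2 where
    D1: "\<forall>D\<ge>D1. trunc n D * W = W \<and> W * trunc n D = W \<and> trunc i D * W = W \<and> W * trunc i D = W" and
    D2: "\<forall>D\<ge>D2. trunc n D * W' = W' \<and> W' * trunc n D = W' \<and> trunc i D * W' = W' \<and> W' * trunc i D = W'"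
    using pair_ideal_local_unit[OF V(4) WS(1)] pair_ideal_local_unit[OF V(4) WS(2)] by blast
  \<comment> \<open>A second size, because folding has spread \<open>W\<close> and \<open>W'\<close>
    over the indices of \<open>n\<close> below \<open>d (d + 1)\<close>.\<close>
  define D where "D = max D1 D2"
  define r where "r = (trunc i D * trunc n D :: 'k alg)"
  define s where "s = r * Y n ^ D"
  define s' where "s' = X n ^ D * r"
  have bl: "block r s s'"
    unfolding r_def s_def s'_def by (rule corner_block[OF V(4)])
  interpret block r s s' by (rule bl)
  have "trunc n D * W = W" "W * trunc n D = W" "trunc i D * W = W" "W * trunc i D = W"
    "trunc n D * W' = W'" "W' * trunc n D = W'" "trunc i D * W' = W'" "W' * trunc i D = W'"
    using D1 D2 by (simp_all add: D_def)
  then have cW: "corner W" "corner W'"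
    unfolding corner_def unfolding r_def by (simp_all add: mult.assoc mult_eq_left)
  have rS: "r \<in> pair_ideal V i n"
    unfolding r_def by (rule trunc_trunc_in_pair_ideal[OF V(4,1,2)])
  have rJ: "r \<in> alg_on (V - {j})"
    unfolding r_def using Vj by (intro alg_on_mult trunc_in)
  have rV: "r \<in> alg_on V" "s \<in> alg_on V" "s' \<in> alg_on V"
    using ideal_ofD(1)[OF SpV rS] V unfolding s_def s'_def by (auto intro!: alg_intros)
  have WSV: "W \<in> pair_ideal V i n" "W' \<in> pair_ideal V i n"
    using pair_ideal_mono[OF _ WS(1), of V] pair_ideal_mono[OF _ WS(2), of V] by auto
  have WV: "W \<in> alg_on V" "W' \<in> alg_on V"
    using ideal_ofD(1)[OF SpV] WSV by auto
  have XYV: "X j \<in> alg_on V" "Y j \<in> alg_on V" using V by (auto intro: X_in Y_in)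
  have commX: "X j * g = g * X j" "Y j * g = g * Y j" if "g \<in> alg_on (V - {j})" for g :: "'k alg"
    by (rule alg_commute_var[OF that, symmetric]; intro X_in Y_in singletonI)+
  define Z where "Z = rot ((r + W) * X j) (Y j * (r + W')) * (rot (r + W) (r + W') * rot (- r) (- r)) *
     rot (- (X j * r)) (- (Y j * r))"
  have Zq: "Z - (1 + W * e0 j) \<in> q"
    unfolding Z_def
    using block_elementary_cong[OF bl q rV XYV WV Y_X commX[OF rJ] commX[OF WJ(1)] commX[OF WJ(2)] cW Wz]
    by (simp add: E_eq)
  have trr: "trunc n D * r = r" "r * trunc n D = r"
  proof -
    have "trunc n D * trunc i D = trunc i D * (trunc n D :: 'k alg)"
      by (rule alg_on_commute[of _ "{n}" _ "{i}"]) (use V in \<open>auto intro: trunc_in\<close>)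
    then show "trunc n D * r = r" "r * trunc n D = r"
      by (simp_all add: r_def mult.assoc trunc_idem mult_eq_left2)
  qed
  have G1: "1 + a * s \<in> elem_grp V i n" if a: "a \<in> pair_ideal V i n" "corner a" for a
  proof -
    have ar: "a * r = a" "r * a = a" using a(2) by (auto simp: corner_def)
    have as: "a * s = a * Y n ^ D" using ar unfolding s_def by (simp flip: mult.assoc)
    have "trunc n D * a = a" using ar trr by (metis mult.assoc)
    then have "trunc n D * (a * Y n ^ D) * (1 - trunc n D) = a * Y n ^ D"
      using Y_power_trunc[of n D, where ?'k = 'k] by (simp add: right_diff_distrib mult.assoc mult_eq_left)
    moreover have "a * Y n ^ D \<in> pair_ideal V i n"
      using a V by (intro ideal_ofD(5)[OF SpV] alg_on_power Y_in)
    ultimately show ?thesis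
      using upper_in_elem_grp[OF V(4), of "a * Y n ^ D" V D] as by simp
  qed
  have G2: "1 + s' * b \<in> elem_grp V i n" if b: "b \<in> pair_ideal V i n" "corner b" for b
  proof -
    have br: "b * r = b" "r * b = b" using b(2) by (auto simp: corner_def)
    have sb: "s' * b = X n ^ D * b" using br unfolding s'_def by (simp add: mult.assoc)
    have "b * trunc n D = b" using br trr by (metis mult.assoc)
    then have "(1 - trunc n D) * (X n ^ D * b) * trunc n D = X n ^ D * b"
      using trunc_X_power[of n D, where ?'k = 'k] by (simp add: left_diff_distrib mult.assoc mult_eq_left)
    moreover have "X n ^ D * b \<in> pair_ideal V i n"
      using b V by (intro ideal_ofD(4)[OF SpV] alg_on_power X_in)
    ultimately show ?thesis
      using lower_in_elem_grp[OF V(4), of "X n ^ D * b" V D] sb by simp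
  qed
  have omG: "rot a b \<in> elem_grp V i n" if "a \<in> pair_ideal V i n" "corner a" "b \<in> pair_ideal V i n" "corner b" for a b
    unfolding rot_def using that
    by (intro elem_grp_mult G1 G2 ideal_uminus[OF SpV] corner_intros)
  have hS: "r + W \<in> pair_ideal V i n" "r + W' \<in> pair_ideal V i n"
    using rS WSV by (auto intro: ideal_ofD(3)[OF SpV])
  have ch: "corner (r + W)" "corner (r + W')" using cW by (auto intro: corner_intros)
  have cX: "corner (g * X j)" "corner (Y j * g)" "corner (X j * g)" if "corner g" "X j * g = g * X j" for g
    using that commX[OF rJ] commX[OF rJ, THEN mult_eq_left2] commX[OF rJ, symmetric, THEN mult_eq_left2]
    unfolding corner_def by (simp_all add: mult.assoc) (metis mult.assoc)+
  have "X j * (r + W) = (r + W) * X j" "X j * (r + W') = (r + W') * X j" "X j * r = r * X j"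
    using commX[OF rJ] commX[OF WJ(1)] commX[OF WJ(2)] by (simp_all add: distrib_left distrib_right)
  note cX' = cX[OF ch(1) this(1)] cX[OF ch(2) this(2)] cX[OF corner_intros(2) this(3)]
  have ZG: "Z \<in> elem_grp V i n"
    unfolding Z_def
    by (intro elem_grp_mult omG[OF ideal_ofD(5)[OF SpV hS(1) XYV(1)] cX'(1) ideal_ofD(4)[OF SpV hS(2) XYV(2)] cX'(5)]
        omG[OF hS(1) ch(1) hS(2) ch(2)]
        omG[OF ideal_uminus[OF SpV rS] corner_intros(4)[OF corner_intros(2)]
          ideal_uminus[OF SpV rS] corner_intros(4)[OF corner_intros(2)]]
        omG[OF ideal_uminus[OF SpV ideal_ofD(4)[OF SpV rS XYV(1)]] corner_intros(4)[OF cX'(9)]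
          ideal_uminus[OF SpV ideal_ofD(4)[OF SpV rS XYV(2)]] corner_intros(4)[OF cX'(8)]])
  \<comment> \<open>The permutation matrix that undoes the folding: it conjugates
    \<open>1 + W * e0 j\<close> to \<open>1 + w\<close>.\<close>
  define P where "P = 1 - p * p' - p' * p + p + p'"
  note swap = swap_involution[OF rel(2-5), folded P_def]
  have PV: "P \<in> alg_on V" unfolding P_def using pV by (intro alg_intros)
  have PP: "inv_pair V P P" using swap(1) PV by (simp add: inv_pair_def)
  have "P * (1 + W * e0 j) * P = P * P + P * (p' * w * p) * P"
    by (simp add: f1(1) distrib_left distrib_right)
  also have "\<dots> = 1 + w"
    using swap f1(2,3) by (simp add: mult.assoc)
  finally have "P * Z * P - (1 + w) = P * (Z - (1 + W * e0 j)) * P"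
    by (simp add: left_diff_distrib right_diff_distrib)
  then have PZ: "P * Z * P - (1 + w) \<in> q"
    using PV Zq by (simp only:) (intro ideal_ofD(5)[OF q ideal_ofD(4)[OF q]])
  have "u - P * Z * P = (u - 1 - w) - (P * Z * P - (1 + w))"
    by simp
  then have "u - P * Z * P \<in> q"
    using ideal_diff[OF q uw PZ] by simp
  then show ?thesis
    using elem_grp_conj[OF V(4,1,2) PP ZG] by blast
qed

section \<open>Units congruent to one modulo triple products\<close>

inductive_set ideal_span :: "nat set \<Rightarrow> 'k::field alg set \<Rightarrow> 'k alg set" for V A where
  ideal_span_zero: "0 \<in> ideal_span V A"
| ideal_span_gen: "a \<in> A \<Longrightarrow> a \<in> ideal_span V A"
| ideal_span_add: "a \<in> ideal_span V A \<Longrightarrow> b \<in> ideal_span V A \<Longrightarrow> a + b \<in> ideal_span V A"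
| ideal_span_lmul: "a \<in> ideal_span V A \<Longrightarrow> r \<in> alg_on V \<Longrightarrow> r * a \<in> ideal_span V A"
| ideal_span_rmul: "a \<in> ideal_span V A \<Longrightarrow> r \<in> alg_on V \<Longrightarrow> a * r \<in> ideal_span V A"

lemma ideal_span_least:
  assumes "ideal_of V I" "A \<subseteq> I"
  shows "ideal_span V A \<subseteq> I"
proof
  fix f assume "f \<in> ideal_span V A"
  then show "f \<in> I"
    by induction (use assms ideal_ofD[OF assms(1)] in auto)
qed

lemma ideal_of_ideal_span:
  assumes "A \<subseteq> alg_on V"
  shows "ideal_of V (ideal_span V A)"
  unfolding ideal_of_def
  using ideal_span_least[OF ideal_of_alg_on assms] by (auto intro: ideal_span.intros)

lemma ideal_span_mono: "A \<subseteq> ideal_span V A' \<Longrightarrow> f \<in> ideal_span V A \<Longrightarrow> f \<in> ideal_span V A'"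
  by (rotate_tac, induction rule: ideal_span.induct) (auto intro: ideal_span.intros)

lemma ideal_span_Un_split:
  assumes "f \<in> ideal_span V (A \<union> A')"
  shows "\<exists>a\<in>ideal_span V A. \<exists>b\<in>ideal_span V A'. f = a + b"
  using assms
proof induction
  case ideal_span_zero
  then show ?case by (metis add_0 ideal_span.ideal_span_zero)
next
  case (ideal_span_gen a)
  then show ?case
    by (metis UnE add_0 add_0_right ideal_span.ideal_span_gen ideal_span.ideal_span_zero)
next
  case (ideal_span_add f g)
  then obtain a b a' b' where "a \<in> ideal_span V A" "b \<in> ideal_span V A'" "f = a + b"
    "a' \<in> ideal_span V A" "b' \<in> ideal_span V A'" "g = a' + b'" by blast
  then show ?case
    by (intro bexI[of _ "a + a'"] bexI[of _ "b + b'"] ideal_span.ideal_span_add) (simp_all add: algebra_simps)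
qed (metis distrib_left distrib_right ideal_span.ideal_span_lmul ideal_span.ideal_span_rmul)+

lemma ideal_span_reduce:
  assumes "f \<in> ideal_span V A" "\<And>a. a \<in> A \<Longrightarrow> reduce B a = 0"
  shows "reduce B f = 0"
  using assms(1) by induction (simp_all add: assms(2) reduce_add reduce_mult_zero)

text \<open>Words in any order; the fixed order of the statement is modelled by
  \<open>elem_prod_list\<close>, and normality of the factors identifies the two in
  \<open>elem_prod_list_eq\<close>.\<close>

inductive_set elem_prod :: "nat set \<Rightarrow> nat \<Rightarrow> nat set \<Rightarrow> 'k::field alg set" for V n S where
  elem_prod_one: "1 \<in> elem_prod V n S"
| elem_prod_mul: "m \<in> elem_prod V n S \<Longrightarrow> i \<in> S \<Longrightarrow> g \<in> elem_grp V i n \<Longrightarrow> m * g \<in> elem_prod V n S"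

lemma elem_prod_mult:
  assumes "a \<in> elem_prod V n S" "b \<in> elem_prod V n S"
  shows "a * b \<in> elem_prod V n S"
  using assms(2) by induction (simp_all add: assms(1) elem_prod_mul flip: mult.assoc)

lemma elem_grp_in_elem_prod: "i \<in> S \<Longrightarrow> g \<in> elem_grp V i n \<Longrightarrow> g \<in> elem_prod V n S"
  using elem_prod_mul[OF elem_prod_one] by (metis mult_1)

lemma elem_prod_mono:
  assumes "S \<subseteq> S'" "m \<in> elem_prod V n S"
  shows "m \<in> elem_prod V n S'"
  using assms(2) by induction (use assms(1) in \<open>auto intro: elem_prod.intros\<close>)

lemma elem_prod_inverse:
  assumes "n \<in> V" "S \<subseteq> V - {n}" "m \<in> elem_prod V n S"
  shows "\<exists>m'\<in>elem_prod V n S. inv_pair V m m'"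
  using assms(3)
proof induction
  case elem_prod_one
  then show ?case by (auto simp: inv_pair_def intro!: bexI[of _ 1] elem_prod.elem_prod_one)
next
  case (elem_prod_mul m i g)
  then obtain m' where m': "m' \<in> elem_prod V n S" "inv_pair V m m'" by blast
  obtain g' where g': "g' \<in> elem_grp V i n" "inv_pair V g g'"
    using elem_grp_inverse[of i n V g] elem_prod_mul.hyps assms by blast
  have "g' * m' \<in> elem_prod V n S"
    using elem_prod_mult[OF elem_grp_in_elem_prod[OF elem_prod_mul.hyps(2) g'(1)] m'(1)] .
  then show ?case
    using inv_pair_mult[OF m'(2) g'(2)] by blast
qed

lemma elem_prod_conj:
  assumes "n \<in> V" "S \<subseteq> V - {n}" "inv_pair V u v" "m \<in> elem_prod V n S"
  shows "u * m * v \<in> elem_prod V n S"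
  using assms(4)
proof induction
  case elem_prod_one
  then show ?case using assms(3) by (simp add: inv_pair_def elem_prod.elem_prod_one)
next
  case (elem_prod_mul m i g)
  have "u * (m * g) * v = u * m * (v * u) * g * v"
    using assms(3) by (simp add: inv_pair_def mult.assoc)
  also have "\<dots> = (u * m * v) * (u * g * v)"
    by (simp only: mult.assoc)
  finally have "u * (m * g) * v = (u * m * v) * (u * g * v)" .
  moreover have "u * g * v \<in> elem_grp V i n"
    using elem_prod_mul.hyps assms by (intro elem_grp_conj) auto
  ultimately show ?case
    using elem_prod_mul by (auto intro: elem_prod.elem_prod_mul)
qed

fun elem_prod_list :: "nat set \<Rightarrow> nat \<Rightarrow> nat list \<Rightarrow> 'k::field alg set" where
  "elem_prod_list V n [] = {1}"
| "elem_prod_list V n (i # is) = {a * b | a b. a \<in> elem_grp V i n \<and> b \<in> elem_prod_list V n is}"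

lemma elem_prod_list_sub: "elem_prod_list V n is \<subseteq> elem_prod V n (set is)"
proof (induction "is")
  case Nil
  then show ?case by (simp add: elem_prod_one)
next
  case (Cons i "is")
  then show ?case
    using elem_prod_mono[of "set is" "set (i # is)"] by (auto intro!: elem_prod_mult intro: elem_grp_in_elem_prod[of i])
qed

lemma one_in_elem_prod_list: "1 \<in> elem_prod_list V n is"
  by (induction "is") (auto intro!: exI[of _ 1] elem_grp_one)

text \<open>A new factor travels left through the tail \<open>b\<close> at the price of a
  conjugation by \<open>b\<close>, which its group absorbs because it is normal.\<close>

lemma elem_prod_list_mult:
  assumes "n \<in> V" "set is \<subseteq> V - {n}" "f \<in> elem_prod_list V n is" "k \<in> set is" "g \<in> elem_grp V k n"
  shows "f * g \<in> elem_prod_list V n is"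
  using assms
proof (induction "is" arbitrary: f)
  case (Cons i "is")
  then obtain a b where ab: "f = a * b" "a \<in> elem_grp V i n" "b \<in> elem_prod_list V n is" by auto
  show ?case
  proof (cases "k \<in> set is")
    case True
    then have "b * g \<in> elem_prod_list V n is" using Cons ab by auto
    then show ?thesis using ab by (auto simp: mult.assoc)
  next
    case False
    then have g: "g \<in> elem_grp V i n" using Cons.prems by auto
    obtain b' where b': "inv_pair V b b'"
      using elem_prod_inverse[OF Cons.prems(1), of "set is" b] elem_prod_list_sub[of V n "is"] ab(3) Cons.prems(2)
      by auto
    have "b * g * b' \<in> elem_grp V i n"
      using Cons.prems b' g by (intro elem_grp_conj) auto
    then have "a * (b * g * b') \<in> elem_grp V i n"
      by (rule elem_grp_mult[OF ab(2)])
    moreover have "f * g = a * (b * g * b') * b"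
      using ab b' by (simp add: inv_pair_def mult.assoc)
    ultimately show ?thesis using ab by auto
  qed
qed simp

lemma elem_prod_list_eq:
  assumes "n \<in> V" "set is \<subseteq> V - {n}"
  shows "elem_prod_list V n is = elem_prod V n (set is)"
proof
  show "elem_prod V n (set is) \<subseteq> elem_prod_list V n is"
  proof
    fix m assume "m \<in> elem_prod V n (set is)"
    then show "m \<in> elem_prod_list V n is"
      by induction (auto intro: one_in_elem_prod_list elem_prod_list_mult[OF assms])
  qed
qed (rule elem_prod_list_sub)

definition triple_gens :: "nat set \<Rightarrow> nat \<Rightarrow> nat set \<Rightarrow> 'k::field alg set" where
  "triple_gens V n S = {e0 i * e0 j * e0 n | i j. i \<in> S \<and> j \<in> V - {n} - {i}}"

lemma e0_commute: "i \<noteq> k \<Longrightarrow> e0 i * e0 k = e0 k * (e0 i :: 'k::field alg)"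
  by (rule alg_on_commute[of _ "{i}" _ "{k}"]) (auto intro: E_in)

text \<open>The triples are removed in lexicographic order.  With \<open>B = S \<union> A\<close>, every triple of the remaining
  ideal meets \<open>B\<close>, and \<open>{i, k, n}\<close> is one of them for each \<open>k \<in> B\<close>; both are needed to cancel the
  idempotent \<open>e_j\<close> modulo that ideal.\<close>

lemma units_in_elem_prod_step:
  fixes u v :: "'k::field alg"
  assumes V: "finite V" "n \<in> V" and S: "insert i S \<subseteq> V - {n}" "i \<notin> S"
    and IH: "\<And>u v :: 'k alg. inv_pair V u v \<Longrightarrow> u - 1 \<in> ideal_span V (triple_gens V n S) \<Longrightarrow> u \<in> elem_prod V n S"
    and A: "finite A" "A \<subseteq> V - {n} - {i} - S"
    and uv: "inv_pair V u v" "u - 1 \<in> ideal_span V (triple_gens V n S \<union> (\<lambda>j. e0 i * e0 j * e0 n) ` A)"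
  shows "u \<in> elem_prod V n (insert i S)"
  using A uv
proof (induction A arbitrary: u v rule: finite_induct)
  case empty
  then show ?case using IH[of u v] elem_prod_mono[of S "insert i S"] by auto
next
  case (insert j A)
  let ?gens = "triple_gens V n S \<union> (\<lambda>j. e0 i * e0 j * e0 n) ` A :: 'k alg set"
  let ?q = "ideal_span V ?gens"
  have iV: "i \<in> V" "i \<noteq> n" and jV: "j \<in> V" "j \<noteq> n" "i \<noteq> j" "j \<notin> S"
    using S insert.prems by auto
  have gV: "?gens \<subseteq> alg_on V"
    unfolding triple_gens_def using S insert.prems V by (auto intro!: alg_on_mult E_in)
  have q: "ideal_of V ?q" by (rule ideal_of_ideal_span[OF gV])
  have PJ: "ideal_of V (mat_ext j (pair_ideal (V - {j}) i n) :: 'k alg set)"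
    by (intro ideal_of_mat_ext ideal_of_pair_ideal) (use V iV jV in auto)
  have t: "e0 i * e0 j * e0 n \<in> (mat_ext j (pair_ideal (V - {j}) i n) :: 'k alg set)"
  proof -
    have "e0 i * e0 j * e0 n = 1 * e0 i * e0 n * (e0 j :: 'k alg)"
      using e0_commute[OF jV(2), where ?'k = 'k] by (simp add: mult.assoc)
    then show ?thesis
      by (simp only:) (intro mat_ext_gen pair_ideal_gen alg_on_1)
  qed
  obtain a b where ab: "a \<in> ?q" "b \<in> ideal_span V {e0 i * e0 j * e0 n}" "u - 1 = a + b"
    using ideal_span_Un_split[of "u - 1" V ?gens "{e0 i * e0 j * e0 n}"] insert.prems(3) by auto
  have "b \<in> mat_ext j (pair_ideal (V - {j}) i n)"
    using ideal_span_least[OF PJ, of "{e0 i * e0 j * e0 n}"] t ab(2) by auto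
  moreover have "u - 1 - b \<in> ?q" using ab by simp
  moreover have "e0 i * e0 k * e0 n \<in> ?q" if "k \<in> S \<union> A" "k \<in> V" for k
  proof (cases "k \<in> A")
    case False
    then have "e0 i * e0 k * e0 n = (e0 k * e0 i * e0 n :: 'k alg)"
      using that S(2) e0_commute[of i k, where ?'k = 'k] by fastforce
    also have "\<dots> \<in> ?q"
      using False that S iV by (intro ideal_span_gen UnI1) (auto simp: triple_gens_def)
    finally show ?thesis .
  qed (auto intro: ideal_span_gen)
  moreover have "reduce (S \<union> A) f = 0" if "f \<in> ?q" for f
    using that
  proof (rule ideal_span_reduce)
    fix g :: "'k alg" assume "g \<in> ?gens"
    then show "reduce (S \<union> A) g = 0"
      unfolding triple_gens_def by (auto simp: reduce_mult_zero reduce_e0)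
  qed
  moreover have "finite (S \<union> A)" "i \<notin> S \<union> A" "n \<notin> S \<union> A" "j \<notin> S \<union> A"
    using V S insert.hyps insert.prems by (auto intro: finite_subset)
  ultimately obtain Z where Z: "Z \<in> elem_grp V i n" "u - Z \<in> ?q"
    using elementary_mod_ideal[OF iV(1) V(2) jV(1) iV(2) jV(2,3) _ _ _ _ q _ _ insert.prems(2), of "S \<union> A" b]
    by blast
  obtain Z' where Z': "Z' \<in> elem_grp V i n" "inv_pair V Z Z'"
    using elem_grp_inverse[OF iV(2,1) V(2) Z(1)] by blast
  \<comment> \<open>Dividing by the lift leaves a unit that is \<open>1\<close> modulo the ideal
    without the triple \<open>{i, j, n}\<close>, so the induction hypothesis applies to it.\<close>
  have "Z' * u - 1 = Z' * (u - Z)"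
    using Z'(2) by (simp add: inv_pair_def right_diff_distrib)
  then have "Z' * u - 1 \<in> ?q"
    using Z(2) Z'(2) by (auto simp: inv_pair_def intro: ideal_span_lmul)
  then have "Z' * u \<in> elem_prod V n (insert i S)"
    using insert.prems by (intro insert.IH[OF _ inv_pair_mult[OF inv_pair_sym[OF Z'(2)] insert.prems(2)]]) auto
  then have "Z * (Z' * u) \<in> elem_prod V n (insert i S)"
    by (rule elem_prod_mult[OF elem_grp_in_elem_prod[OF insertI1 Z(1)]])
  then show ?case
    using Z'(2) by (simp add: inv_pair_def flip: mult.assoc)
qed

lemma units_in_elem_prod:
  fixes u v :: "'k::field alg"
  assumes V: "finite V" "n \<in> V" and S: "S \<subseteq> V - {n}"
    and uv: "inv_pair V u v" "u - 1 \<in> ideal_span V (triple_gens V n S)"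
  shows "u \<in> elem_prod V n S"
proof -
  have "finite S" using S V by (auto intro: finite_subset)
  then show ?thesis
    using S uv
  proof (induction S arbitrary: u v rule: finite_induct)
    case empty
    have "f = 0" if "f \<in> ideal_span V {}" for f :: "'k alg"
      using that by induction auto
    then show ?case
      using empty elem_prod_one by (fastforce simp: triple_gens_def)
  next
    case (insert i S)
    let ?A = "V - {n} - {i} - S"
    have "triple_gens V n (insert i S) \<subseteq> (ideal_span V (triple_gens V n S \<union> (\<lambda>j. e0 i * e0 j * e0 n) ` ?A) :: 'k alg set)"
    proof
      fix g :: "'k alg" assume "g \<in> triple_gens V n (insert i S)"
      then obtain i' j where g: "g = e0 i' * e0 j * e0 n" "i' \<in> insert i S" "j \<in> V - {n} - {i'}"
        by (auto simp: triple_gens_def)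
      show "g \<in> ideal_span V (triple_gens V n S \<union> (\<lambda>j. e0 i * e0 j * e0 n) ` ?A)"
      \<comment> \<open>For \<open>j \<in> S\<close> the triple \<open>{i, j, n}\<close> already
        occurs among the generators for \<open>S\<close>, with the roles of \<open>i\<close> and
        \<open>j\<close> exchanged.\<close>
      proof (cases "i' = i \<and> j \<in> S")
        case True
        then have "g = e0 j * e0 i * e0 n"
          using g e0_commute[of i j, where ?'k = 'k] by auto
        then show ?thesis
          using True insert.prems g by (intro ideal_span_gen UnI1) (auto simp: triple_gens_def)
      next
        case False
        then show ?thesis
          using g by (intro ideal_span_gen) (auto simp: triple_gens_def)
      qed
    qed
    from ideal_span_mono[OF this insert.prems(3)] show ?case
      using insert V by (intro units_in_elem_prod_step[OF V insert.prems(1) insert.hyps(2) insert.IH _ _ insert.prems(2)]) auto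
  qed
qed

lemma pair_ideal_reduce_zero:
  fixes f :: "'k::field alg"
  assumes "f \<in> pair_ideal V k n" "k \<in> B"
  shows "reduce B f = 0"
  using assms(1) by (induction rule: pair_ideal_induct) (simp_all add: reduce_add reduce_mult_zero reduce_E[OF assms(2)])

text \<open>This bounds the intersection of \<open>p p_n\<close> with \<open>a_{n,3}\<close>.
  Reduction in all variables except \<open>i\<close> and \<open>n\<close> kills the sum and every
  \<open>g k\<close> with \<open>k \<noteq> i\<close>, hence also \<open>g i\<close>, which then
  lies in the ideal of the triples containing \<open>i\<close> and \<open>n\<close>.\<close>

lemma sum_pair_ideal_in_triple_gens:
  fixes g :: "nat \<Rightarrow> 'k::field alg"
  assumes V: "finite V" "n \<in> V" and S: "S \<subseteq> V - {n}"
    and g: "\<And>i. i \<in> S \<Longrightarrow> g i \<in> pair_ideal V i n"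
    and sg: "\<And>i. i \<in> S \<Longrightarrow> reduce (V - {n} - {i}) (\<Sum>i\<in>S. g i) = 0"
  shows "(\<Sum>i\<in>S. g i) \<in> ideal_span V (triple_gens V n S)"
proof -
  have "triple_gens V n S \<subseteq> (alg_on V :: 'k alg set)"
    unfolding triple_gens_def using S V by (auto intro!: alg_on_mult E_in)
  then have q: "ideal_of V (ideal_span V (triple_gens V n S) :: 'k alg set)" by (rule ideal_of_ideal_span)
  show ?thesis
  proof (rule ideal_sum[OF q])
    fix i assume i: "i \<in> S"
    let ?B = "V - {n} - {i}"
    have finS: "finite S" using S V by (auto intro: finite_subset)
    have "reduce ?B (\<Sum>k\<in>S. g k) = reduce ?B (g i) + (\<Sum>k\<in>S - {i}. reduce ?B (g k))"
      by (simp add: sum.remove[OF finS i] reduce_add reduce_sum)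
    also have "(\<Sum>k\<in>S - {i}. reduce ?B (g k)) = 0"
      using S by (intro sum.neutral ballI pair_ideal_reduce_zero[OF g]) auto
    finally have "reduce ?B (g i) = 0" using sg[OF i] by simp
    moreover have "g i - reduce ?B (g i) \<in> ideal_span V (triple_gens V n S)"
      using S i V by (intro pair_ideal_diff_reduce[OF _ _ _ g[OF i] _ _ _ q] ideal_span_gen) (auto simp: triple_gens_def)
    ultimately show "g i \<in> ideal_span V (triple_gens V n S)" by simp
  qed
qed

section \<open>Transfer to finitely supported functions\<close>

declare One_nat_def [simp del]

definition to_jel :: "'k::field alg \<Rightarrow> 'k jel" where
  "to_jel f = (\<lambda>m. lookup f (Bic (fst m) (snd m)))"

lemma to_jel_inject: "to_jel f = to_jel g \<longleftrightarrow> f = g"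
proof
  assume "to_jel f = to_jel g"
  then have "lookup f (Bic a b) = lookup g (Bic a b)" for a b
    by (simp add: to_jel_def fun_eq_iff)
  then show "f = g"
    by (intro poly_mapping_eqI) (metis bic.exhaust)
qed simp

lemma to_jel_add: "jadd (to_jel f) (to_jel g) = to_jel (f + g)"
  by (simp add: to_jel_def jadd_def lookup_add)

lemma to_jel_diff: "jsub (to_jel f) (to_jel g) = to_jel (f - g)"
  by (simp add: to_jel_def jsub_def lookup_minus)

lemma to_jel_uminus: "jneg (to_jel f) = to_jel (- f)"
  by (simp add: to_jel_def jneg_def)

lemma to_jel_0: "jzero = to_jel 0"
  by (simp add: to_jel_def jzero_def)

lemma to_jel_1: "jone = to_jel 1"
  by (auto simp: to_jel_def jone_def lookup_one zero_bic_def when_def fun_eq_iff prod_eq_iff)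

lemma jsupp_to_jel: "p \<in> jsupp (to_jel f) \<longleftrightarrow> Bic (fst p) (snd p) \<in> keys f"
  by (simp add: jsupp_def to_jel_def in_keys_iff)

lemma to_jel_mult: "jmul (to_jel f) (to_jel g) = to_jel (f * g)"
proof
  fix m :: mon
  let ?b = "\<lambda>p :: mon. Bic (fst p) (snd p)"
  let ?P = "{p. fst p \<in> jsupp (to_jel f) \<and> snd p \<in> jsupp (to_jel g) \<and> mmul (fst p) (snd p) = m}"
  let ?Q = "{(a, b). a \<in> keys f \<and> b \<in> keys g \<and> ?b m = a + b}"
  have "to_jel (f * g) m = (\<Sum>(a, b). lookup f a * lookup g b when ?b m = a + b)"
    by (simp add: to_jel_def times_poly_mapping.rep_eq prod_fun_unfold_prod)
  also have "\<dots> = (\<Sum>(a, b)\<in>keys f \<times> keys g. lookup f a * lookup g b when ?b m = a + b)"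
    by (rule Sum_any.expand_superset) (auto simp: in_keys_iff)
  also have "\<dots> = (\<Sum>(a, b)\<in>?Q. lookup f a * lookup g b)"
    by (rule sum.mono_neutral_cong_right) auto
  also have "\<dots> = (\<Sum>p\<in>?P. to_jel f (fst p) * to_jel g (snd p))"
    by (rule sum.reindex_bij_witness[of _ "\<lambda>p. (?b (fst p), ?b (snd p))"
          "\<lambda>(a, b). ((xexp a, yexp a), (xexp b, yexp b))"])
      (auto simp: jsupp_to_jel plus_bic_def mmul_def prod_eq_iff, auto simp: to_jel_def)
  finally show "jmul (to_jel f) (to_jel g) m = to_jel (f * g) m"
    by (simp add: jmul_def)
qed

lemma to_jel_X: "jX i = to_jel (X i)"
  by (auto simp: to_jel_def jX_def X_def lookup_single when_def fun_eq_iff prod_eq_iff)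

lemma to_jel_Y: "jY i = to_jel (Y i)"
  by (auto simp: to_jel_def jY_def Y_def lookup_single when_def fun_eq_iff prod_eq_iff)

lemma to_jel_power: "jpow (to_jel f) k = to_jel (f ^ k)"
  by (induction k) (simp_all add: to_jel_1 to_jel_mult power_commutes)

lemma to_jel_E: "Est i s t = to_jel (E i s t)"
  by (simp only: Est_def E_def to_jel_X to_jel_Y to_jel_power to_jel_mult to_jel_diff)

lemma to_jel_e0: "je i = to_jel (e0 i)"
  by (simp add: je_def to_jel_E)

lemma Jac_eq: "Jac V = to_jel ` alg_on V"
proof (intro equalityI subsetI)
  fix f :: "'k::field jel" assume f: "f \<in> Jac V"
  define g where "g = Abs_poly_mapping (\<lambda>b. f (xexp b, yexp b))"
  have "finite ((\<lambda>m. Bic (fst m) (snd m)) ` jsupp f)"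
    using f by (simp add: Jac_def)
  then have "finite {b. f (xexp b, yexp b) \<noteq> 0}"
  proof (rule rev_finite_subset, intro subsetI)
    fix b assume "b \<in> {b. f (xexp b, yexp b) \<noteq> 0}"
    then show "b \<in> (\<lambda>m. Bic (fst m) (snd m)) ` jsupp f"
      by (intro image_eqI[of _ _ "(xexp b, yexp b)"]) (auto simp: jsupp_def)
  qed
  then have lk: "lookup g b = f (xexp b, yexp b)" for b
    by (simp add: g_def)
  have "f = to_jel g"
    by (simp add: to_jel_def lk)
  moreover have "g \<in> alg_on V"
    using f by (auto simp: alg_on_def Jac_def in_keys_iff lk jsupp_def)
  ultimately show "f \<in> to_jel ` alg_on V" by blast
next
  fix f :: "'k::field jel" assume "f \<in> to_jel ` alg_on V"
  then obtain g where g: "g \<in> alg_on V" "f = to_jel g" by blast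
  have "jsupp f \<subseteq> (\<lambda>b. (xexp b, yexp b)) ` keys g"
    using g(2) by (force simp: jsupp_to_jel image_iff)
  then have "finite (jsupp f)"
    by (rule finite_subset) simp
  moreover have "fst m i = 0 \<and> snd m i = 0" if "m \<in> jsupp f" "i \<notin> V" for m i
  proof -
    have "Bic (fst m) (snd m) \<in> keys g" using that g(2) by (simp add: jsupp_to_jel)
    then have "xexp (Bic (fst m) (snd m)) i = 0 \<and> yexp (Bic (fst m) (snd m)) i = 0"
      using g(1) that(2) unfolding alg_on_def by blast
    then show ?thesis by simp
  qed
  ultimately show "f \<in> Jac V"
    by (simp add: Jac_def)
qed

text \<open>A value of the product reads the right factor only at solutions of
  \<open>mmul p q = m\<close>. Once these are finite in number, an arbitrary function may be
  replaced by a finitely supported one.\<close>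

lemma jmul_local_cong:
  assumes "\<And>p q. p \<in> jsupp f \<Longrightarrow> mmul p q = m \<Longrightarrow> g q = g' q"
  shows "jmul f g m = jmul f g' m"
  unfolding jmul_def
  using assms by (intro sum.cong) (auto simp: jsupp_def)

lemma finite_mmul_solutions:
  fixes p m :: mon
  assumes "\<And>i. i \<notin> {1..n} \<Longrightarrow> fst p i = 0 \<and> snd p i = 0"
  shows "finite {q. mmul p q = m}"
proof -
  let ?V = "{1..n}"
  let ?F = "\<lambda>(c, d). ((\<lambda>i. if i \<in> ?V then c i else fst m i), (\<lambda>i. if i \<in> ?V then d i else snd m i))"
  \<comment> \<open>From \<open>fst m i = fst p i + (fst q i - snd p i)\<close> follows
    \<open>fst q i \<le> fst m i + snd p i\<close>, and likewise
    \<open>snd q i \<le> snd m i\<close>; outside \<open>{1..n}\<close> the exponents of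
    \<open>q\<close> are those of \<open>m\<close>.\<close>
  let ?D = "(PiE ?V (\<lambda>i. {..fst m i + snd p i})) \<times> (PiE ?V (\<lambda>i. {..snd m i}))"
  have "q \<in> ?F ` ?D" if "mmul p q = m" for q
  proof
    show "(restrict (fst q) ?V, restrict (snd q) ?V) \<in> ?D"
      unfolding that[symmetric] by (auto simp: mmul_def)
    show "q = ?F (restrict (fst q) ?V, restrict (snd q) ?V)"
      using assms unfolding that[symmetric] by (auto simp: mmul_def prod_eq_iff fun_eq_iff)
  qed
  then have "{q. mmul p q = m} \<subseteq> ?F ` ?D"
    by blast
  moreover have "finite (?F ` ?D)"
    by (intro finite_imageI finite_cartesian_product finite_PiE) auto
  ultimately show ?thesis
    by (rule finite_subset)
qed

text \<open>The inverse chosen by \<^const>\<open>jinv\<close> ranges over functions of arbitrary support, for which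
  \<^const>\<open>jmul\<close> is not associative in general.\<close>

lemma jmul_left_inverse:
  assumes "inv_pair {1..n} u v"
  shows "jmul (to_jel v) (jmul (to_jel u) w) = w"
proof
  fix m
  \<comment> \<open>All points at which the iterated product, evaluated at \<open>m\<close>, reads
    \<open>w\<close>, together with \<open>m\<close> itself.\<close>
  define Q where "Q = insert m (\<Union>p'\<in>jsupp (to_jel v). \<Union>r\<in>{r. mmul p' r = m}. \<Union>p\<in>jsupp (to_jel u). {q. mmul p q = r})"
  have uv: "to_jel u \<in> Jac {1..n}" "to_jel v \<in> Jac {1..n}"
    using assms by (auto simp: inv_pair_def Jac_eq)
  have finQ: "finite Q"
    unfolding Q_def using uv
    by (intro finite.insertI finite_UN_I finite_mmul_solutions) (auto simp: Jac_def)
  define w0 where "w0 = (\<lambda>q. if q \<in> Q then w q else 0)"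
  have "finite (jsupp w0)"
    using finQ by (rule rev_finite_subset) (auto simp: jsupp_def w0_def)
  then have "w0 \<in> Jac UNIV"
    by (simp add: Jac_def)
  then obtain w' where w': "w0 = to_jel w'"
    by (auto simp: Jac_eq)
  have "jmul (to_jel v) (jmul (to_jel u) w) m = jmul (to_jel v) (jmul (to_jel u) w0) m"
    by (intro jmul_local_cong) (auto simp: w0_def Q_def)
  also have "\<dots> = to_jel (v * u * w') m"
    by (simp add: w' to_jel_mult mult.assoc)
  also have "\<dots> = w m"
    using assms w' by (simp add: inv_pair_def) (simp add: w0_def Q_def flip: w')
  finally show "jmul (to_jel v) (jmul (to_jel u) w) m = w m" .
qed

lemma jinv_to_jel:
  assumes "inv_pair {1..n} u v"
  shows "jinv (to_jel u) = to_jel v"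
  unfolding jinv_def
proof (rule some_equality)
  show "jmul (to_jel u) (to_jel v) = jone \<and> jmul (to_jel v) (to_jel u) = jone"
    using assms by (simp add: to_jel_mult to_jel_1 inv_pair_def)
next
  fix w assume "jmul (to_jel u) w = jone \<and> jmul w (to_jel u) = jone"
  then show "w = to_jel v"
    using jmul_left_inverse[OF assms, of w] by (simp add: to_jel_1 to_jel_mult)
qed

lemma Units_to_jel:
  assumes "u \<in> Units n"
  shows "\<exists>u' v'. u = to_jel u' \<and> inv_pair {1..n} u' v'"
  using assms
  by (force simp: Units_def Sn_def Jac_eq inv_pair_def to_jel_1 to_jel_mult to_jel_inject)

lemma EI_pair:
  assumes "i < n"
  shows "EI {i, n} \<alpha> \<beta> = to_jel (E i (\<alpha> i) (\<beta> i) * E n (\<alpha> n) (\<beta> n))"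
proof -
  have "sorted_list_of_set {i, n} = [i, n]"
    using assms by (simp add: insort_insert_triv)
  then show ?thesis
    by (simp add: EI_def to_jel_E to_jel_1 to_jel_mult)
qed

lemma Einf_pair:
  assumes i: "1 \<le> i" "i < n"
  shows "Einf n {i, n} = to_jel ` elem_grp {1..n} i n"
proof (intro equalityI subsetI)
  let ?W = "{1..n} - {n} - {i}"
  have W: "{1..n} - {i, n} = ?W" by auto
  have V: "i \<noteq> n" "i \<in> {1..n}" "n \<in> {1..n}" using i by auto
  fix f :: "'k::field jel" assume "f \<in> Einf n {i, n}"
  then show "f \<in> to_jel ` elem_grp {1..n} i n"
    unfolding Einf_def W
  proof (induction rule: grp_gen.induct)
    case gg_one
    then show ?case by (auto simp: to_jel_1 intro: elem_grp_one)
  next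
    case (gg_mul g x)
    then obtain a \<alpha> \<beta> where x: "x = jadd jone (jmul (to_jel a) (EI {i, n} \<alpha> \<beta>))" "a \<in> alg_on ?W"
      "(\<alpha> i, \<alpha> n) \<noteq> (\<beta> i, \<beta> n)"
      by (auto simp: Jac_eq)
    then have "x = to_jel (1 + a * E i (\<alpha> i) (\<beta> i) * E n (\<alpha> n) (\<beta> n))"
      by (simp add: EI_pair[OF i(2)] to_jel_1 to_jel_mult to_jel_add mult.assoc)
    then show ?case
      using gg_mul.IH elem_grp_mul[OF _ x(2,3)] by (auto simp: to_jel_mult)
  next
    case (gg_inv g x)
    then obtain a \<alpha> \<beta> where x: "x = jadd jone (jmul (to_jel a) (EI {i, n} \<alpha> \<beta>))" "a \<in> alg_on ?W"
      "(\<alpha> i, \<alpha> n) \<noteq> (\<beta> i, \<beta> n)"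
      by (auto simp: Jac_eq)
    then have "x = to_jel (1 + a * E i (\<alpha> i) (\<beta> i) * E n (\<alpha> n) (\<beta> n))"
      by (simp add: EI_pair[OF i(2)] to_jel_1 to_jel_mult to_jel_add mult.assoc)
    then have "jinv x = to_jel (1 + (- a) * E i (\<alpha> i) (\<beta> i) * E n (\<alpha> n) (\<beta> n))"
      by (simp only: jinv_to_jel[OF gen_inv_pair[OF V x(2,3)]])
    then show ?case
      using gg_inv.IH elem_grp_mul[OF _ alg_on_uminus[OF x(2)] x(3)] by (auto simp: to_jel_mult simp del: mult_minus_left)
  qed
next
  let ?W = "{1..n} - {n} - {i}"
  have W: "{1..n} - {i, n} = ?W" by auto
  fix f :: "'k::field jel" assume "f \<in> to_jel ` elem_grp {1..n} i n"
  then obtain g where g: "g \<in> elem_grp {1..n} i n" "f = to_jel g" by blast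
  have "to_jel g \<in> Einf n {i, n}"
    using g(1)
  proof induction
    case elem_grp_one
    then show ?case by (simp add: Einf_def grp_gen.gg_one flip: to_jel_1)
  next
    case (elem_grp_mul g a s k t l)
    let ?\<alpha> = "\<lambda>x. if x = i then s else k" and ?\<beta> = "\<lambda>x. if x = i then t else l"
    have "to_jel (g * (1 + a * E i s t * E n k l)) = jmul (to_jel g) (jadd jone (jmul (to_jel a) (EI {i, n} ?\<alpha> ?\<beta>)))"
      using i by (simp add: EI_pair to_jel_1 to_jel_mult to_jel_add mult.assoc)
    moreover have "to_jel a \<in> Jac ({1..n} - {i, n})"
      using elem_grp_mul.hyps unfolding W Jac_eq by blast
    moreover have "\<exists>x\<in>{i, n}. ?\<alpha> x \<noteq> ?\<beta> x"
      using elem_grp_mul.hyps i by auto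
    ultimately show ?case
      using elem_grp_mul.IH unfolding Einf_def by (simp only:) (rule grp_gen.gg_mul, assumption, blast)
  qed
  then show "f \<in> Einf n {i, n}" using g by simp
qed

lemma setprod_list_Einf:
  assumes "set is \<subseteq> {1..n} - {n}"
  shows "setprod_list (map (Einf n) (map (\<lambda>i. {i, n}) is)) = (to_jel ` elem_prod_list {1..n} n is :: 'k::field jel set)"
  using assms
proof (induction "is")
  case Nil
  then show ?case by (simp add: setprod_list_def to_jel_1)
next
  case (Cons i "is")
  then have i: "1 \<le> i" "i < n" by auto
  have "(setprod_list (map (Einf n) (map (\<lambda>i. {i, n}) (i # is))) :: 'k jel set) =
     {jmul a b | a b. a \<in> Einf n {i, n} \<and> b \<in> setprod_list (map (Einf n) (map (\<lambda>i. {i, n}) is))}"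
    by (simp add: setprod_list_def)
  also have "\<dots> = {jmul a b | a b. a \<in> to_jel ` elem_grp {1..n} i n \<and> b \<in> to_jel ` elem_prod_list {1..n} n is}"
    using Cons by (simp only: Einf_pair[OF i]) simp
  also have "\<dots> = to_jel ` elem_prod_list {1..n} n (i # is)"
    by (force simp: to_jel_mult image_iff)
  finally show ?case .
qed

section \<open>Upper bounds for the ideals of the statement\<close>

lemma ideal_gen_sub:
  assumes I: "ideal_of V I" and X: "A \<subseteq> to_jel ` I"
  shows "ideal_gen (to_jel ` alg_on V) A \<subseteq> to_jel ` I"
proof
  fix f assume "f \<in> ideal_gen (to_jel ` alg_on V) A"
  then show "f \<in> to_jel ` I"
    by induction (use X ideal_ofD[OF I] ideal_uminus[OF I] in \<open>auto simp: to_jel_0 to_jel_add to_jel_uminus to_jel_mult\<close>)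
qed

lemma Sn_eq: "Sn n = to_jel ` alg_on {1..n}"
  by (simp add: Sn_def Jac_eq)

lemma pid_sub: "ideal_of {1..n} I \<Longrightarrow> e0 i \<in> I \<Longrightarrow> pid n i \<subseteq> to_jel ` I"
  unfolding pid_def Sn_eq by (rule ideal_gen_sub) (auto simp: to_jel_e0)

lemma ideal_prod_sub:
  assumes "ideal_of {1..n} I" "A \<subseteq> to_jel ` A'" "B \<subseteq> to_jel ` B'" "\<And>a b. a \<in> A' \<Longrightarrow> b \<in> B' \<Longrightarrow> a * b \<in> I"
  shows "ideal_prod (Sn n) A B \<subseteq> to_jel ` I"
  unfolding ideal_prod_def Sn_eq
proof (rule ideal_gen_sub[OF assms(1)], clarify)
  fix a b assume "a \<in> A" "b \<in> B"
  then obtain a' b' where "a = to_jel a'" "b = to_jel b'" "a' \<in> A'" "b' \<in> B'" using assms by blast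
  then show "jmul a b \<in> to_jel ` I" using assms(4) by (auto simp: to_jel_mult)
qed

lemma ideal_of_sum_family:
  assumes F: "\<And>i. i \<in> S \<Longrightarrow> ideal_of V (F i)"
  shows "ideal_of V {\<Sum>i\<in>S. g i | g. \<forall>i\<in>S. g i \<in> F i}"
  unfolding ideal_of_def
proof (intro conjI ballI, goal_cases)
  case 1
  then show ?case using ideal_ofD(1)[OF F] by (auto intro!: alg_on_sum)
next
  case 2
  then show ?case using ideal_ofD(2)[OF F] by (auto intro!: exI[of _ "\<lambda>_. 0"])
next
  case (3 a b)
  then obtain g h where "a = sum g S" "b = sum h S" "\<forall>i\<in>S. g i \<in> F i" "\<forall>i\<in>S. h i \<in> F i" by auto
  then show ?case
    using ideal_ofD(3)[OF F] by (auto intro!: exI[of _ "\<lambda>i. g i + h i"] simp: sum.distrib)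
next
  case (4 a r)
  then obtain g where "a = sum g S" "\<forall>i\<in>S. g i \<in> F i" by auto
  then show ?case
    using ideal_ofD(4)[OF F _ 4(2)] by (auto intro!: exI[of _ "\<lambda>i. r * g i"] simp: sum_distrib_left)
next
  case (5 a r)
  then obtain g where "a = sum g S" "\<forall>i\<in>S. g i \<in> F i" by auto
  then show ?case
    using ideal_ofD(5)[OF F _ 5(2)] by (auto intro!: exI[of _ "\<lambda>i. g i * r"] simp: sum_distrib_right)
qed

lemma mem_sum_family:
  assumes F: "\<And>i. i \<in> S \<Longrightarrow> ideal_of V (F i)" and "finite S" "k \<in> S" "a \<in> F k"
  shows "a \<in> {\<Sum>i\<in>S. g i | g. \<forall>i\<in>S. g i \<in> F i}"
  using assms ideal_ofD(2)[OF F] by (auto intro!: exI[of _ "\<lambda>i. if i = k then a else 0"])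

lemma ppn_sub:
  assumes "S \<subseteq> {1..n} - {n}" "n \<in> {1..n}"
  shows "ppn n S \<subseteq> to_jel ` {\<Sum>i\<in>S. g i | g. \<forall>i\<in>S. g i \<in> (pair_ideal {1..n} i n :: 'k::field alg set)}"
proof -
  let ?V = "{1..n}"
  have pair_ideal: "ideal_of ?V (pair_ideal ?V i n :: 'k alg set)" if "i \<in> S" for i
    using that assms by (intro ideal_of_pair_ideal) auto
  have finS: "finite S" using assms by (auto intro: finite_subset)
  have "ideal_prod (Sn n) (pid n i) (pid n n) \<subseteq> to_jel ` (pair_ideal ?V i n :: 'k alg set)" if i: "i \<in> S" for i
  proof -
    let ?In = "mat_ext n (alg_on (?V - {n})) :: 'k alg set"
    have In: "ideal_of ?V ?In" using assms by (intro ideal_of_mat_ext ideal_of_alg_on)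
    \<comment> \<open>The transporter of \<open>?In\<close> into \<open>pair_ideal\<close> is a
      two-sided ideal, so it contains \<open>p_i\<close> as soon as it contains
      \<open>e0 i\<close>.\<close>
    define I where "I = {a \<in> alg_on ?V. \<forall>b\<in>?In. a * b \<in> pair_ideal ?V i n}"
    have I: "ideal_of ?V I"
      unfolding ideal_of_def
    proof (intro conjI ballI, goal_cases)
      case (5 a r)
      then show ?case
        using ideal_ofD(4)[OF In _ 5(2)] by (auto simp: I_def mult.assoc intro: alg_on_mult)
    qed (auto simp: I_def distrib_right mult.assoc ideal_ofD[OF pair_ideal[OF i]] intro: alg_on_add alg_on_mult)
    have "e0 i * b \<in> pair_ideal ?V i n" if "b \<in> ?In" for b
      using that
    proof induction
      case (mat_ext_gen c s t)
      have iW: "i \<in> ?V - {n}" using i assms by auto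
      have "ideal_of (?V - {n}) (mat_ext i (alg_on (?V - {n} - {i})) :: 'k alg set)"
        using iW by (intro ideal_of_mat_ext ideal_of_alg_on)
      moreover have "1 * e0 i \<in> (mat_ext i (alg_on (?V - {n} - {i})) :: 'k alg set)"
        by (rule mat_ext.mat_ext_gen) simp
      ultimately have "e0 i * c \<in> mat_ext i (alg_on (?V - {n} - {i}))"
        using mat_ext_gen ideal_ofD(5) by fastforce
      then show ?case
        unfolding pair_ideal_def by (auto simp flip: mult.assoc intro: mat_ext.mat_ext_gen)
    qed (auto simp: distrib_left ideal_ofD[OF pair_ideal[OF i]])
    then have "e0 i \<in> I"
      using i assms by (auto simp: I_def intro!: E_in)
    then have "pid n i \<subseteq> to_jel ` I" by (rule pid_sub[OF I])
    moreover have "1 * e0 n \<in> ?In" by (rule mat_ext.mat_ext_gen) simp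
    then have "pid n n \<subseteq> to_jel ` ?In" using pid_sub[OF In] by simp
    ultimately show ?thesis
      by (rule ideal_prod_sub[OF pair_ideal[OF i]]) (auto simp: I_def)
  qed
  moreover have "pair_ideal ?V i n \<subseteq> {\<Sum>i\<in>S. g i | g. \<forall>i\<in>S. g i \<in> (pair_ideal ?V i n :: 'k alg set)}" if "i \<in> S" for i
    using mem_sum_family[OF pair_ideal finS that] by (intro subsetI) simp
  ultimately have "(\<Union>i\<in>S. ideal_prod (Sn n) (pid n i) (pid n n)) \<subseteq>
      to_jel ` {\<Sum>i\<in>S. g i | g. \<forall>i\<in>S. g i \<in> (pair_ideal ?V i n :: 'k alg set)}"
    by (intro UN_least) (meson image_mono order_trans)
  moreover have "ideal_of ?V {\<Sum>i\<in>S. g i | g. \<forall>i\<in>S. g i \<in> (pair_ideal ?V i n :: 'k alg set)}"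
    by (rule ideal_of_sum_family) (rule pair_ideal)
  ultimately show ?thesis
    unfolding ppn_def unfolding Sn_eq by (intro ideal_gen_sub)
qed

lemma ideal_of_ker_reduce: "ideal_of V {f \<in> alg_on V. reduce B f = 0}"
  by (auto simp: ideal_of_def reduce_add reduce_mult_zero intro: alg_on_add alg_on_mult)

text \<open>One factor \<open>p_k\<close> with \<open>k \<in> B\<close> puts the whole product into
  the kernel of \<open>reduce B\<close>, which is a two-sided ideal.\<close>

lemma pI_sub:
  assumes "I \<subseteq> {1..n}" "k \<in> I" "k \<in> B"
  shows "pI n I \<subseteq> to_jel ` {f \<in> alg_on {1..n}. reduce B f = (0 :: 'k::field alg)}"
proof -
  let ?V = "{1..n}" and ?K = "{f \<in> alg_on {1..n}. reduce B f = (0 :: 'k::field alg)}"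
  let ?F = "\<lambda>xs. foldr (\<lambda>i acc. ideal_prod (Sn n) (pid n i) acc) xs (Sn n) :: 'k jel set"
  have pV: "pid n i \<subseteq> to_jel ` (alg_on ?V :: 'k alg set)" if "i \<in> ?V" for i
    using that by (intro pid_sub ideal_of_alg_on E_in)
  have FV: "?F xs \<subseteq> to_jel ` alg_on ?V" if "set xs \<subseteq> ?V" for xs
    using that
  proof (induction xs)
    case (Cons i xs)
    have "ideal_prod (Sn n) (pid n i) (?F xs) \<subseteq> to_jel ` alg_on ?V"
      using Cons by (intro ideal_prod_sub[OF ideal_of_alg_on pV]) (auto intro: alg_on_mult)
    then show ?case by simp
  qed (simp add: Sn_eq)
  have "?F xs \<subseteq> to_jel ` ?K" if "set xs \<subseteq> ?V" "k \<in> set xs" for xs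
    using that
  proof (induction xs)
    case (Cons i xs)
    show ?case
    proof (cases "k \<in> set xs")
      case True
      then have "?F xs \<subseteq> to_jel ` ?K" using Cons by auto
      then have "ideal_prod (Sn n) (pid n i) (?F xs) \<subseteq> to_jel ` ?K"
        using pV[of i] Cons.prems
        by (intro ideal_prod_sub[OF ideal_of_ker_reduce, where A' = "alg_on ?V"]) (auto simp: reduce_mult_zero intro: alg_on_mult)
      then show ?thesis by simp
    next
      case False
      then have "i = k" using Cons by auto
      then have "pid n i \<subseteq> to_jel ` ?K"
        using Cons.prems assms by (intro pid_sub ideal_of_ker_reduce) (auto simp: reduce_e0 intro: E_in)
      then have "ideal_prod (Sn n) (pid n i) (?F xs) \<subseteq> to_jel ` ?K"
        using FV[of xs] Cons.prems
        by (intro ideal_prod_sub[OF ideal_of_ker_reduce, where B' = "alg_on ?V"]) (auto simp: reduce_mult_zero intro: alg_on_mult)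
      then show ?thesis by simp
    qed
  qed simp
  then show ?thesis
    unfolding pI_def using assms finite_subset[OF assms(1)] by simp
qed

text \<open>Three indices cannot all lie in \<open>{n, i}\<close>, so each \<open>p_I\<close> has a
  factor \<open>p_k\<close> that the reduction kills.\<close>

lemma ans_sub:
  "ans n 3 \<subseteq> to_jel ` {f \<in> alg_on {1..n}. reduce ({1..n} - {n} - {i}) f = (0 :: 'k::field alg)}"
  unfolding ans_def Sn_eq
proof (rule ideal_gen_sub[OF ideal_of_ker_reduce], rule Union_least, clarify)
  fix x and I :: "nat set"
  assume I: "I \<subseteq> {1..n}" "card I = 3" and x: "x \<in> (pI n I :: 'k jel set)"
  have "\<not> I \<subseteq> {n, i}"
    using I(2) card_mono[of "{n, i}" I] card_insert_le_m1[of 2 "{i}" n] by auto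
  then obtain k where "k \<in> I" "k \<notin> {n, i}" by blast
  then have k: "k \<in> I" "k \<in> {1..n} - {n} - {i}" using I(1) by auto
  show "x \<in> to_jel ` {f \<in> alg_on {1..n}. reduce ({1..n} - {n} - {i}) f = (0 :: 'k alg)}"
    using pI_sub[OF I(1) k] x by blast
qed

section \<open>The relative elementary group\<close>

lemma pS_sub:
  assumes "S \<subseteq> {1..n-1}"
  shows "pS n S \<subseteq> to_jel ` {\<Sum>i\<in>S. g i | g. \<forall>i\<in>S. g i \<in> (mat_ext i (alg_on ({1..n-1} - {i})) :: 'k::field alg set)}"
proof -
  let ?W = "{1..n-1}"
  let ?I = "{\<Sum>i\<in>S. g i | g. \<forall>i\<in>S. g i \<in> (mat_ext i (alg_on (?W - {i})) :: 'k alg set)}"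
  have F: "ideal_of ?W (mat_ext i (alg_on (?W - {i})) :: 'k alg set)" if "i \<in> S" for i
    using that assms by (intro ideal_of_mat_ext ideal_of_alg_on) auto
  have finS: "finite S" using assms by (rule finite_subset) simp
  have I: "ideal_of ?W ?I"
    by (rule ideal_of_sum_family) (rule F)
  have "e0 i \<in> ?I" if "i \<in> S" for i
  proof -
    have "1 * e0 i \<in> (mat_ext i (alg_on (?W - {i})) :: 'k alg set)"
      by (rule mat_ext_gen) simp
    then show ?thesis
      using mem_sum_family[where F = "\<lambda>i. mat_ext i (alg_on (?W - {i}))", OF F finS that] by simp
  qed
  then have "ideal_gen (Sn (n - 1)) {je i} \<subseteq> to_jel ` ?I" if "i \<in> S" for i
    unfolding Sn_eq using that by (intro ideal_gen_sub[OF I]) (auto simp: to_jel_e0)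
  then show ?thesis
    unfolding pS_def unfolding Sn_eq by (intro ideal_gen_sub[OF I]) (rule UN_least)
qed

text \<open>Because \<open>k \<noteq> l\<close>, passing from \<open>a\<close> to
  \<open>1 + a * E n k l\<close> turns sums into products, and each term is off-diagonal for the
  pair \<open>{i, n}\<close> even if its two indices at \<open>i\<close> agree.\<close>

lemma one_plus_sum_in_elem_prod:
  fixes g :: "nat \<Rightarrow> 'k::field alg"
  assumes V: "n \<in> V" "S \<subseteq> V - {n}" "k \<noteq> l" and "finite S"
    and g: "\<And>i. i \<in> S \<Longrightarrow> g i \<in> mat_ext i (alg_on (V - {n} - {i}))"
  shows "1 + (\<Sum>i\<in>S. g i) * E n k l \<in> elem_prod V n S"
proof -
  define A where "A = {a \<in> alg_on (V - {n}). 1 + a * E n k l \<in> (elem_prod V n S :: 'k alg set)}"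
  have add: "a + b \<in> A" if "a \<in> A" "b \<in> A" for a b
  proof -
    have "b * E n k l = E n k l * b"
      using that by (intro alg_commute_var) (auto simp: A_def intro: E_in)
    then have "a * E n k l * (b * E n k l) = a * (E n k l * E n k l) * b"
      by (simp add: mult.assoc)
    then have "a * E n k l * (b * E n k l) = 0"
      using V(3) by (simp add: E_mult)
    then have "1 + (a + b) * E n k l = (1 + a * E n k l) * (1 + b * E n k l)"
      by (simp add: distrib_left distrib_right)
    then show ?thesis
      using that elem_prod_mult by (auto simp: A_def intro: alg_on_add)
  qed
  have zero: "0 \<in> A" by (simp add: A_def elem_prod_one)
  have inA: "a \<in> A" if "i \<in> S" "a \<in> mat_ext i (alg_on (V - {n} - {i}))" for a i
    using that(2)
  proof induction
    case (mat_ext_gen c s t)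
    have "c * E i s t \<in> alg_on (V - {n})"
      using that(1) V mat_ext_gen alg_on_mono[of "V - {n} - {i}" "V - {n}"] by (intro alg_on_mult E_in) auto
    moreover have "1 + c * E i s t * E n k l \<in> elem_prod V n S"
      using V(3) by (intro elem_grp_in_elem_prod[OF that(1)] elem_grp_gen[OF mat_ext_gen]) simp
    ultimately show ?case by (simp add: A_def)
  qed (simp_all add: zero add)
  have "(\<Sum>i\<in>S'. g i) \<in> A" if "S' \<subseteq> S" for S'
    using finite_subset[OF that \<open>finite S\<close>] that
    by (induction S' rule: finite_induct) (auto simp: zero intro!: add inA[OF _ g])
  then show ?thesis by (auto simp: A_def)
qed

lemma interval_pred: "n \<ge> 1 \<Longrightarrow> {1..n-1} = {1..n} - {n :: nat}"
  by auto

lemma Sn_pred: "n \<ge> 1 \<Longrightarrow> Sn (n - 1) = to_jel ` alg_on ({1..n} - {n})"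
  by (simp only: Sn_eq interval_pred)

lemma transvection_inv_pair:
  fixes a :: "'k::field alg"
  assumes "n \<in> V" "a \<in> alg_on (V - {n})" "k \<noteq> l"
  shows "inv_pair V (1 + a * E n k l) (1 - a * E n k l)"
proof -
  have a: "a \<in> alg_on V" using assms(2) alg_on_mono[of "V - {n}" V] by auto
  have Ea: "E n k l * a = a * E n k l"
    by (rule alg_commute_var[OF assms(2), symmetric]) (simp add: E_in)
  have "a * E n k l * (a * E n k l) = a * (E n k l * a) * E n k l"
    by (simp only: mult.assoc)
  also have "\<dots> = a * a * (E n k l * E n k l)"
    unfolding Ea by (simp only: mult.assoc)
  finally have "a * E n k l * (a * E n k l) = 0"
    using assms(3) by (simp add: E_mult)
  then have "(1 + a * E n k l) * (1 - a * E n k l) = 1" "(1 - a * E n k l) * (1 + a * E n k l) = 1"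
    by (simp_all add: distrib_left distrib_right left_diff_distrib right_diff_distrib)
  moreover have "a * E n k l \<in> alg_on V"
    using a assms(1) by (intro alg_on_mult E_in)
  ultimately show ?thesis
    by (auto simp: inv_pair_def intro: alg_intros)
qed

lemma Eel_units:
  assumes n: "n \<ge> 1" and "g \<in> Eel n"
  shows "\<exists>u v. g = to_jel u \<and> inv_pair {1..n} u v"
  using assms(2) unfolding Eel_def Sn_pred[OF n]
proof (induction rule: grp_gen.induct)
  case gg_one
  then show ?case by (intro exI[of _ 1]) (simp add: to_jel_1 inv_pair_def)
next
  case (gg_mul g x)
  then obtain u v a k l where u: "g = to_jel u" "inv_pair {1..n} u v"
    and x: "x = jadd jone (jmul (to_jel a) (Est n k l))" "a \<in> alg_on ({1..n} - {n})" "k \<noteq> l" by auto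
  have "x = to_jel (1 + a * E n k l)" by (simp add: x to_jel_E to_jel_1 to_jel_mult to_jel_add)
  then show ?case
    using u inv_pair_mult[OF u(2) transvection_inv_pair[OF _ x(2,3)]] n by (auto simp: to_jel_mult)
next
  case (gg_inv g x)
  then obtain u v a k l where u: "g = to_jel u" "inv_pair {1..n} u v"
    and x: "x = jadd jone (jmul (to_jel a) (Est n k l))" "a \<in> alg_on ({1..n} - {n})" "k \<noteq> l" by auto
  have p: "inv_pair {1..n} (1 + a * E n k l) (1 - a * E n k l)"
    using n x by (intro transvection_inv_pair) auto
  have "x = to_jel (1 + a * E n k l)" by (simp add: x to_jel_E to_jel_1 to_jel_mult to_jel_add)
  then have "jinv x = to_jel (1 - a * E n k l)" using jinv_to_jel[OF p] by simp
  then show ?case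
    using u inv_pair_mult[OF u(2) inv_pair_sym[OF p]] by (auto simp: to_jel_mult)
qed

lemma Erel_sub:
  assumes n: "n \<ge> 1" and S: "S \<subseteq> {1..n-1}"
  shows "Erel n (pS n S) \<subseteq> to_jel ` (elem_prod {1..n} n S :: 'k::field alg set)"
proof -
  note W = interval_pred[OF n]
  have SV: "S \<subseteq> {1..n} - {n}" "n \<in> {1..n}" using S n unfolding W by auto
  have finS: "finite S" using S by (rule finite_subset) simp
  have gen: "\<exists>m\<in>elem_prod {1..n} n S. x = to_jel m"
    if "x \<in> {jmul (jmul g (jadd jone (jmul a (Est n k l)))) (jinv g) | g a k l.
                         g \<in> Eel n \<and> a \<in> pS n S \<and> k \<noteq> l}" for x :: "'k jel"
  proof -
    obtain g a k l where x: "x = jmul (jmul g (jadd jone (jmul a (Est n k l)))) (jinv g)"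
      "g \<in> Eel n" "a \<in> pS n S" "k \<noteq> l"
      using \<open>x \<in> _\<close> by blast
    obtain u v where u: "g = to_jel u" "inv_pair {1..n} u v"
      using Eel_units[OF n x(2)] by blast
    obtain b where b: "a = to_jel (\<Sum>i\<in>S. b i)" "\<forall>i\<in>S. b i \<in> mat_ext i (alg_on ({1..n} - {n} - {i}))"
      using pS_sub[OF S] x(3) unfolding W by blast
    have "1 + (\<Sum>i\<in>S. b i) * E n k l \<in> elem_prod {1..n} n S"
      using b by (intro one_plus_sum_in_elem_prod[OF SV(2,1) x(4) finS]) auto
    \<comment> \<open>Normality under all units is what counts here, since \<open>u\<close> comes
      from the absolute group \<open>Eel\<close>.\<close>
    then have "u * (1 + (\<Sum>i\<in>S. b i) * E n k l) * v \<in> elem_prod {1..n} n S"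
      by (rule elem_prod_conj[OF SV(2,1) u(2)])
    moreover have "x = to_jel (u * (1 + (\<Sum>i\<in>S. b i) * E n k l) * v)"
      by (simp add: x(1) u(1) b(1) jinv_to_jel[OF u(2)] to_jel_E to_jel_1 to_jel_mult to_jel_add)
    ultimately show ?thesis by blast
  qed
  show ?thesis
  proof
    fix f :: "'k jel" assume "f \<in> Erel n (pS n S)"
    then show "f \<in> to_jel ` elem_prod {1..n} n S"
      unfolding Erel_def
    proof (induction rule: grp_gen.induct)
      case gg_one
      then show ?case by (auto simp: to_jel_1 intro: elem_prod_one)
    next
      case (gg_mul g x)
      obtain m where m: "m \<in> elem_prod {1..n} n S" "x = to_jel m" using gen[OF gg_mul.hyps(2)] by blast
      then show ?case using gg_mul.IH elem_prod_mult[OF _ m(1)] by (auto simp: to_jel_mult)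
    next
      case (gg_inv g x)
      obtain m where m: "m \<in> elem_prod {1..n} n S" "x = to_jel m" using gen[OF gg_inv.hyps(2)] by blast
      obtain m' where m': "m' \<in> elem_prod {1..n} n S" "inv_pair {1..n} m m'"
        using elem_prod_inverse[OF SV(2,1) m(1)] by blast
      then have "jinv x = to_jel m'" using jinv_to_jel m by blast
      then show ?case using gg_inv.IH elem_prod_mult[OF _ m'(1)] by (auto simp: to_jel_mult)
    qed
  qed
qed

lemma in_pS:
  fixes a :: "'k::field alg"
  assumes "S \<subseteq> {1..n-1}" "i \<in> S" "a \<in> alg_on {1..n-1}"
  shows "to_jel (a * E i s t) \<in> pS n S"
proof -
  have i: "i \<in> {1..n-1}" using assms by auto
  have XY: "X i ^ s \<in> (alg_on {1..n-1} :: 'k alg set)" "Y i ^ t \<in> (alg_on {1..n-1} :: 'k alg set)"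
    by (rule alg_on_power[OF X_in[OF i]], rule alg_on_power[OF Y_in[OF i]])
  have "to_jel (e0 i) \<in> pS n S"
    unfolding pS_def using assms(2) by (intro ideal_gen.ig_gen UN_I) (auto simp: to_jel_e0 intro: ideal_gen.ig_gen)
  then have "jmul (to_jel a) (jmul (jmul (to_jel (X i ^ s)) (to_jel (e0 i))) (to_jel (Y i ^ t))) \<in> pS n S"
    unfolding pS_def Sn_eq
    by (intro ideal_gen.ig_lmul ideal_gen.ig_rmul imageI XY assms(3))
  then show ?thesis
    by (simp add: to_jel_mult flip: E_eq_e0)
qed

text \<open>For \<open>k \<noteq> l\<close> the factor is a relative generator at once. For
  \<open>k = l\<close> it is off-diagonal only in the variable \<open>i\<close>, and it is written
  as the commutator of a member of \<open>Eel\<close> with a relative generator.\<close>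

lemma gen_in_Erel:
  fixes f a :: "'k::field alg"
  assumes n: "n \<ge> 1" and S: "S \<subseteq> {1..n-1}" "i \<in> S"
    and f: "to_jel f \<in> Erel n (pS n S)" and a: "a \<in> alg_on ({1..n} - {n} - {i})" and ne: "(s, k) \<noteq> (t, l)"
  shows "to_jel (f * (1 + a * E i s t * E n k l)) \<in> Erel n (pS n S)"
proof -
  let ?V = "{1..n}"
  note W = interval_pred[OF n]
  have i: "i \<noteq> n" "i \<in> ?V" "n \<in> ?V" "i \<in> {1..n-1}" using S n unfolding W by auto
  have aW: "a \<in> alg_on {1..n-1}"
    using a alg_on_mono[of "?V - {n} - {i}" "{1..n-1}"] unfolding W by auto
  have one: "inv_pair ?V 1 (1 :: 'k alg)" by (simp add: inv_pair_def)
  have mul: "to_jel (f * (u * (1 + b * E n k l) * v)) \<in> Erel n (pS n S)"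
    if "to_jel f \<in> Erel n (pS n S)" "to_jel u \<in> Eel n" "inv_pair ?V u v" "to_jel b \<in> pS n S" "k \<noteq> l" for f u v b :: "'k alg" and k l
  proof -
    have "to_jel (f * (u * (1 + b * E n k l) * v)) =
        jmul (to_jel f) (jmul (jmul (to_jel u) (jadd jone (jmul (to_jel b) (Est n k l)))) (jinv (to_jel u)))"
      by (simp add: jinv_to_jel[OF that(3)] to_jel_E to_jel_1 to_jel_mult to_jel_add)
    also have "\<dots> \<in> Erel n (pS n S)"
      using that unfolding Erel_def by (intro grp_gen.gg_mul) blast+
    finally show ?thesis .
  qed
  have oneE: "to_jel 1 \<in> (Eel n :: 'k jel set)"
    by (simp add: Eel_def grp_gen.gg_one flip: to_jel_1)
  have elem: "to_jel (f * (1 + b * E i s t * E n k l)) \<in> Erel n (pS n S)"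
    if "to_jel f \<in> Erel n (pS n S)" "k \<noteq> l" "b \<in> alg_on {1..n-1}" for k l s t and f b :: "'k alg"
    using mul[OF that(1) oneE one in_pS[OF S that(3)] that(2)] by simp
  show ?thesis
  proof (cases "k = l")
    case False
    then show ?thesis by (rule elem[OF f _ aW])
  next
    case True
    then have st: "s \<noteq> t" using ne by simp
    \<comment> \<open>The detour runs through the index \<open>Suc k\<close> of \<open>n\<close>,
      while \<open>E i s s\<close> leaves the index \<open>s\<close> of \<open>i\<close> in place;
      \<open>?r * ?c\<close> vanishes because \<open>s \<noteq> t\<close>.\<close>
    let ?c = "1 * E i s s * E n k (Suc k) :: 'k alg"
    let ?r = "a * E i s t * E n (Suc k) k"
    have "?c * ?c = 0" by (subst EE_mult[OF i(1) alg_on_1 alg_on_1]) simp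
    moreover have "?r * ?r = 0" by (subst EE_mult[OF i(1) a a]) simp
    moreover have "?r * ?c = 0" using st by (subst EE_mult[OF i(1) a alg_on_1]) simp
    ultimately have id: "1 + ?c * ?r = (1 + ?c) * (1 + ?r) * (1 + - ?c) * (1 + - ?r)"
      by (rule commutator_identity)
    have cr: "?c * ?r = a * E i s t * E n k k" by (subst EE_mult[OF i(1) alg_on_1 a]) simp
    have inv: "inv_pair ?V (1 + ?c) (1 + - ?c)"
      using gen_inv_pair[OF i(1-3) alg_on_1, of s k s "Suc k"] by simp
    have "to_jel (1 + ?c) = jmul jone (jadd jone (jmul (to_jel (E i s s)) (Est n k (Suc k))))"
      by (simp add: to_jel_E to_jel_1 to_jel_mult to_jel_add)
    also have "\<dots> \<in> Eel n"
    proof -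
      have "to_jel (E i s s) \<in> (Sn (n - 1) :: 'k jel set)"
        unfolding Sn_eq by (rule imageI[OF E_in[OF i(4)]])
      moreover have "k \<noteq> Suc k" by simp
      ultimately show ?thesis
        unfolding Eel_def by (intro grp_gen.gg_mul grp_gen.gg_one) blast
    qed
    finally have cE: "to_jel (1 + ?c) \<in> Eel n" .
    have "to_jel (f * ((1 + ?c) * (1 + ?r) * (1 + - ?c))) \<in> Erel n (pS n S)"
      using mul[OF f cE inv in_pS[OF S aW]] by simp
    then have "to_jel (f * ((1 + ?c) * (1 + ?r) * (1 + - ?c)) * (1 + (- a) * E i s t * E n (Suc k) k)) \<in> Erel n (pS n S)"
      by (rule elem) (simp_all add: aW alg_on_uminus)
    also have "f * ((1 + ?c) * (1 + ?r) * (1 + - ?c)) * (1 + (- a) * E i s t * E n (Suc k) k) = f * (1 + ?c * ?r)"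
      unfolding id by (simp add: mult.assoc)
    finally have "to_jel (f * (1 + a * E i s t * E n k k)) \<in> Erel n (pS n S)"
      unfolding cr .
    then show ?thesis
      using True by simp
  qed
qed

lemma elem_prod_sub_Erel:
  assumes n: "n \<ge> 1" and S: "S \<subseteq> {1..n-1}"
  shows "to_jel ` (elem_prod {1..n} n S :: 'k::field alg set) \<subseteq> Erel n (pS n S)"
proof clarify
  fix m :: "'k alg" assume "m \<in> elem_prod {1..n} n S"
  then show "to_jel m \<in> Erel n (pS n S)"
  proof induction
    case elem_prod_one
    then show ?case by (simp add: Erel_def grp_gen.gg_one flip: to_jel_1)
  next
    case (elem_prod_mul m i g)
    from elem_prod_mul.hyps(3) show ?case
    proof induction
      case elem_grp_one
      then show ?case using elem_prod_mul.IH by simp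
    next
      case (elem_grp_mul g a s k t l)
      then show ?case
        using gen_in_Erel[OF n S elem_prod_mul.hyps(2) elem_grp_mul.IH elem_grp_mul.hyps(2,3)] by (simp add: mult.assoc)
    qed
  qed
qed

lemma one_plus_units_in_elem_prod:
  fixes u :: "'k::field jel"
  assumes n: "n \<ge> 1" and S: "S \<subseteq> {1..n-1}"
    and u: "u \<in> one_plus_units n (ppn n S)" "u \<in> one_plus_units n (ans n 3)"
  shows "u \<in> to_jel ` elem_prod {1..n} n S"
proof -
  let ?V = "{1..n}"
  have SV: "S \<subseteq> ?V - {n}" "n \<in> ?V" using S n unfolding interval_pred[OF n] by auto
  obtain u' v' where u': "u = to_jel u'" "inv_pair ?V u' v'"
    using Units_to_jel[of u n] u(1) by (auto simp: one_plus_units_def)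
  have "to_jel (u' - 1) \<in> ppn n S" and a3: "to_jel (u' - 1) \<in> ans n 3"
    using u unfolding one_plus_units_def u'(1) by (auto simp: to_jel_1 to_jel_diff)
  then obtain g where g: "u' - 1 = (\<Sum>i\<in>S. g i)" "\<forall>i\<in>S. g i \<in> pair_ideal ?V i n"
    using ppn_sub[OF SV] by (fastforce simp: to_jel_inject)
  have "reduce (?V - {n} - {i}) (\<Sum>i\<in>S. g i) = 0" for i
    using ans_sub[of n i] a3 unfolding g(1) by (auto simp: to_jel_inject)
  then have "(\<Sum>i\<in>S. g i) \<in> ideal_span ?V (triple_gens ?V n S)"
    using g(2) by (intro sum_pair_ideal_in_triple_gens) (use SV in auto)
  then have "u' \<in> elem_prod ?V n S"
    using g(1) by (intro units_in_elem_prod[OF _ SV(2,1) u'(2)]) auto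
  then show ?thesis using u'(1) by blast
qed

theorem theorem5p7:
  fixes n :: nat and S :: "nat set" and Is :: "nat set list"
  assumes "n \<ge> 3"
    and "S \<noteq> {}" and "S \<subseteq> {1..n-1}"
    and "distinct Is"
    and "set Is = {I. I \<subseteq> {1..n} \<and> card I = 2 \<and> n \<in> I \<and> I \<inter> S \<noteq> {}}"
  shows "{jmul g u | g u. g \<in> setprod_list (map (Einf n) Is) \<and>
            u \<in> one_plus_units n (ppn n S) \<inter> one_plus_units n (ans n 3)}
         = (Erel n (pS n S) :: 'k::field jel set)"
proof -
  let ?V = "{1..n}"
  have n: "n \<ge> 1" using assms(1) by simp
  have SV: "S \<subseteq> ?V - {n}" "n \<in> ?V" using assms(3) n unfolding interval_pred[OF n] by auto
  have pair: "\<exists>i\<in>S. I = {i, n}" if "I \<in> set Is" for I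
  proof -
    have I: "card I = 2" "n \<in> I" "I \<inter> S \<noteq> {}" using that assms(5) by auto
    then obtain i where i: "i \<in> I" "i \<in> S" by auto
    then have "i \<noteq> n" using SV by auto
    then show ?thesis
      using I i by (auto simp: card_2_iff)
  qed
  \<comment> \<open>Recovers the partners of \<open>n\<close> in the given order, so that every
    enumeration \<open>Is\<close> of the pairs is covered.\<close>
  define js where "js = map (\<lambda>I. THE i. I = {i, n} \<and> i \<noteq> n) Is"
  have the: "(THE i. {k, n} = {i, n} \<and> i \<noteq> n) = k" if "k \<noteq> n" for k
    using that by (intro the_equality) (auto simp: doubleton_eq_iff)
  have kn: "k \<in> S \<Longrightarrow> k \<noteq> n" for k using SV by auto
  have Is: "Is = map (\<lambda>i. {i, n}) js"
    unfolding js_def map_map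
    by (rule map_idI[symmetric]) (use pair the kn in fastforce)
  have js: "set js = S"
  proof (intro equalityI subsetI)
    fix k assume "k \<in> set js"
    then show "k \<in> S" using pair the kn by (fastforce simp: js_def)
  next
    fix k assume k: "k \<in> S"
    have "card {k, n} = 2" using kn[OF k] by simp
    then have "{k, n} \<in> set Is"
      unfolding assms(5) using SV k by auto
    then have "(THE i. {k, n} = {i, n} \<and> i \<noteq> n) \<in> set js"
      unfolding js_def set_map by (rule imageI)
    then show "k \<in> set js"
      by (simp only: the[OF kn[OF k]])
  qed
  have prod: "setprod_list (map (Einf n) Is) = (to_jel ` elem_prod ?V n S :: 'k jel set)"
  proof -
    have "set js \<subseteq> ?V - {n}" using SV js by simp
    then show ?thesis
      unfolding Is by (simp only: setprod_list_Einf elem_prod_list_eq[OF SV(2)] js)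
  qed
  have Er: "Erel n (pS n S) = (to_jel ` elem_prod ?V n S :: 'k jel set)"
    using Erel_sub[OF n assms(3)] elem_prod_sub_Erel[OF n assms(3)] by blast
  show ?thesis
    unfolding prod Er
  proof (intro equalityI subsetI, goal_cases)
    case (1 x)
    then obtain g u where x: "x = jmul (to_jel g) u" "g \<in> elem_prod ?V n S"
      "u \<in> one_plus_units n (ppn n S)" "u \<in> one_plus_units n (ans n 3)" by blast
    \<comment> \<open>The factor \<open>u\<close> already lies in the product of the elementary
      groups and does not enlarge it.\<close>
    obtain m where "u = to_jel m" "m \<in> elem_prod ?V n S"
      using one_plus_units_in_elem_prod[OF n assms(3) x(3,4)] by blast
    then show ?case
      using x(1) elem_prod_mult[OF x(2)] by (auto simp: to_jel_mult)
  next
    case (2 x)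
    then obtain g where g: "x = to_jel g" "g \<in> elem_prod ?V n S" by blast
    \<comment> \<open>For this inclusion the factor \<open>u\<close> is taken to be
      \<open>1\<close>.\<close>
    have "jone \<in> (Units n :: 'k jel set)"
      by (auto simp: Units_def Sn_eq to_jel_1 to_jel_mult intro!: bexI[of _ "to_jel 1"])
    moreover have "jsub jone jone = (jzero :: 'k jel)"
      by (simp add: to_jel_1 to_jel_diff to_jel_0)
    ultimately have "jone \<in> (one_plus_units n (ppn n S) \<inter> one_plus_units n (ans n 3) :: 'k jel set)"
      by (simp add: one_plus_units_def ppn_def ans_def ideal_gen.ig_zero)
    moreover have "x = jmul (to_jel g) jone"
      using g by (simp add: to_jel_1 to_jel_mult)
    ultimately show ?case using g(2) by blast
  qed
qed

end
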